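(* Let $d_L\ge2$, let $\tau:=I_L/d_L$ be the maximally mixed state on $\mathcal H_L=\mathbb C^{d_L}$, and for $0\le p<1$ let $\mathcal N_p$, $\mathcal C_p^{\mathrm{opt}}$ and $\operatorname{tr}_S$ be the noise map, encoder and decoder defined in the context. Then: 1. For every $0\le p<1$, $\mathcal N_p$ is a completely positive trace-preserving map, $\mathcal C_p^{\mathrm{opt}}$ is completely positive and trace preserving, and the pair $(\mathcal C_p^{\mathrm{opt}},\operatorname{tr}_S)$ attains the unrestricted optimum, with $$F^{\mathrm{opt}}(\tau,\mathcal N_p)=1-\frac{p}{d_L^2-2},\qquad\text{i.e.}\qquad \varepsilon^{\mathrm{opt}}(\tau,\mathcal N_p)=\frac{p}{d_L^2-2}.$$ 2. For every $0<p<1$, $\Delta^{\mathrm{opt}}(\tau,\mathcal N_p)>0$. Moreover, whenever CPTNI maps $\mathcal C,\mathcal D$ satisfy $F_{\mathrm e}(\tau,\mathcal D\circ\mathcal N_p\circ\mathcal C)=F^{\mathrm{opt}}(\tau,\mathcal N_p)$, the encoder $\mathcal C$ is of the form $\mathcal C_p^{\mathrm{opt}}\circ\mathcal U$ for some unitary channel $\mathcal U$ on $\mathsf L(\mathcal H_L)$; it has Choi rank at least $d_L$; it maps every pure state on $\mathcal H_L$ to a state of rank $d_L$ (in particular a mixed state); and its entropy exchange on $\tau$ equals $\log_2d_L$.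
   Context: $\mathsf L(\mathcal H)$ is the space of linear operators on $\mathcal H$. CPTNI means completely positive and trace-non-increasing ($\sum_jL_j^\dagger L_j\preceq I$ for Kraus operators $L_j$). For a completely positive map $\Phi$ on $\mathsf L(\mathcal H_L)$ with Kraus operators $F_j$, $F_{\mathrm e}(\rho,\Phi):=\sum_j|\operatorname{tr}(\rho F_j)|^2$. The Choi rank $r_{\mathcal C}$ of $\mathcal C$ is the minimum number of its Kraus operators. For a noise map $\mathcal N$ on $\mathsf L(\mathcal H_C)$, $$F^{\mathrm{opt}}(\rho,\mathcal N):=\max_{\mathcal C,\mathcal D}F_{\mathrm e}(\rho,\mathcal D\circ\mathcal N\circ\mathcal C),\qquad F_1^{\mathrm{opt}}(\rho,\mathcal N):=\max_{\mathcal C,\mathcal D:\,r_{\mathcal C}\le1}F_{\mathrm e}(\rho,\mathcal D\circ\mathcal N\circ\mathcal C),$$ over CPTNI maps $\mathcal C:\mathsf L(\mathcal H_L)\to\mathsf L(\mathcal H_C)$, $\mathcal D:\mathsf L(\mathcal H_C)\to\mathsf L(\mathcal H_L)$; $\varepsilon^{\mathrm{opt}}:=1-F^{\mathrm{opt}}$, $\Delta^{\mathrm{opt}}:=F^{\mathrm{opt}}-F_1^{\mathrm{opt}}$. The entropy exchange of a trace-preserving $\mathcal C$ with Kraus operators $C_i$ on a state $\rho$ is the von Neumann entropy (base 2) of the matrix with entries $\operatorname{tr}(C_i\rho C_j^\dagger)$. Input-first vectorization: for $M:\mathcal H_1\to\mathcal H_2$, $|M\rangle\!\rangle:=\sum_i|i\rangle\otimes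 M|i\rangle\in\mathcal H_1\otimes\mathcal H_2$; the Choi matrix of a map with Kraus operators $L_j$ is $J=\sum_j|L_j\rangle\!\rangle\langle\!\langle L_j|$ (extended linearly to all linear maps). $\mathcal N^\dagger$ is the Hilbert–Schmidt adjoint of $\mathcal N$. Construction. $\mathcal H_S=\mathbb C^{d_L}$, $\mathcal H_C=\mathcal H_L\otimes\mathcal H_S$ (so $d_C=d_L^2$), $|\psi_\tau\rangle:=d_L^{-1/2}\sum_{i=0}^{d_L-1}|i\rangle_L\otimes|i\rangle_S$, $\hat\pi_C:=|\psi_\tau\rangle\langle\psi_\tau|$. For $0\le p<1$ set $$\lambda_1:=1-\tfrac{p}{d_L^2-2},\quad\lambda_4:=\tfrac{d_L^2-1+p}{d_L^2},\quad\lambda_5:=\tfrac{1-p}{d_L^2},\quad\lambda_2:=\tfrac{(1-\lambda_1)(d_L^2\lambda_1-1)}{d_L^2\lambda_4},\quad\lambda_3:=\tfrac{2(1-\lambda_1)^2}{d_L^2\lambda_4},$$ $$Q_p:=\sqrt{d_L}\Big[\sqrt{\tfrac{\lambda_4}{d_L^2-1}}\,(I_C-\hat\pi_C)+\sqrt{\lambda_5}\,\hat\pi_C\Big].$$ The encoder is $\mathcal C_p^{\mathrm{opt}}(\rho):=Q_p(\rho\otimes I_S)Q_p$ and the decoder is the partial trace $\operatorname{tr}_S$ over $\mathcal H_S$. Let $C_i(p):=Q_p(I_L\otimes|i\rangle_S)$, $D_j:=I_L\otimes\langle j|_S$, $B_{ij}(p):=C_i(p)D_j\in\mathsf L(\mathcal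 H_C)$; let $P_p$ be the orthogonal projector onto $\operatorname{span}\{|B_{ij}(p)\rangle\!\rangle\}_{i,j=0}^{d_L-1}\subseteq\mathcal H_C\otimes\mathcal H_C$, $P_p^\perp:=I_{C\otimes C}-P_p$, and $X_p:=\lambda_3I_C+\frac{\lambda_2}{\lambda_4}\hat\pi_C$. The noise map $\mathcal N_p:\mathsf L(\mathcal H_C)\to\mathsf L(\mathcal H_C)$ is defined by $$J(\mathcal N_p^\dagger)=\lambda_1P_p+P_p^\perp(I_C\otimes X_p)P_p^\perp.$$ *)

theory Defs
  imports "Jordan_Normal_Form.Char_Poly" "HOL-Analysis.Analysis"
begin

hide_const (open) Matrix.mat Matrix.vec Matrix.row Matrix.col Determinant.det
hide_type (open) Matrix.mat Matrix.vec
no_notation Matrix.vec_index (infixl \<open>$\<close> 100)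

text \<open>A Hilbert space with orthonormal basis indexed by a finite type \<open>'a\<close> is \<open>complex ^ 'a\<close>, its
  tensor product with \<open>complex ^ 'b\<close> is \<open>complex ^ ('a \<times> 'b)\<close>, and an operator from \<open>complex ^ 'a\<close> to
  \<open>complex ^ 'b\<close> is a matrix of type \<open>complex ^ 'a ^ 'b\<close> (rows indexed by \<open>'b\<close>).\<close>

section \<open>Operators\<close>

definition cinner :: "complex ^ 'a::finite \<Rightarrow> complex ^ 'a \<Rightarrow> complex"
  where "cinner v w = (\<Sum>i\<in>UNIV. cnj (v $ i) * w $ i)"

definition adj :: "complex ^ 'a::finite ^ 'b::finite \<Rightarrow> complex ^ 'b ^ 'a"
  where "adj A = (\<chi> i j. cnj (A $ j $ i))"

definition cscale :: "complex \<Rightarrow> complex ^ 'a::finite ^ 'b::finite \<Rightarrow> complex ^ 'a ^ 'b"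
  where "cscale c A = (\<chi> i j. c * A $ i $ j)"

definition ketbra :: "complex ^ 'a::finite \<Rightarrow> complex ^ 'b::finite \<Rightarrow> complex ^ 'b ^ 'a"
  where "ketbra v w = (\<chi> i j. v $ i * cnj (w $ j))"

definition kron :: "complex ^ 'a::finite ^ 'b::finite \<Rightarrow> complex ^ 'c::finite ^ 'd::finite \<Rightarrow>
    complex ^ ('a \<times> 'c) ^ ('b \<times> 'd)"
  where "kron A B = (\<chi> i j. A $ fst i $ fst j * B $ snd i $ snd j)"

text \<open>\<open>\<real>\<^sub>\<ge>\<^sub>0\<close> is a set of complex numbers here, so hermiticity is included.\<close>

definition psd :: "complex ^ 'a::finite ^ 'a \<Rightarrow> bool"
  where "psd A \<longleftrightarrow> (\<forall>v. cinner v (A *v v) \<in> \<real>\<^sub>\<ge>\<^sub>0)"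

definition unitary :: "complex ^ 'a::finite ^ 'a \<Rightarrow> bool"
  where "unitary U \<longleftrightarrow> adj U ** U = mat 1 \<and> U ** adj U = mat 1"

definition density :: "complex ^ 'a::finite ^ 'a \<Rightarrow> bool"
  where "density \<rho> \<longleftrightarrow> psd \<rho> \<and> trace \<rho> = 1"

definition orth_projector :: "(complex ^ 'a::finite) set \<Rightarrow> complex ^ 'a ^ 'a"
  where "orth_projector V = (THE P. adj P = P \<and> P ** P = P \<and> range ((*v) P) = V)"

section \<open>Maps between operator spaces\<close>

definition clinear_map :: "(complex ^ 'a::finite ^ 'a \<Rightarrow> complex ^ 'b::finite ^ 'b) \<Rightarrow> bool"
  where "clinear_map \<Phi> \<longleftrightarrow> Vector_Spaces.linear cscale cscale \<Phi>"

text \<open>Positivity of \<open>id\<^sub>k \<otimes> \<Phi>\<close> for all \<open>k\<close>: an operator on the \<open>k\<close>-fold direct sum is given by its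
  blocks \<open>A i j\<close> with \<open>i, j < k\<close>, and \<open>id\<^sub>k \<otimes> \<Phi>\<close> acts blockwise.\<close>

definition block_psd :: "nat \<Rightarrow> (nat \<Rightarrow> nat \<Rightarrow> complex ^ 'a::finite ^ 'a) \<Rightarrow> bool"
  where "block_psd k A \<longleftrightarrow> (\<forall>v. (\<Sum>i<k. \<Sum>j<k. cinner (v i) (A i j *v v j)) \<in> \<real>\<^sub>\<ge>\<^sub>0)"

definition completely_positive ::
    "(complex ^ 'a::finite ^ 'a \<Rightarrow> complex ^ 'b::finite ^ 'b) \<Rightarrow> bool"
  where "completely_positive \<Phi> \<longleftrightarrow> clinear_map \<Phi> \<and>
    (\<forall>k A. block_psd k A \<longrightarrow> block_psd k (\<lambda>i j. \<Phi> (A i j)))"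

definition trace_preserving ::
    "(complex ^ 'a::finite ^ 'a \<Rightarrow> complex ^ 'b::finite ^ 'b) \<Rightarrow> bool"
  where "trace_preserving \<Phi> \<longleftrightarrow> (\<forall>\<rho>. trace (\<Phi> \<rho>) = trace \<rho>)"

definition trace_nonincreasing ::
    "(complex ^ 'a::finite ^ 'a \<Rightarrow> complex ^ 'b::finite ^ 'b) \<Rightarrow> bool"
  where "trace_nonincreasing \<Phi> \<longleftrightarrow> (\<forall>\<rho>. psd \<rho> \<longrightarrow> Re (trace (\<Phi> \<rho>)) \<le> Re (trace \<rho>))"

definition cptni :: "(complex ^ 'a::finite ^ 'a \<Rightarrow> complex ^ 'b::finite ^ 'b) \<Rightarrow> bool"
  where "cptni \<Phi> \<longleftrightarrow> completely_positive \<Phi> \<and> trace_nonincreasing \<Phi>"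

definition kraus :: "(complex ^ 'a::finite ^ 'b::finite) list \<Rightarrow>
    (complex ^ 'a ^ 'a \<Rightarrow> complex ^ 'b ^ 'b) \<Rightarrow> bool"
  where "kraus Ks \<Phi> \<longleftrightarrow> (\<forall>\<rho>. \<Phi> \<rho> = (\<Sum>K\<leftarrow>Ks. K ** \<rho> ** adj K))"

definition choi_rank :: "(complex ^ 'a::finite ^ 'a \<Rightarrow> complex ^ 'b::finite ^ 'b) \<Rightarrow> nat"
  where "choi_rank \<Phi> = (LEAST r. \<exists>Ks. length Ks = r \<and> kraus Ks \<Phi>)"

definition unitary_channel :: "complex ^ 'a::finite ^ 'a \<Rightarrow> complex ^ 'a ^ 'a \<Rightarrow> complex ^ 'a ^ 'a"
  where "unitary_channel U \<rho> = U ** \<rho> ** adj U"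

definition hs_inner :: "complex ^ 'a::finite ^ 'b::finite \<Rightarrow> complex ^ 'a ^ 'b \<Rightarrow> complex"
  where "hs_inner A B = trace (adj A ** B)"

definition hs_adjoint :: "(complex ^ 'a::finite ^ 'a \<Rightarrow> complex ^ 'b::finite ^ 'b) \<Rightarrow>
    (complex ^ 'b ^ 'b \<Rightarrow> complex ^ 'a ^ 'a)"
  where "hs_adjoint \<Phi> = (THE \<Psi>. \<forall>A B. hs_inner (\<Psi> A) B = hs_inner A (\<Phi> B))"

text \<open>Input-first vectorization.\<close>

definition vectorize :: "complex ^ 'a::finite ^ 'b::finite \<Rightarrow> complex ^ ('a \<times> 'b)"
  where "vectorize M = (\<chi> k. M $ snd k $ fst k)"

text \<open>The Choi matrix \<open>\<Sum>i j. |i\<rangle>\<langle>j| \<otimes> \<Phi>(|i\<rangle>\<langle>j|)\<close>; it is linear in \<open>\<Phi>\<close> and agrees with the sum of the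
  projections onto the vectorized Kraus operators (lemma \<open>choi_kraus\<close> below).\<close>

definition choi :: "(complex ^ 'a::finite ^ 'a \<Rightarrow> complex ^ 'b::finite ^ 'b) \<Rightarrow>
    complex ^ ('a \<times> 'b) ^ ('a \<times> 'b)"
  where "choi \<Phi> = (\<Sum>i\<in>UNIV. \<Sum>j\<in>UNIV.
    kron (ketbra (axis i 1) (axis j 1)) (\<Phi> (ketbra (axis i 1) (axis j 1))))"

section \<open>Fidelities and entropy\<close>

text \<open>The value does not depend on the chosen Kraus operators (lemma
  \<open>entanglement_fidelity_kraus\<close> below).\<close>

definition entanglement_fidelity ::
    "complex ^ 'a::finite ^ 'a \<Rightarrow> (complex ^ 'a ^ 'a \<Rightarrow> complex ^ 'a ^ 'a) \<Rightarrow> real"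
  where "entanglement_fidelity \<rho> \<Phi> = (\<Sum>F\<leftarrow>(SOME Fs. kraus Fs \<Phi>). (cmod (trace (\<rho> ** F)))\<^sup>2)"

definition F_opt :: "complex ^ 'l::finite ^ 'l \<Rightarrow>
    (complex ^ 'c::finite ^ 'c \<Rightarrow> complex ^ 'c ^ 'c) \<Rightarrow> real"
  where "F_opt \<rho> N = Sup {entanglement_fidelity \<rho> (D \<circ> N \<circ> C) | C D. cptni C \<and> cptni D}"

definition F1_opt :: "complex ^ 'l::finite ^ 'l \<Rightarrow>
    (complex ^ 'c::finite ^ 'c \<Rightarrow> complex ^ 'c ^ 'c) \<Rightarrow> real"
  where "F1_opt \<rho> N =
    Sup {entanglement_fidelity \<rho> (D \<circ> N \<circ> C) | C D. cptni C \<and> cptni D \<and> choi_rank C \<le> 1}"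

definition eps_opt :: "complex ^ 'l::finite ^ 'l \<Rightarrow>
    (complex ^ 'c::finite ^ 'c \<Rightarrow> complex ^ 'c ^ 'c) \<Rightarrow> real"
  where "eps_opt \<rho> N = 1 - F_opt \<rho> N"

definition Delta_opt :: "complex ^ 'l::finite ^ 'l \<Rightarrow>
    (complex ^ 'c::finite ^ 'c \<Rightarrow> complex ^ 'c ^ 'c) \<Rightarrow> real"
  where "Delta_opt \<rho> N = F_opt \<rho> N - F1_opt \<rho> N"

text \<open>Base 2, for hermitian positive semidefinite \<open>W\<close>: the sum runs over the eigenvalues with
  multiplicity, and \<open>0 * log 2 0 = 0\<close>. The size of \<open>W\<close> is a number because the exchange matrix
  below is indexed by a list of Kraus operators of arbitrary length.\<close>

definition vn_entropy :: "complex Matrix.mat \<Rightarrow> real"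
  where "vn_entropy W = - (\<Sum>x\<in>#proots (char_poly W). Re x * log 2 (Re x))"

definition exchange_matrix :: "(complex ^ 'a::finite ^ 'b::finite) list \<Rightarrow> complex ^ 'a ^ 'a \<Rightarrow>
    complex Matrix.mat"
  where "exchange_matrix Cs \<rho> = Matrix.mat (length Cs) (length Cs)
    (\<lambda>(i, j). trace (Cs ! i ** \<rho> ** adj (Cs ! j)))"

definition entropy_exchange :: "(complex ^ 'a::finite ^ 'b::finite) list \<Rightarrow> complex ^ 'a ^ 'a \<Rightarrow> real"
  where "entropy_exchange Cs \<rho> = vn_entropy (exchange_matrix Cs \<rho>)"

section \<open>The construction\<close>

text \<open>The logical space and \<open>S\<close> are both \<open>complex ^ 'n\<close>, so \<open>d\<^sub>L = CARD('n)\<close> and the physical space is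
  \<open>complex ^ ('n \<times> 'n)\<close>, with \<open>L\<close> as the first factor. The basis of \<open>complex ^ 'n\<close> is indexed by \<open>'n\<close>
  instead of \<open>0, \<dots>, d\<^sub>L - 1\<close>. The scalars take \<open>d = d\<^sub>L\<close> as a real argument.\<close>

definition max_mixed :: "complex ^ 'n::finite ^ 'n"
  where "max_mixed = (1 / real CARD('n)) *\<^sub>R mat 1"

definition lam1 :: "real \<Rightarrow> real \<Rightarrow> real"
  where "lam1 d p = 1 - p / (d\<^sup>2 - 2)"

definition lam4 :: "real \<Rightarrow> real \<Rightarrow> real"
  where "lam4 d p = (d\<^sup>2 - 1 + p) / d\<^sup>2"

definition lam5 :: "real \<Rightarrow> real \<Rightarrow> real"
  where "lam5 d p = (1 - p) / d\<^sup>2"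

definition lam2 :: "real \<Rightarrow> real \<Rightarrow> real"
  where "lam2 d p = (1 - lam1 d p) * (d\<^sup>2 * lam1 d p - 1) / (d\<^sup>2 * lam4 d p)"

definition lam3 :: "real \<Rightarrow> real \<Rightarrow> real"
  where "lam3 d p = 2 * (1 - lam1 d p)\<^sup>2 / (d\<^sup>2 * lam4 d p)"

definition psi_tau :: "complex ^ ('n::finite \<times> 'n)"
  where "psi_tau = (1 / sqrt (real CARD('n))) *\<^sub>R (\<chi> k. if fst k = snd k then 1 else 0)"

definition pi_C :: "complex ^ ('n::finite \<times> 'n) ^ ('n \<times> 'n)"
  where "pi_C = ketbra psi_tau psi_tau"

definition Q_op :: "real \<Rightarrow> complex ^ ('n::finite \<times> 'n) ^ ('n \<times> 'n)"
  where "Q_op p = (let d = real CARD('n) in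
    sqrt d *\<^sub>R (sqrt (lam4 d p / (d\<^sup>2 - 1)) *\<^sub>R (mat 1 - pi_C) + sqrt (lam5 d p) *\<^sub>R pi_C))"

definition encoder :: "real \<Rightarrow> complex ^ 'n::finite ^ 'n \<Rightarrow> complex ^ ('n \<times> 'n) ^ ('n \<times> 'n)"
  where "encoder p \<rho> = Q_op p ** kron \<rho> (mat 1) ** Q_op p"

definition tr_S :: "complex ^ ('n::finite \<times> 'n) ^ ('n \<times> 'n) \<Rightarrow> complex ^ 'n ^ 'n"
  where "tr_S M = (\<chi> a b. \<Sum>s\<in>UNIV. M $ (a, s) $ (b, s))"

text \<open>\<open>I\<^sub>L \<otimes> |i\<rangle>\<close>, mapping \<open>L\<close> to \<open>L \<otimes> S\<close>; its adjoint is \<open>I\<^sub>L \<otimes> \<langle>i|\<close>.\<close>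

definition embed_S :: "'n \<Rightarrow> complex ^ 'n::finite ^ ('n \<times> 'n)"
  where "embed_S i = (\<chi> k b. if fst k = b \<and> snd k = i then 1 else 0)"

definition C_op :: "real \<Rightarrow> 'n \<Rightarrow> complex ^ 'n::finite ^ ('n \<times> 'n)"
  where "C_op p i = Q_op p ** embed_S i"

definition D_op :: "'n \<Rightarrow> complex ^ ('n::finite \<times> 'n) ^ 'n"
  where "D_op j = adj (embed_S j)"

definition B_op :: "real \<Rightarrow> 'n \<Rightarrow> 'n \<Rightarrow> complex ^ ('n::finite \<times> 'n) ^ ('n \<times> 'n)"
  where "B_op p i j = C_op p i ** D_op j"

definition P_proj ::
    "real \<Rightarrow> complex ^ (('n::finite \<times> 'n) \<times> ('n \<times> 'n)) ^ (('n \<times> 'n) \<times> ('n \<times> 'n))"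
  where "P_proj p = orth_projector (vec.span {vectorize (B_op p i j) | i j. True})"

definition X_op :: "real \<Rightarrow> complex ^ ('n::finite \<times> 'n) ^ ('n \<times> 'n)"
  where "X_op p = (let d = real CARD('n) in
    lam3 d p *\<^sub>R mat 1 + (lam2 d p / lam4 d p) *\<^sub>R pi_C)"

definition noise_adj_choi ::
    "real \<Rightarrow> complex ^ (('n::finite \<times> 'n) \<times> ('n \<times> 'n)) ^ (('n \<times> 'n) \<times> ('n \<times> 'n))"
  where "noise_adj_choi p = lam1 (real CARD('n)) p *\<^sub>R P_proj p
    + (mat 1 - P_proj p) ** kron (mat 1) (X_op p) ** (mat 1 - P_proj p)"

definition noise_map ::
    "real \<Rightarrow> complex ^ ('n::finite \<times> 'n) ^ ('n \<times> 'n) \<Rightarrow> complex ^ ('n \<times> 'n) ^ ('n \<times> 'n)"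
  where "noise_map p = (THE N. clinear_map N \<and> choi (hs_adjoint N) = noise_adj_choi p)"

section \<open>Consistency of the definitions\<close>

lemma ketbra_axis_nth: "ketbra (axis i 1) (axis j 1) $ a $ b = (if a = i \<and> b = j then 1 else 0)"
  by (auto simp: ketbra_def axis_def)

lemma choi_nth: "choi \<Phi> $ k $ l = \<Phi> (ketbra (axis (fst k) 1) (axis (fst l) 1)) $ snd k $ snd l"
proof -
  have "choi \<Phi> $ k $ l = (\<Sum>i\<in>UNIV. \<Sum>j\<in>UNIV. if j = fst l then (if i = fst k then
      \<Phi> (ketbra (axis i 1) (axis j 1)) $ snd k $ snd l else 0) else 0)"
    unfolding choi_def sum_component kron_def
    by (intro sum.cong refl) (auto simp: ketbra_axis_nth)
  then show ?thesis by (simp add: sum.delta')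
qed

lemma sum_list_nth2: "sum_list (map f xs) $ a $ b = (\<Sum>x\<leftarrow>xs. f x $ a $ b)"
  for f :: "'x \<Rightarrow> complex ^ 'c::finite ^ 'd::finite"
  by (induction xs) auto

lemma kraus_unit_nth:
  "(K ** ketbra (axis i 1) (axis j 1) ** adj K) $ a $ b = K $ a $ i * cnj (K $ b $ j)"
proof -
  have *: "(K ** ketbra (axis i 1) (axis j 1)) $ a $ c = (if c = j then K $ a $ i else 0)" for c
    by (cases "c = j") (simp_all add: matrix_matrix_mult_def ketbra_axis_nth if_distrib sum.delta
        cong: if_cong)
  show ?thesis
    by (simp add: matrix_matrix_mult_def[of "K ** _"] * adj_def if_distrib if_distribR sum.delta
        cong: if_cong)
qed

lemma choi_kraus:
  assumes "kraus Ks \<Phi>"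
  shows "choi \<Phi> = (\<Sum>K\<leftarrow>Ks. ketbra (vectorize K) (vectorize K))"
proof -
  have "\<Phi> (ketbra (axis a 1) (axis c 1)) $ b $ d = (\<Sum>K\<leftarrow>Ks. K $ b $ a * cnj (K $ d $ c))"
    for a b c d
    using assms by (simp add: kraus_def sum_list_nth2 kraus_unit_nth)
  then show ?thesis
    by (simp add: vec_eq_iff choi_nth sum_list_nth2) (simp add: ketbra_def vectorize_def)
qed

lemma cmod_square_trace:
  "complex_of_real ((cmod (trace (\<rho> ** F)))\<^sup>2) = (\<Sum>a\<in>UNIV. \<Sum>b\<in>UNIV. \<Sum>c\<in>UNIV. \<Sum>d\<in>UNIV.
     \<rho> $ a $ b * cnj (\<rho> $ c $ d) * (F $ b $ a * cnj (F $ d $ c)))"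
proof -
  have t: "trace (\<rho> ** F) = (\<Sum>a\<in>UNIV. \<Sum>b\<in>UNIV. \<rho> $ a $ b * F $ b $ a)"
    by (simp add: trace_def matrix_matrix_mult_def)
  have "(\<Sum>a\<in>UNIV. \<Sum>b\<in>UNIV. \<rho> $ a $ b * F $ b $ a)
      * (\<Sum>c\<in>UNIV. \<Sum>d\<in>UNIV. cnj (\<rho> $ c $ d) * cnj (F $ d $ c))
    = (\<Sum>a\<in>UNIV. \<Sum>b\<in>UNIV. (\<rho> $ a $ b * F $ b $ a)
      * (\<Sum>c\<in>UNIV. \<Sum>d\<in>UNIV. cnj (\<rho> $ c $ d) * cnj (F $ d $ c)))"
    unfolding sum_distrib_right ..
  also have "\<dots> = (\<Sum>a\<in>UNIV. \<Sum>b\<in>UNIV. \<Sum>c\<in>UNIV. \<Sum>d\<in>UNIV.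
     (\<rho> $ a $ b * F $ b $ a) * (cnj (\<rho> $ c $ d) * cnj (F $ d $ c)))"
    unfolding sum_distrib_left ..
  finally show ?thesis
    unfolding complex_norm_square t cnj_sum complex_cnj_mult
    by (simp only: mult.assoc mult.left_commute)
qed

lemma entanglement_fidelity_kraus:
  assumes "kraus Fs \<Phi>"
  shows "entanglement_fidelity \<rho> \<Phi> = (\<Sum>F\<leftarrow>Fs. (cmod (trace (\<rho> ** F)))\<^sup>2)"
proof -
  let ?e = "\<lambda>Ks. \<Sum>F\<leftarrow>Ks. (cmod (trace (\<rho> ** F)))\<^sup>2"
  have e: "complex_of_real (?e Ks) = (\<Sum>a\<in>UNIV. \<Sum>b\<in>UNIV. \<Sum>c\<in>UNIV. \<Sum>d\<in>UNIV.
      \<rho> $ a $ b * cnj (\<rho> $ c $ d) * \<Phi> (ketbra (axis a 1) (axis c 1)) $ b $ d)"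
    if "kraus Ks \<Phi>" for Ks
  proof -
    have \<Phi>: "\<Phi> (ketbra (axis a 1) (axis c 1)) $ b $ d = (\<Sum>K\<leftarrow>Ks. K $ b $ a * cnj (K $ d $ c))"
      for a b c d
      using that by (simp add: kraus_def sum_list_nth2 kraus_unit_nth)
    show ?thesis
      unfolding \<Phi>
    proof (induction Ks)
      case (Cons K Ks)
      then show ?case
        by (simp del: of_real_power add: cmod_square_trace distrib_left sum.distrib)
    qed simp
  qed
  have eq: "?e Ks = ?e Fs" if "kraus Ks \<Phi>" for Ks
    using trans[OF e[OF that] e[OF assms, symmetric]] unfolding of_real_eq_iff .
  show ?thesis
    unfolding entanglement_fidelity_def by (rule eq, rule someI[of "\<lambda>Fs. kraus Fs \<Phi>", OF assms])
qed

lemma vector_space_cscale: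
  "vector_space (cscale :: complex \<Rightarrow> complex ^ 'a::finite ^ 'b::finite \<Rightarrow> _)"
  by unfold_locales (auto simp: cscale_def vec_eq_iff algebra_simps)

lemma clinear_map_iff: "clinear_map \<Phi> \<longleftrightarrow>
    (\<forall>A B. \<Phi> (A + B) = \<Phi> A + \<Phi> B) \<and> (\<forall>c A. \<Phi> (cscale c A) = cscale c (\<Phi> A))"
  unfolding clinear_map_def Vector_Spaces.linear_iff by (simp add: vector_space_cscale)

lemma clinear_map_expand:
  assumes "clinear_map \<Phi>"
  shows "\<Phi> A $ k $ l
    = (\<Sum>a\<in>UNIV. \<Sum>b\<in>UNIV. A $ a $ b * \<Phi> (ketbra (axis a 1) (axis b 1)) $ k $ l)"
proof -
  have add: "\<Phi> (A + B) = \<Phi> A + \<Phi> B" and scale: "\<Phi> (cscale c A) = cscale c (\<Phi> A)" for A B c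
    using assms by (auto simp: clinear_map_iff)
  have zero: "\<Phi> 0 = 0"
    using add[of 0 0] by simp
  have sum: "\<Phi> (sum f S) = (\<Sum>x\<in>S. \<Phi> (f x))" if "finite S" for f and S :: "'x set"
    using that by (induction S rule: finite_induct) (auto simp: add zero)
  have "A = (\<Sum>a\<in>UNIV. \<Sum>b\<in>UNIV. cscale (A $ a $ b) (ketbra (axis a 1) (axis b 1)))"
  proof -
    have "(\<Sum>a\<in>UNIV. \<Sum>b\<in>UNIV. cscale (A $ a $ b) (ketbra (axis a 1) (axis b 1))) $ k $ l
      = (\<Sum>a\<in>UNIV. \<Sum>b\<in>UNIV. if b = l then (if a = k then A $ a $ b else 0) else 0)" for k l
      unfolding sum_component cscale_def
      by (intro sum.cong refl) (auto simp: ketbra_axis_nth)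
    then show ?thesis by (simp add: vec_eq_iff sum.delta')
  qed
  then have "\<Phi> A
    = \<Phi> (\<Sum>a\<in>UNIV. \<Sum>b\<in>UNIV. cscale (A $ a $ b) (ketbra (axis a 1) (axis b 1)))" by simp
  then show ?thesis
    by (simp add: sum scale) (simp add: cscale_def)
qed

lemma hs_inner_nth: "hs_inner A B = (\<Sum>k\<in>UNIV. \<Sum>l\<in>UNIV. cnj (A $ k $ l) * B $ k $ l)"
  unfolding hs_inner_def trace_def adj_def matrix_matrix_mult_def
  by (simp, subst sum.swap, simp)

lemma hs_inner_unit: "hs_inner A (ketbra (axis a 1) (axis b 1)) = cnj (A $ a $ b)"
proof -
  have "hs_inner A (ketbra (axis a 1) (axis b 1)) = (\<Sum>k\<in>UNIV. \<Sum>l\<in>UNIV. if l = b then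
      (if k = a then cnj (A $ k $ l) else 0) else 0)"
    unfolding hs_inner_nth by (intro sum.cong refl) (auto simp: ketbra_axis_nth)
  then show ?thesis by (simp add: sum.delta')
qed

lemma hs_inner_cnj: "hs_inner B A = cnj (hs_inner A B)"
  by (simp add: hs_inner_nth mult.commute)

lemma hs_adjoint_unique:
  assumes "\<And>A B. hs_inner (\<Psi> A) B = hs_inner A (\<Phi> B)"
  shows "hs_adjoint \<Phi> = \<Psi>"
  unfolding hs_adjoint_def
proof (rule the_equality)
  fix \<Psi>' assume "\<forall>A B. hs_inner (\<Psi>' A) B = hs_inner A (\<Phi> B)"
  then have "hs_inner (\<Psi>' A) B = hs_inner (\<Psi> A) B" for A B
    using assms by simp
  then have "cnj (\<Psi>' A $ a $ b) = cnj (\<Psi> A $ a $ b)" for A a b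
    by (metis hs_inner_unit)
  then show "\<Psi>' = \<Psi>" by (simp add: fun_eq_iff vec_eq_iff)
qed (use assms in blast)

lemma hs_adjoint_exists:
  assumes "clinear_map \<Phi>"
  obtains \<Psi> where "clinear_map \<Psi>" "\<And>A B. hs_inner (\<Psi> A) B = hs_inner A (\<Phi> B)"
proof
  let ?\<Psi> = "\<lambda>A. \<chi> a b. hs_inner (\<Phi> (ketbra (axis a 1) (axis b 1))) A"
  show "clinear_map ?\<Psi>"
    by (simp add: clinear_map_iff hs_inner_nth vec_eq_iff cscale_def distrib_left sum.distrib
        sum_distrib_left mult.left_commute)
  fix A B
  have "hs_inner A (\<Phi> B) = (\<Sum>k\<in>UNIV. \<Sum>l\<in>UNIV. \<Sum>a\<in>UNIV. \<Sum>b\<in>UNIV.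
      cnj (A $ k $ l) * (B $ a $ b * \<Phi> (ketbra (axis a 1) (axis b 1)) $ k $ l))"
    by (simp add: hs_inner_nth clinear_map_expand[OF assms, of B] sum_distrib_left)
  also have "\<dots> = (\<Sum>k\<in>UNIV. \<Sum>a\<in>UNIV. \<Sum>b\<in>UNIV. \<Sum>l\<in>UNIV.
      cnj (A $ k $ l) * (B $ a $ b * \<Phi> (ketbra (axis a 1) (axis b 1)) $ k $ l))"
    by (intro sum.cong refl, subst sum.swap, intro sum.cong refl, rule sum.swap)
  also have "\<dots> = (\<Sum>a\<in>UNIV. \<Sum>b\<in>UNIV. \<Sum>k\<in>UNIV. \<Sum>l\<in>UNIV.
      cnj (A $ k $ l) * (B $ a $ b * \<Phi> (ketbra (axis a 1) (axis b 1)) $ k $ l))"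
    by (subst sum.swap, intro sum.cong refl, rule sum.swap)
  also have "\<dots> = hs_inner (?\<Psi> A) B"
    by (simp add: hs_inner_nth sum_distrib_right sum_distrib_left mult_ac)
  finally show "hs_inner (?\<Psi> A) B = hs_inner A (\<Phi> B)" by simp
qed

lemma hs_adjoint:
  assumes "clinear_map \<Phi>"
  shows "hs_inner (hs_adjoint \<Phi> A) B = hs_inner A (\<Phi> B)"
    and "clinear_map (hs_adjoint \<Phi>)"
    and "hs_adjoint (hs_adjoint \<Phi>) = \<Phi>"
proof -
  obtain \<Psi> where \<Psi>: "clinear_map \<Psi>" "\<And>A B. hs_inner (\<Psi> A) B = hs_inner A (\<Phi> B)"
    using hs_adjoint_exists[OF assms] by blast
  have eq: "hs_adjoint \<Phi> = \<Psi>"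
    by (rule hs_adjoint_unique) (rule \<Psi>)
  show "hs_inner (hs_adjoint \<Phi> A) B = hs_inner A (\<Phi> B)" "clinear_map (hs_adjoint \<Phi>)"
    using \<Psi> eq by auto
  show "hs_adjoint (hs_adjoint \<Phi>) = \<Phi>"
    unfolding eq by (rule hs_adjoint_unique) (metis \<Psi>(2) hs_inner_cnj)
qed

lemma choi_inj:
  assumes "clinear_map \<Phi>" "clinear_map \<Psi>" "choi \<Phi> = choi \<Psi>"
  shows "\<Phi> = \<Psi>"
proof -
  have "\<Phi> (ketbra (axis a 1) (axis b 1)) $ k $ l = \<Psi> (ketbra (axis a 1) (axis b 1)) $ k $ l"
    for a b k l
    using choi_nth[of \<Phi> "(a, k)" "(b, l)"] choi_nth[of \<Psi> "(a, k)" "(b, l)"] assms(3) by simp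
  then have "\<Phi> A $ k $ l = \<Psi> A $ k $ l" for A k l
    unfolding clinear_map_expand[OF assms(1), of A k l] clinear_map_expand[OF assms(2), of A k l]
    by simp
  then show ?thesis by (simp add: fun_eq_iff vec_eq_iff)
qed

lemma choi_surj:
  obtains \<Phi> where "clinear_map \<Phi>" "choi \<Phi> = J"
proof
  let ?\<Phi> = "\<lambda>A. \<chi> k l. \<Sum>a\<in>UNIV. \<Sum>b\<in>UNIV. A $ a $ b * J $ (a, k) $ (b, l)"
  show "clinear_map ?\<Phi>"
    by (simp add: clinear_map_iff vec_eq_iff cscale_def distrib_right sum.distrib
        sum_distrib_left mult.assoc)
  have "(\<Sum>a\<in>UNIV. \<Sum>b\<in>UNIV. ketbra (axis i 1) (axis j 1) $ a $ b * J $ (a, k) $ (b, l))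
    = J $ (i, k) $ (j, l)" for i j k l
  proof -
    have "(\<Sum>a\<in>UNIV. \<Sum>b\<in>UNIV. ketbra (axis i 1) (axis j 1) $ a $ b * J $ (a, k) $ (b, l))
      = (\<Sum>a\<in>UNIV. \<Sum>b\<in>UNIV. if b = j then (if a = i then J $ (a, k) $ (b, l) else 0) else 0)"
      by (intro sum.cong refl) (auto simp: ketbra_axis_nth)
    then show ?thesis by (simp add: sum.delta')
  qed
  then show "choi ?\<Phi> = J"
    by (simp add: vec_eq_iff choi_nth)
qed

lemma noise_map:
  "clinear_map (noise_map p :: complex ^ ('n::finite \<times> 'n) ^ ('n \<times> 'n) \<Rightarrow> _)"
  "choi (hs_adjoint (noise_map p :: complex ^ ('n \<times> 'n) ^ ('n \<times> 'n) \<Rightarrow> _)) = noise_adj_choi p"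
proof -
  obtain \<Phi> :: "complex ^ ('n \<times> 'n) ^ ('n \<times> 'n) \<Rightarrow> _"
    where \<Phi>: "clinear_map \<Phi>" "choi \<Phi> = noise_adj_choi p"
    using choi_surj by blast
  have "\<exists>!N :: complex ^ ('n \<times> 'n) ^ ('n \<times> 'n) \<Rightarrow> _.
      clinear_map N \<and> choi (hs_adjoint N) = noise_adj_choi p"
  proof (rule ex1I[of _ "hs_adjoint \<Phi>"])
    show "clinear_map (hs_adjoint \<Phi>) \<and> choi (hs_adjoint (hs_adjoint \<Phi>)) = noise_adj_choi p"
      using \<Phi> hs_adjoint[OF \<Phi>(1)] by simp
  next
    fix N :: "complex ^ ('n \<times> 'n) ^ ('n \<times> 'n) \<Rightarrow> _"
    assume N: "clinear_map N \<and> choi (hs_adjoint N) = noise_adj_choi p"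
    then have "hs_adjoint N = \<Phi>"
      using \<Phi> hs_adjoint(2)[of N] by (intro choi_inj) auto
    then show "N = hs_adjoint \<Phi>"
      using N hs_adjoint(3)[of N] by simp
  qed
  from theI'[OF this]
  show "clinear_map (noise_map p :: complex ^ ('n \<times> 'n) ^ ('n \<times> 'n) \<Rightarrow> _)"
    "choi (hs_adjoint (noise_map p :: complex ^ ('n \<times> 'n) ^ ('n \<times> 'n) \<Rightarrow> _)) = noise_adj_choi p"
    unfolding noise_map_def by auto
qed

end

theory Submission
  imports Defs
begin

text \<open>For Kraus operators \<open>C\<^sub>i\<close> and \<open>D\<^sub>j\<close> of an encoder and a decoder, \<open>d\<^sup>2 F\<close> is the sum of the
  quadratic form of \<open>J(\<N>\<^sup>\<dagger>)\<close> over the vectorized products \<open>C\<^sub>i D\<^sub>j\<close>, whose squared norms add up to at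
  most \<open>d\<^sup>2\<close>. The \<open>B\<^sub>i\<^sub>j\<close> are orthonormal, and on the complement of their span the form is at most
  \<open>\<lambda>\<^sub>3 + \<lambda>\<^sub>2/\<lambda>\<^sub>4 < \<lambda>\<^sub>1\<close>. Hence \<open>F \<le> \<lambda>\<^sub>1\<close>, with equality only if every \<open>C\<^sub>i D\<^sub>j\<close> has the form
  \<open>Q (I \<otimes> M\<^sub>i\<^sub>j)\<close> and no trace is lost. This forces \<open>C\<^sub>i = Q (I \<otimes> |m\<^sub>i\<rangle>) U\<^sup>\<dagger>\<close> with \<open>U\<close> unitary. For \<open>p > 0\<close>
  the operator \<open>Q\<^sup>2\<close> is not a multiple of \<open>I\<close>, so that trace preservation of the encoder gives
  \<open>\<Sum>\<^sub>i |m\<^sub>i\<rangle>\<langle>m\<^sub>i| = I\<close>, from which rank, Choi rank and entropy exchange are read off. In particular no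
  encoder of Choi rank one reaches \<open>\<lambda>\<^sub>1\<close>; since the supremum over these is attained by compactness,
  the gap is positive.\<close>

section \<open>Matrices and inner products\<close>

text \<open>\<open>Q_op\<close>, \<open>X_op\<close> and the partial traces that occur all lie in
  the commutative algebra spanned by I - \<pi> and \<pi>, so operator identities become pairs of
  scalar identities. This explains the constants. \<open>lam4 + lam5 = 1\<close> says that both
  partial traces of Q^2 equal I, which yields at once the orthonormality of the
  \<open>B_op p i j\<close> and trace preservation of the encoder. The two eigenvalues of
  \<open>X_op\<close> then solve the two linear equations stating that the adjoint of the noise map
  is unital. Rigidity comes from a transposition: compressing \<pi> by I \<otimes> |m> gives the
  transpose of |m><m| divided by d. Trace preservation of an encoder with vectors m_i therefore
  reads s1 tr(R) I + k R^T = I, where R is the sum of the |m_i><m_i| and k is the difference of the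
  two eigenvalues of Q^2 divided by d. If k is nonzero, this determines R; at p = 0 one has k = 0
  and only tr R is fixed. Compactness enters because \<open>F1_opt\<close> is a supremum: a strict
  inequality for each single pair would only give a weak one.\<close>

lemma sum_UNIV_prod: "(\<Sum>k\<in>UNIV. f k) = (\<Sum>a\<in>UNIV. \<Sum>b\<in>UNIV. f (a, b))"
  for f :: "'a::finite \<times> 'b::finite \<Rightarrow> 'c::comm_monoid_add"
  by (simp add: sum.cartesian_product)

lemma matrix_diff_ldistrib: "A ** (B - C) = A ** B - A ** C"
  for A :: "'a::ring_1 ^ 'n::finite ^ 'm::finite"
  by (simp add: matrix_matrix_mult_def vec_eq_iff right_diff_distrib sum_subtractf)

lemma matrix_diff_rdistrib: "(A - B) ** C = A ** C - B ** C"
  for A :: "'a::ring_1 ^ 'n::finite ^ 'm::finite"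
  by (simp add: matrix_matrix_mult_def vec_eq_iff left_diff_distrib sum_subtractf)

lemma matrix_add_rdistrib: "(A + B) ** C = A ** C + B ** C"
  for A :: "'a::semiring_1 ^ 'n::finite ^ 'm::finite"
  by (simp add: matrix_matrix_mult_def vec_eq_iff distrib_right sum.distrib)

lemma matrix_sum_ldistrib: "A ** (\<Sum>i\<in>I. B i) = (\<Sum>i\<in>I. A ** B i)"
  for A :: "'a::semiring_1 ^ 'n::finite ^ 'm::finite"
  by (induction I rule: infinite_finite_induct) (simp_all add: matrix_add_ldistrib)

lemma matrix_sum_rdistrib: "(\<Sum>i\<in>I. B i) ** A = (\<Sum>i\<in>I. B i ** A)"
  for A :: "'a::semiring_1 ^ 'n::finite ^ 'm::finite"
  by (induction I rule: infinite_finite_induct) (simp_all add: matrix_add_rdistrib)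

lemma matrix_vector_sum_rdistrib: "(\<Sum>i\<in>I. B i) *v v = (\<Sum>i\<in>I. B i *v v)"
  for v :: "'a::semiring_1 ^ 'n::finite"
  by (induction I rule: infinite_finite_induct) (simp_all add: matrix_vector_mult_add_rdistrib)

lemma trace_sum: "trace (\<Sum>i\<in>I. A i) = (\<Sum>i\<in>I. trace (A i))"
  for A :: "'i \<Rightarrow> 'a::comm_semiring_1 ^ 'n::finite ^ 'n"
  unfolding trace_def sum_component by (rule sum.swap)

lemma trace_scaleR: "trace (c *\<^sub>R A) = c *\<^sub>R trace A"
  for A :: "'a::real_algebra_1 ^ 'n::finite ^ 'n"
  by (simp add: trace_def scaleR_sum_right)

lemma scaleR_matrix_vector: "(c *\<^sub>R A) *v v = c *\<^sub>R (A *v v)"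
  for v :: "'a::real_algebra_1 ^ 'n::finite"
  by (simp add: matrix_vector_mult_def vec_eq_iff scaleR_sum_right)

lemma matrix_vector_scaleR: "A *v (c *\<^sub>R v) = c *\<^sub>R (A *v v)"
  for v :: "'a::real_algebra_1 ^ 'n::finite"
  by (simp add: matrix_vector_mult_def vec_eq_iff scaleR_sum_right)

lemma adj_mult: "adj (A ** B) = adj B ** adj A"
  by (simp add: adj_def matrix_matrix_mult_def vec_eq_iff mult.commute)

lemma adj_adj [simp]: "adj (adj A) = A"
  by (simp add: adj_def vec_eq_iff)

lemma adj_mat_1 [simp]: "adj (mat 1) = mat 1"
  by (auto simp: adj_def vec_eq_iff mat_def)

lemma adj_add: "adj (A + B) = adj A + adj B"
  by (simp add: adj_def vec_eq_iff)

lemma adj_diff: "adj (A - B) = adj A - adj B"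
  by (simp add: adj_def vec_eq_iff)

lemma adj_scaleR: "adj (c *\<^sub>R A) = c *\<^sub>R adj A"
  by (simp add: adj_def vec_eq_iff)

lemma adj_sum: "adj (\<Sum>i\<in>I. A i) = (\<Sum>i\<in>I. adj (A i))"
  by (simp add: adj_def vec_eq_iff)

lemma adj_ketbra: "adj (ketbra v w) = ketbra w v"
  by (simp add: adj_def ketbra_def vec_eq_iff)

lemma cinner_add_right: "cinner v (w + w') = cinner v w + cinner v w'"
  by (simp add: cinner_def distrib_left sum.distrib)

lemma cinner_add_left: "cinner (v + v') w = cinner v w + cinner v' w"
  by (simp add: cinner_def distrib_right sum.distrib)

lemma cinner_diff_right: "cinner v (w - w') = cinner v w - cinner v w'"
  by (simp add: cinner_def right_diff_distrib sum_subtractf)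

lemma cinner_diff_left: "cinner (v - v') w = cinner v w - cinner v' w"
  by (simp add: cinner_def left_diff_distrib sum_subtractf)

lemma cinner_scale_right: "cinner v (c *s w) = c * cinner v w"
  by (simp add: cinner_def sum_distrib_left mult_ac)

lemma cinner_scale_left: "cinner (c *s v) w = cnj c * cinner v w"
  by (simp add: cinner_def sum_distrib_left mult_ac)

lemma cinner_sum_right: "cinner v (\<Sum>i\<in>I. w i) = (\<Sum>i\<in>I. cinner v (w i))"
  unfolding cinner_def sum_component sum_distrib_left by (rule sum.swap)

lemma cinner_scaleR_right: "cinner v (c *\<^sub>R w) = of_real c * cinner v w"
  by (simp add: cinner_def scaleR_conv_of_real[where 'a=complex] sum_distrib_left mult_ac)

lemma cnj_cinner: "cnj (cinner v w) = cinner w v"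
  by (simp add: cinner_def mult.commute)

lemma cinner_self: "cinner v v = of_real ((norm v)\<^sup>2)"
proof -
  have "(norm v)\<^sup>2 = (\<Sum>i\<in>UNIV. (cmod (v $ i))\<^sup>2)"
    by (simp add: norm_vec_def L2_set_def sum_nonneg)
  then show ?thesis
    by (simp add: cinner_def complex_norm_square mult.commute del: of_real_power)
qed

lemma cinner_adj_left: "cinner (A *v v) w = cinner v (adj A *v w)"
proof -
  have "cinner (A *v v) w = (\<Sum>i\<in>UNIV. \<Sum>j\<in>UNIV. cnj (A $ i $ j) * cnj (v $ j) * w $ i)"
    by (simp add: cinner_def matrix_vector_mult_def sum_distrib_right)
  also have "\<dots> = (\<Sum>j\<in>UNIV. \<Sum>i\<in>UNIV. cnj (A $ i $ j) * cnj (v $ j) * w $ i)"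
    by (rule sum.swap)
  also have "\<dots> = cinner v (adj A *v w)"
    by (simp add: cinner_def matrix_vector_mult_def adj_def sum_distrib_left mult_ac)
  finally show ?thesis .
qed

lemma cinner_adj_right: "cinner v (A *v w) = cinner (adj A *v v) w"
  by (simp add: cinner_adj_left)

lemma cinner_axis_left: "cinner (axis i 1) v = v $ i"
  by (simp add: cinner_def axis_def if_distrib if_distribR sum.delta cong: if_cong)

lemma ketbra_mult_vec: "ketbra v w *v x = cinner w x *s v"
  by (simp add: ketbra_def matrix_vector_mult_def cinner_def vec_eq_iff sum_distrib_left
      sum_distrib_right mult_ac)

lemma mult_ketbra: "A ** ketbra v w = ketbra (A *v v) w"
  by (simp add: ketbra_def matrix_vector_mult_def matrix_matrix_mult_def vec_eq_iff
      sum_distrib_left sum_distrib_right mult_ac)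

lemma ketbra_mult: "ketbra v w ** A = ketbra v (adj A *v w)"
  by (metis adj_adj adj_ketbra adj_mult mult_ketbra)

lemma trace_ketbra: "trace (ketbra v w) = cinner w v"
  by (simp add: trace_def ketbra_def cinner_def mult.commute)

lemma axis_nth_eq: "axis k (1::complex) $ i = (if i = k then 1 else 0)"
  by (simp add: axis_def)

lemma mult_vec_axis: "(A *v axis k (1::complex)) $ i = A $ i $ k"
  by (simp add: matrix_vector_mult_def axis_def if_distrib if_distribR sum.delta cong: if_cong)

lemma cinner_axis_entry: "cinner (axis i 1) (A *v axis j 1) = A $ i $ j"
  by (simp add: cinner_axis_left mult_vec_axis)

text \<open>The nested Euclidean norm on matrices is the Hilbert-Schmidt norm. Contraction bounds on
  vectors can thus be summed over columns, and \<open>vectorize\<close> is an isometry.\<close>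

lemma norm_matrix_sq:
  fixes M :: "complex ^ 'a::finite ^ 'b::finite"
  shows "(norm M)\<^sup>2 = (\<Sum>i\<in>UNIV. \<Sum>j\<in>UNIV. (cmod (M $ i $ j))\<^sup>2)"
  by (simp add: norm_vec_def L2_set_def sum_nonneg)

lemma norm_matrix_sq_columns:
  fixes M :: "complex ^ 'a::finite ^ 'b::finite"
  shows "(norm M)\<^sup>2 = (\<Sum>k\<in>UNIV. (norm (M *v axis k 1))\<^sup>2)"
proof -
  have "(norm (M *v axis k 1))\<^sup>2 = (\<Sum>i\<in>UNIV. (cmod (M $ i $ k))\<^sup>2)" for k
    by (simp add: norm_vec_def L2_set_def sum_nonneg mult_vec_axis)
  then show ?thesis
    unfolding norm_matrix_sq by (simp only:) (rule sum.swap)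
qed

lemma norm_vectorize:
  fixes M :: "complex ^ 'a::finite ^ 'b::finite"
  shows "norm (vectorize M) = norm M"
proof -
  have "(norm (vectorize M))\<^sup>2 = (\<Sum>k\<in>UNIV. \<Sum>i\<in>UNIV. (cmod (M $ i $ k))\<^sup>2)"
    by (simp add: vectorize_def norm_vec_def L2_set_def sum_nonneg sum.cartesian_product case_prod_beta)
  also have "\<dots> = (norm M)\<^sup>2"
    unfolding norm_matrix_sq by (rule sum.swap)
  finally show ?thesis by (simp add: power2_eq_iff_nonneg)
qed

lemma cinner_vectorize: "cinner (vectorize A) (vectorize B) = hs_inner A B"
proof -
  have "cinner (vectorize A) (vectorize B) = (\<Sum>k\<in>UNIV. \<Sum>i\<in>UNIV. cnj (A $ i $ k) * B $ i $ k)"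
    by (simp add: vectorize_def cinner_def sum.cartesian_product case_prod_beta)
  then show ?thesis
    unfolding hs_inner_nth by (simp only:) (rule sum.swap)
qed

lemma vectorize_inject: "vectorize A = vectorize B \<longleftrightarrow> A = B"
  by (auto simp: vectorize_def vec_eq_iff)

lemma matrix_eq_by_cinner:
  assumes "\<And>v w. cinner v (A *v w) = cinner v (B *v w)"
  shows "A = B"
  using assms[of "axis _ 1" "axis _ 1"] by (simp add: vec_eq_iff cinner_axis_entry)

section \<open>Positive semidefinite matrices\<close>

lemma nonneg_Reals_iff: "z \<in> \<real>\<^sub>\<ge>\<^sub>0 \<longleftrightarrow> Im z = 0 \<and> 0 \<le> Re z"
  by (auto simp: complex_nonneg_Reals_iff)

text \<open>Polarization: reality of the form at \<open>v + w\<close> and at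
  \<open>v + \<i> *s w\<close> compares the imaginary and the real parts of
  \<open>cinner v (A *v w)\<close> and \<open>cinner w (A *v v)\<close>.\<close>

lemma psd_hermitian:
  assumes "psd A"
  shows "adj A = A"
proof -
  have q: "Im (cinner v (A *v v)) = 0" for v
    using assms by (auto simp: psd_def nonneg_Reals_iff)
  have pol: "cinner (v + c *s w) (A *v (v + c *s w)) = cinner v (A *v v) + c * cinner v (A *v w)
      + cnj c * cinner w (A *v v) + cnj c * c * cinner w (A *v w)" for v w c
    by (simp add: cinner_add_left cinner_add_right cinner_scale_left cinner_scale_right
        matrix_vector_right_distrib vector_scalar_commute distrib_left algebra_simps)
  have "cinner w (A *v v) = cnj (cinner v (A *v w))" for v w
  proof -
    have 1: "Im (cinner v (A *v w)) + Im (cinner w (A *v v)) = 0"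
      using q[of "v + 1 *s w"] q[of v] q[of w] unfolding pol by simp
    have 2: "Re (cinner v (A *v w)) - Re (cinner w (A *v v)) = 0"
      using q[of "v + \<i> *s w"] q[of v] q[of w] unfolding pol by simp
    show ?thesis using 1 2 by (simp add: complex_eq_iff)
  qed
  then show ?thesis
    by (intro matrix_eq_by_cinner) (metis cinner_adj_right cnj_cinner adj_adj)
qed

text \<open>With \<open>y = A *v x\<close>, moving from a zero \<open>x\<close> of the form in the
  direction \<open>- y\<close> lowers the form to first order at rate 2 |y|^2, which contradicts
  positivity unless \<open>y = 0\<close>.\<close>

lemma psd_kernel:
  assumes "psd A" "cinner x (A *v x) = 0"
  shows "A *v x = 0"
proof -
  define y where "y = A *v x"
  define q where "q = Re (cinner y (A *v y))"
  have q0: "q \<ge> 0" and qy: "cinner y (A *v y) = of_real q"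
    using assms(1) by (auto simp: psd_def q_def nonneg_Reals_iff complex_eq_iff)
  define n where "n = (norm y)\<^sup>2"
  have yy: "cinner y y = of_real n" by (simp add: cinner_self n_def)
  \<comment> \<open>This step size turns the value - 2 s n + s^2 q of the form at
    \<open>x - s *\<^sub>R y\<close> into - s^2 (q + 2). The summand 1 keeps the denominator
    positive when \<open>q = 0\<close>.\<close>
  define s where "s = n / (q + 1)"
  define z where "z = x - s *\<^sub>R y"
  have Az: "A *v z = y - s *\<^sub>R (A *v y)"
    unfolding z_def by (simp add: matrix_vector_mult_diff_distrib matrix_vector_scaleR y_def)
  have sc: "cinner (r *\<^sub>R v) w = of_real r * cinner v w" for r and v w :: "complex^'a"
    by (metis cnj_cinner cinner_scaleR_right complex_cnj_complex_of_real complex_cnj_mult)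
  have xAy: "cinner x (A *v y) = of_real n"
    by (metis cinner_adj_right psd_hermitian[OF assms(1)] y_def yy)
  have "cinner z (A *v z) = of_real (- 2 * s * n + s\<^sup>2 * q)"
    unfolding Az unfolding z_def cinner_diff_left cinner_diff_right sc cinner_scaleR_right xAy qy yy
    using assms(2) by (simp add: y_def[symmetric] power2_eq_square algebra_simps)
  then have *: "0 \<le> - 2 * s * n + s\<^sup>2 * q"
    using assms(1) unfolding psd_def by (metis Re_complex_of_real nonneg_Reals_iff)
  have "n = 0"
  proof (rule ccontr)
    assume "n \<noteq> 0"
    have "- 2 * s * n + s\<^sup>2 * q = - (s\<^sup>2 * (q + 2))"
    proof -
      have "n = s * (q + 1)" using q0 by (simp add: s_def)
      then show ?thesis by (simp only:) (simp add: power2_eq_square algebra_simps)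
    qed
    moreover have "s\<^sup>2 * (q + 2) > 0"
      using q0 \<open>n \<noteq> 0\<close> by (simp add: s_def)
    ultimately show False using * by linarith
  qed
  then show ?thesis by (simp add: n_def y_def)
qed

lemma psd_diag:
  assumes "psd A"
  shows "Im (A $ i $ i) = 0" "0 \<le> Re (A $ i $ i)"
  using assms[unfolded psd_def, rule_format, of "axis i 1"]
  by (simp_all add: cinner_axis_entry nonneg_Reals_iff)

text \<open>A zero diagonal entry is a zero of the form at a basis vector, so the column vanishes by
  \<open>psd_kernel\<close> and the row by hermiticity.\<close>

lemma psd_diag_zero:
  assumes "psd A" "A $ i $ i = 0"
  shows "A $ j $ i = 0" "A $ i $ j = 0"
proof -
  have "A *v axis i 1 = 0"
    by (rule psd_kernel) (simp_all add: assms cinner_axis_entry)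
  then show 1: "A $ j $ i = 0" for j
    by (metis mult_vec_axis zero_index)
  have "A $ i $ j = cnj (A $ j $ i)"
  proof -
    have "A $ i $ j = adj A $ i $ j" unfolding psd_hermitian[OF assms(1)] ..
    also have "\<dots> = cnj (A $ j $ i)" by (simp add: adj_def)
    finally show ?thesis .
  qed
  then show "A $ i $ j = 0" by (simp add: 1)
qed

text \<open>The form of the Schur complement at \<open>v\<close> is the form of \<open>A\<close> at
  the vector \<open>u\<close> obtained by minimizing along \<open>axis i 1\<close>; hence it stays
  nonnegative.\<close>

lemma psd_schur_step:
  assumes "psd A" "A $ i $ i \<noteq> 0"
  shows "psd (A - inverse (Re (A $ i $ i)) *\<^sub>R ketbra (A *v axis i 1) (A *v axis i 1))"
  unfolding psd_def
proof
  fix v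
  define q where "q = Re (A $ i $ i)"
  have Aii: "A $ i $ i = of_real q"
    using psd_diag[OF assms(1), of i] by (simp add: q_def complex_eq_iff)
  then have q: "q \<noteq> 0" using assms(2) by auto
  define z where "z = cinner (axis i 1) (A *v v)"
  define u where "u = v - (z / of_real q) *s axis i 1"
  have vAi: "cinner v (A *v axis i 1) = cnj z"
    by (metis cinner_adj_right cnj_cinner psd_hermitian[OF assms(1)] z_def)
  have Au: "A *v u = A *v v - (z / of_real q) *s (A *v axis i 1)"
    by (simp add: u_def matrix_vector_mult_diff_distrib vector_scalar_commute)
  have "cinner u (A *v u) = cinner v (A *v v) - z * cnj z / of_real q"
    unfolding Au unfolding u_def cinner_diff_left cinner_diff_right cinner_scale_left
      cinner_scale_right vAi z_def[symmetric] cinner_axis_entry Aii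
    using q by (simp add: field_simps)
  moreover have "cinner v ((A - inverse q *\<^sub>R ketbra (A *v axis i 1) (A *v axis i 1)) *v v)
      = cinner v (A *v v) - z * cnj z / of_real q"
  proof -
    have "cinner (A *v axis i 1) v = z"
      by (metis vAi cnj_cinner complex_cnj_cnj)
    then show ?thesis
      by (simp add: matrix_vector_mult_diff_rdistrib scaleR_matrix_vector ketbra_mult_vec
          cinner_diff_right cinner_scaleR_right cinner_scale_right vAi divide_inverse mult_ac)
  qed
  ultimately show "cinner v ((A - inverse (Re (A $ i $ i)) *\<^sub>R
      ketbra (A *v axis i 1) (A *v axis i 1)) *v v) \<in> \<real>\<^sub>\<ge>\<^sub>0"
    using assms(1) unfolding psd_def q_def by metis
qed

text \<open>Cholesky factorization: each step clears one diagonal entry, and with it a row and a column.\<close>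

lemma psd_factor_aux:
  assumes "finite S" "psd A" "\<And>i. i \<notin> S \<Longrightarrow> A $ i $ i = 0"
  shows "\<exists>u. A = (\<Sum>i\<in>S. ketbra (u i) (u i))"
  using assms
proof (induction S arbitrary: A rule: finite_induct)
  case empty
  then have "A $ j $ i = 0" for i j
    using psd_diag_zero(1)[OF empty(1), of i j] by blast
  then have "A = 0" by (simp add: vec_eq_iff)
  then show ?case by simp
next
  case (insert i S)
  show ?case
  proof (cases "A $ i $ i = 0")
    case True
    obtain u where u: "A = (\<Sum>j\<in>S. ketbra (u j) (u j))"
    proof -
      have "A $ j $ j = 0" if "j \<notin> S" for j
        using insert.prems(2)[of j] that True by (cases "j = i") auto
      then show ?thesis using insert.IH[OF insert.prems(1)] that by blast
    qed
    have "A = (\<Sum>j\<in>insert i S. ketbra ((u(i := 0)) j) ((u(i := 0)) j))"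
      unfolding sum.insert[OF insert.hyps] using insert.hyps(2)
      by (subst u, subst sum.cong[of S S _ "\<lambda>j. ketbra ((u(i := 0)) j) ((u(i := 0)) j)"])
        (auto simp: ketbra_def vec_eq_iff)
    then show ?thesis by blast
  next
    case False
    define q where "q = Re (A $ i $ i)"
    have Aii: "A $ i $ i = of_real q" and "q > 0"
      using psd_diag[OF insert.prems(1), of i] False
      by (auto simp: q_def complex_eq_iff less_le)
    define w where "w = A *v axis i 1"
    define A' where "A' = A - inverse q *\<^sub>R ketbra w w"
    have psd': "psd A'"
      unfolding A'_def q_def w_def by (rule psd_schur_step[OF insert.prems(1) False])
    have "A' $ j $ j = 0" if "j \<notin> S" for j
    proof (cases "j = i")
      case True
      then show ?thesis using \<open>q > 0\<close>
        by (simp add: A'_def w_def ketbra_def mult_vec_axis Aii field_simps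
            scaleR_conv_of_real[where 'a=complex])
    next
      case F: False
      then have "A $ j $ j = 0" using insert.prems(2) that by auto
      then have "A $ j $ i = 0" by (rule psd_diag_zero[OF insert.prems(1)])
      then show ?thesis
        using \<open>A $ j $ j = 0\<close> by (simp add: A'_def w_def ketbra_def mult_vec_axis)
    qed
    then obtain u where u: "A' = (\<Sum>j\<in>S. ketbra (u j) (u j))"
      using insert.IH[OF psd'] by blast
    define u' where "u' = u(i := (1 / sqrt q) *\<^sub>R w)"
    have "ketbra (u' i) (u' i) = inverse q *\<^sub>R ketbra w w"
      using \<open>q > 0\<close> by (simp add: u'_def ketbra_def vec_eq_iff scaleR_conv_of_real[where 'a=complex]
          field_simps flip: of_real_mult)
    moreover have "(\<Sum>j\<in>S. ketbra (u' j) (u' j)) = A'"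
      unfolding u using insert.hyps(2) by (intro sum.cong) (auto simp: u'_def)
    ultimately have "A = (\<Sum>j\<in>insert i S. ketbra (u' j) (u' j))"
      unfolding sum.insert[OF insert.hyps] by (simp add: A'_def)
    then show ?thesis by blast
  qed
qed

lemma psd_factor:
  fixes A :: "complex ^ 'a::finite ^ 'a"
  assumes "psd A"
  obtains u :: "'a \<Rightarrow> complex ^ 'a" where "A = (\<Sum>i\<in>UNIV. ketbra (u i) (u i))"
proof -
  have "\<exists>u. A = (\<Sum>i\<in>(UNIV :: 'a set). ketbra (u i) (u i))"
    by (rule psd_factor_aux) (simp_all add: assms)
  then show ?thesis using that by blast
qed

lemma cinner_sum_ketbra:
  "cinner v ((\<Sum>i\<in>I. ketbra (u i) (u i)) *v v) = of_real (\<Sum>i\<in>I. (cmod (cinner (u i) v))\<^sup>2)"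
proof -
  have "cinner v (ketbra (u i) (u i) *v v) = of_real ((cmod (cinner (u i) v))\<^sup>2)" for i
    unfolding complex_norm_square ketbra_mult_vec cinner_scale_right cnj_cinner by simp
  then show ?thesis
    by (simp add: matrix_vector_sum_rdistrib cinner_sum_right del: of_real_power)
qed

lemma psd_sum_ketbra: "psd (\<Sum>i\<in>I. ketbra (u i) (u i))"
  unfolding psd_def cinner_sum_ketbra by (simp add: sum_nonneg del: of_real_sum)

lemma psd_ketbra: "psd (ketbra v v)"
  using psd_sum_ketbra[of "\<lambda>_. v" "{()}"] by simp

section \<open>Kraus families\<close>

text \<open>Arbitrary finite index sets replace lists, since composition indexes by a product,
  Choi's theorem by pairs of basis labels, and a single operator by the unit type.
  \<open>kraus_iff_kraus_on\<close> and \<open>kraus_on_list\<close> translate between the two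
  forms.\<close>

definition kraus_on ::
  "'i set \<Rightarrow> ('i \<Rightarrow> complex ^ 'a::finite ^ 'b::finite) \<Rightarrow> (complex ^ 'a ^ 'a \<Rightarrow> complex ^ 'b ^ 'b) \<Rightarrow> bool"
  where "kraus_on I K \<Phi> \<longleftrightarrow> finite I \<and> (\<forall>\<rho>. \<Phi> \<rho> = (\<Sum>i\<in>I. K i ** \<rho> ** adj (K i)))"

lemma kraus_onD: "kraus_on I K \<Phi> \<Longrightarrow> \<Phi> \<rho> = (\<Sum>i\<in>I. K i ** \<rho> ** adj (K i))"
  by (simp add: kraus_on_def)

lemma kraus_on_finite: "kraus_on I K \<Phi> \<Longrightarrow> finite I"
  by (simp add: kraus_on_def)

lemma kraus_iff_kraus_on: "kraus Ks \<Phi> \<longleftrightarrow> kraus_on {..<length Ks} (\<lambda>i. Ks ! i) \<Phi>"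
  by (simp add: kraus_def kraus_on_def sum_list_sum_nth atLeast0LessThan)

lemma kraus_on_list:
  assumes "kraus_on I K \<Phi>"
  obtains xs where "distinct xs" "set xs = I" "kraus (map K xs) \<Phi>"
proof -
  obtain xs where xs: "distinct xs" "set xs = I"
    using finite_distinct_list assms by (auto simp: kraus_on_def)
  have "kraus (map K xs) \<Phi>"
    using assms xs by (auto simp: kraus_def kraus_on_def o_def sum_list_distinct_conv_sum_set)
  then show ?thesis using that xs by blast
qed

lemma kraus_on_compose:
  assumes "kraus_on I K \<Phi>" "kraus_on J L \<Psi>"
  shows "kraus_on (I \<times> J) (\<lambda>(i, j). L j ** K i) (\<Psi> \<circ> \<Phi>)"
proof -
  have "(\<Psi> \<circ> \<Phi>) \<rho> = (\<Sum>k\<in>I \<times> J. (case k of (i, j) \<Rightarrow> L j ** K i) ** \<rho> ** adj (case k of (i, j) \<Rightarrow> L j ** K i))"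
    for \<rho>
  proof -
    have "(\<Psi> \<circ> \<Phi>) \<rho> = (\<Sum>j\<in>J. \<Sum>i\<in>I. L j ** (K i ** \<rho> ** adj (K i)) ** adj (L j))"
      by (simp add: kraus_onD[OF assms(1)] kraus_onD[OF assms(2)] matrix_sum_ldistrib
          matrix_sum_rdistrib)
    also have "\<dots> = (\<Sum>i\<in>I. \<Sum>j\<in>J. L j ** (K i ** \<rho> ** adj (K i)) ** adj (L j))"
      by (rule sum.swap)
    finally show ?thesis
      by (simp add: sum.cartesian_product adj_mult matrix_mul_assoc case_prod_beta)
  qed
  then show ?thesis
    using assms by (simp add: kraus_on_def)
qed

lemma clinear_kraus_on:
  fixes K :: "'i \<Rightarrow> complex ^ 'a::finite ^ 'b::finite"
  assumes "kraus_on I K \<Phi>"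
  shows "clinear_map \<Phi>"
proof -
  have "K ** cscale c A ** L = cscale c (K ** A ** L)"
    for c and K :: "complex^'a^'b" and A and L :: "complex^'b^'a"
    by (simp add: cscale_def matrix_matrix_mult_def vec_eq_iff sum_distrib_left sum_distrib_right
        mult_ac)
  moreover have "cscale c (sum f I) = (\<Sum>i\<in>I. cscale c (f i))" for c and f :: "_ \<Rightarrow> complex^'b^'b"
    by (simp add: cscale_def vec_eq_iff sum_distrib_left)
  ultimately show ?thesis
    by (simp add: clinear_map_iff kraus_onD[OF assms] matrix_add_ldistrib matrix_add_rdistrib
        sum.distrib)
qed

lemma sum_nonneg_Reals: "(\<And>i. i \<in> I \<Longrightarrow> f i \<in> \<real>\<^sub>\<ge>\<^sub>0) \<Longrightarrow> sum f I \<in> \<real>\<^sub>\<ge>\<^sub>0"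
  for f :: "_ \<Rightarrow> complex"
  by (simp add: nonneg_Reals_iff sum_nonneg)

text \<open>Each Kraus operator moves to the vectors as its adjoint, so every Kraus term is the form
  of the given block matrix at transformed vectors.\<close>

lemma completely_positive_kraus_on:
  fixes K :: "'i \<Rightarrow> complex ^ 'a::finite ^ 'b::finite"
  assumes "kraus_on I K \<Phi>"
  shows "completely_positive \<Phi>"
  unfolding completely_positive_def
proof (intro conjI allI impI)
  fix k and A :: "nat \<Rightarrow> nat \<Rightarrow> complex ^ 'a ^ 'a" assume A: "block_psd k A"
  show "block_psd k (\<lambda>i j. \<Phi> (A i j))"
    unfolding block_psd_def
  proof
    fix v :: "nat \<Rightarrow> complex ^ 'b"
    have 1: "cinner (v i) (\<Phi> (A i j) *v v j)
        = (\<Sum>l\<in>I. cinner (adj (K l) *v v i) (A i j *v (adj (K l) *v v j)))" for i j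
      by (simp add: kraus_onD[OF assms] matrix_vector_sum_rdistrib cinner_sum_right
          cinner_adj_left matrix_vector_mul_assoc matrix_mul_assoc)
    have "(\<Sum>i<k. \<Sum>j<k. cinner (v i) (\<Phi> (A i j) *v v j))
        = (\<Sum>i<k. \<Sum>l\<in>I. \<Sum>j<k. cinner (adj (K l) *v v i) (A i j *v (adj (K l) *v v j)))"
      unfolding 1 by (intro sum.cong refl sum.swap)
    also have "\<dots> = (\<Sum>l\<in>I. \<Sum>i<k. \<Sum>j<k. cinner (adj (K l) *v v i) (A i j *v (adj (K l) *v v j)))"
      by (rule sum.swap)
    also have "\<dots> \<in> \<real>\<^sub>\<ge>\<^sub>0"
      by (rule sum_nonneg_Reals) (use A[unfolded block_psd_def, rule_format, of "\<lambda>i. adj (K _) *v v i"] in simp)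
    finally show "(\<Sum>i<k. \<Sum>j<k. cinner (v i) (\<Phi> (A i j) *v v j)) \<in> \<real>\<^sub>\<ge>\<^sub>0" .
  qed
qed (rule clinear_kraus_on[OF assms])

text \<open>Choi's theorem: the vectors of a factorization of the Choi matrix are the vectorized Kraus
  operators.\<close>

lemma kraus_on_if_choi_psd:
  fixes \<Phi> :: "complex ^ 'a::finite ^ 'a \<Rightarrow> complex ^ 'b::finite ^ 'b"
  assumes "clinear_map \<Phi>" "psd (choi \<Phi>)"
  obtains K :: "'a \<times> 'b \<Rightarrow> complex ^ 'a ^ 'b" where "kraus_on UNIV K \<Phi>"
    "choi \<Phi> = (\<Sum>i\<in>UNIV. ketbra (vectorize (K i)) (vectorize (K i)))"
proof -
  obtain u :: "'a \<times> 'b \<Rightarrow> _" where u: "choi \<Phi> = (\<Sum>i\<in>UNIV. ketbra (u i) (u i))"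
    using psd_factor[OF assms(2)] .
  define K where "K = (\<lambda>i. \<chi> b a. u i $ (a, b))"
  have vec: "vectorize (K i) = u i" for i
    by (simp add: K_def vectorize_def vec_eq_iff)
  have unit: "\<Phi> (ketbra (axis a 1) (axis c 1)) $ b $ d = (\<Sum>i\<in>UNIV. K i $ b $ a * cnj (K i $ d $ c))"
    for a b c d
    using choi_nth[of \<Phi> "(a, b)" "(c, d)"] unfolding u by (simp add: K_def ketbra_def)
  have "\<Phi> \<rho> = (\<Sum>i\<in>UNIV. K i ** \<rho> ** adj (K i))" for \<rho>
  proof -
    have "\<Phi> \<rho> $ k $ l = (\<Sum>i\<in>UNIV. K i ** \<rho> ** adj (K i)) $ k $ l" for k l
    proof -
      have "\<Phi> \<rho> $ k $ l = (\<Sum>a\<in>UNIV. \<Sum>b\<in>UNIV. \<Sum>i\<in>UNIV. K i $ k $ a * \<rho> $ a $ b * cnj (K i $ l $ b))"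
        unfolding clinear_map_expand[OF assms(1), of \<rho>] unit
        by (simp add: sum_distrib_left mult_ac)
      also have "\<dots> = (\<Sum>a\<in>UNIV. \<Sum>i\<in>UNIV. \<Sum>b\<in>UNIV. K i $ k $ a * \<rho> $ a $ b * cnj (K i $ l $ b))"
        by (intro sum.cong refl sum.swap)
      also have "\<dots> = (\<Sum>i\<in>UNIV. \<Sum>a\<in>UNIV. \<Sum>b\<in>UNIV. K i $ k $ a * \<rho> $ a $ b * cnj (K i $ l $ b))"
        by (rule sum.swap)
      also have "\<dots> = (\<Sum>i\<in>UNIV. \<Sum>b\<in>UNIV. \<Sum>a\<in>UNIV. K i $ k $ a * \<rho> $ a $ b * cnj (K i $ l $ b))"
        by (intro sum.cong refl sum.swap)
      finally show ?thesis
        by (simp add: matrix_matrix_mult_def adj_def sum_distrib_right)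
    qed
    then show ?thesis by (simp add: vec_eq_iff)
  qed
  then have "kraus_on UNIV K \<Phi>" by (simp add: kraus_on_def)
  then show ?thesis using that u vec by simp
qed

text \<open>The Choi matrix is the image under id \<otimes> \<Phi> of the block matrix of matrix
  units, which is the projection onto the unnormalized maximally entangled vector; its form is a
  squared modulus. The enumeration \<open>f\<close> of the basis is there because
  \<open>block_psd\<close> numbers its blocks by naturals.\<close>

lemma choi_psd_if_completely_positive:
  fixes \<Phi> :: "complex ^ 'a::finite ^ 'a \<Rightarrow> complex ^ 'b::finite ^ 'b"
  assumes "completely_positive \<Phi>"
  shows "psd (choi \<Phi>)"
  unfolding psd_def
proof
  fix w :: "complex ^ ('a \<times> 'b)"
  define k where "k = CARD('a)"
  obtain f :: "nat \<Rightarrow> 'a" where f: "bij_betw f {..<k} UNIV"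
    using ex_bij_betw_nat_finite[of "UNIV :: 'a set"] by (auto simp: k_def atLeast0LessThan)
  have sum_f: "(\<Sum>i<k. g (f i)) = (\<Sum>a\<in>UNIV. g a)" for g :: "'a \<Rightarrow> complex"
    by (rule sum.reindex_bij_betw[OF f])
  define E :: "nat \<Rightarrow> nat \<Rightarrow> complex ^ 'a ^ 'a" where "E = (\<lambda>i j. ketbra (axis (f i) 1) (axis (f j) 1))"
  have "block_psd k E"
    unfolding block_psd_def
  proof
    fix v :: "nat \<Rightarrow> complex ^ 'a"
    have "(\<Sum>i<k. \<Sum>j<k. cinner (v i) (E i j *v v j))
        = (\<Sum>i<k. cnj (v i $ f i)) * (\<Sum>j<k. v j $ f j)"
      unfolding sum_product
      by (intro sum.cong refl) (simp add: E_def ketbra_mult_vec cinner_scale_right cinner_axis_left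
          flip: cnj_cinner[of "axis _ _"])
    also have "\<dots> = of_real ((cmod (\<Sum>j<k. v j $ f j))\<^sup>2)"
      unfolding complex_norm_square by (simp add: mult.commute)
    finally show "(\<Sum>i<k. \<Sum>j<k. cinner (v i) (E i j *v v j)) \<in> \<real>\<^sub>\<ge>\<^sub>0"
      by (simp del: of_real_power)
  qed
  then have "block_psd k (\<lambda>i j. \<Phi> (E i j))"
    using assms by (auto simp: completely_positive_def)
  then have "(\<Sum>i<k. \<Sum>j<k. cinner (\<chi> b. w $ (f i, b)) (\<Phi> (E i j) *v (\<chi> b. w $ (f j, b)))) \<in> \<real>\<^sub>\<ge>\<^sub>0"
    unfolding block_psd_def by (elim allE[where x="\<lambda>i. \<chi> b. w $ (f i, b)"])
  also have "(\<Sum>i<k. \<Sum>j<k. cinner (\<chi> b. w $ (f i, b)) (\<Phi> (E i j) *v (\<chi> b. w $ (f j, b))))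
      = (\<Sum>a\<in>UNIV. \<Sum>c\<in>UNIV. cinner (\<chi> b. w $ (a, b))
          (\<Phi> (ketbra (axis a 1) (axis c 1)) *v (\<chi> b. w $ (c, b))))"
    unfolding E_def by (simp only: sum_f[symmetric])
  also have "\<dots> = (\<Sum>a\<in>UNIV. \<Sum>c\<in>UNIV. \<Sum>b\<in>UNIV. \<Sum>d\<in>UNIV. cnj (w $ (a, b)) *
      (choi \<Phi> $ (a, b) $ (c, d) * w $ (c, d)))"
    by (simp add: cinner_def matrix_vector_mult_def choi_nth sum_distrib_left)
  also have "\<dots> = (\<Sum>a\<in>UNIV. \<Sum>b\<in>UNIV. \<Sum>c\<in>UNIV. \<Sum>d\<in>UNIV. cnj (w $ (a, b)) *
      (choi \<Phi> $ (a, b) $ (c, d) * w $ (c, d)))"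
    by (intro sum.cong refl sum.swap)
  also have "\<dots> = cinner w (choi \<Phi> *v w)"
    by (simp add: cinner_def matrix_vector_mult_def sum_distrib_left sum_UNIV_prod)
  finally show "cinner w (choi \<Phi> *v w) \<in> \<real>\<^sub>\<ge>\<^sub>0" .
qed

lemma trace_kraus_term: "trace (K ** \<rho> ** adj K) = trace (adj K ** K ** \<rho>)"
  by (metis matrix_mul_assoc trace_mul_sym)

text \<open>On \<open>ketbra v v\<close> the two conditions are literally the same inequality, and
  \<open>psd_factor\<close> writes every positive operator as a sum of such rank-one
  operators.\<close>

lemma trace_nonincreasing_kraus_on:
  fixes K :: "'i \<Rightarrow> complex ^ 'a::finite ^ 'b::finite"
  assumes "kraus_on I K \<Phi>"
  shows "trace_nonincreasing \<Phi> \<longleftrightarrow> (\<forall>v. (\<Sum>i\<in>I. (norm (K i *v v))\<^sup>2) \<le> (norm v)\<^sup>2)"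
proof -
  have tr: "trace (\<Phi> (ketbra v v)) = of_real (\<Sum>i\<in>I. (norm (K i *v v))\<^sup>2)" for v
    by (simp add: kraus_onD[OF assms] trace_sum mult_ketbra ketbra_mult trace_ketbra cinner_self
        del: of_real_power)
  have tk: "trace (ketbra v v) = of_real ((norm v)\<^sup>2)" for v :: "complex ^ 'a"
    by (simp add: trace_ketbra cinner_self del: of_real_power)
  show ?thesis
  proof
    assume *: "trace_nonincreasing \<Phi>"
    show "\<forall>v. (\<Sum>i\<in>I. (norm (K i *v v))\<^sup>2) \<le> (norm v)\<^sup>2"
    proof
      fix v
      have "Re (trace (\<Phi> (ketbra v v))) \<le> Re (trace (ketbra v v))"
        using * psd_ketbra unfolding trace_nonincreasing_def by blast
      then show "(\<Sum>i\<in>I. (norm (K i *v v))\<^sup>2) \<le> (norm v)\<^sup>2"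
        unfolding tr tk Re_complex_of_real .
    qed
  next
    assume *: "\<forall>v. (\<Sum>i\<in>I. (norm (K i *v v))\<^sup>2) \<le> (norm v)\<^sup>2"
    show "trace_nonincreasing \<Phi>"
      unfolding trace_nonincreasing_def
    proof (intro allI impI)
      fix \<rho> :: "complex ^ 'a ^ 'a" assume "psd \<rho>"
      then obtain u :: "'a \<Rightarrow> _" where u: "\<rho> = (\<Sum>j\<in>UNIV. ketbra (u j) (u j))" by (rule psd_factor)
      have "\<Phi> \<rho> = (\<Sum>j\<in>UNIV. \<Phi> (ketbra (u j) (u j)))"
        unfolding u kraus_onD[OF assms]
        by (simp add: matrix_sum_ldistrib matrix_sum_rdistrib sum.swap[of _ I])
      then have "Re (trace (\<Phi> \<rho>)) = (\<Sum>j\<in>UNIV. \<Sum>i\<in>I. (norm (K i *v u j))\<^sup>2)"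
        by (simp add: trace_sum tr)
      also have "\<dots> \<le> (\<Sum>j\<in>UNIV. (norm (u j))\<^sup>2)"
        by (intro sum_mono) (use * in blast)
      also have "\<dots> = Re (trace \<rho>)"
        by (simp add: u trace_sum tk)
      finally show "Re (trace (\<Phi> \<rho>)) \<le> Re (trace \<rho>)" .
    qed
  qed
qed

lemma cptni_kraus_on:
  fixes \<Phi> :: "complex ^ 'a::finite ^ 'a \<Rightarrow> complex ^ 'b::finite ^ 'b"
  assumes "cptni \<Phi>"
  obtains K :: "'a \<times> 'b \<Rightarrow> complex ^ 'a ^ 'b" where "kraus_on UNIV K \<Phi>"
proof -
  have "completely_positive \<Phi>" using assms by (simp add: cptni_def)
  then have "clinear_map \<Phi>" "psd (choi \<Phi>)"
    using choi_psd_if_completely_positive by (auto simp: completely_positive_def)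
  then show ?thesis using kraus_on_if_choi_psd that by metis
qed

lemma cptni_iff_kraus_on:
  assumes "kraus_on I K \<Phi>"
  shows "cptni \<Phi> \<longleftrightarrow> (\<forall>v. (\<Sum>i\<in>I. (norm (K i *v v))\<^sup>2) \<le> (norm v)\<^sup>2)"
  using trace_nonincreasing_kraus_on[OF assms] completely_positive_kraus_on[OF assms]
  by (simp add: cptni_def)

lemma trace_preserving_kraus_on:
  assumes "kraus_on I K \<Phi>" "(\<Sum>i\<in>I. adj (K i) ** K i) = mat 1"
  shows "trace_preserving \<Phi>"
  unfolding trace_preserving_def
proof
  fix \<rho>
  have "trace (\<Phi> \<rho>) = trace ((\<Sum>i\<in>I. adj (K i) ** K i) ** \<rho>)"
    by (simp add: kraus_onD[OF assms(1)] trace_sum trace_kraus_term matrix_sum_rdistrib)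
  then show "trace (\<Phi> \<rho>) = trace \<rho>" by (simp add: assms(2))
qed

lemma entanglement_fidelity_kraus_on:
  assumes "kraus_on I K \<Phi>"
  shows "entanglement_fidelity \<rho> \<Phi> = (\<Sum>i\<in>I. (cmod (trace (\<rho> ** K i)))\<^sup>2)"
proof -
  obtain xs where "distinct xs" "set xs = I" "kraus (map K xs) \<Phi>"
    using kraus_on_list[OF assms] .
  then show ?thesis
    by (auto simp: entanglement_fidelity_kraus o_def sum_list_distinct_conv_sum_set)
qed

lemma cptni_if_trace_preserving:
  "completely_positive \<Phi> \<Longrightarrow> trace_preserving \<Phi> \<Longrightarrow> cptni \<Phi>"
  by (simp add: cptni_def trace_nonincreasing_def trace_preserving_def)

section \<open>Tensor products\<close>

lemma kron_mult: "kron A B ** kron C E = kron (A ** C) (B ** E)"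
  by (simp add: kron_def matrix_matrix_mult_def vec_eq_iff sum_UNIV_prod sum_product mult_ac)

lemma adj_kron: "adj (kron A B) = kron (adj A) (adj B)"
  by (simp add: kron_def adj_def vec_eq_iff)

lemma kron_mat_1 [simp]: "kron (mat 1) (mat 1) = mat 1"
  by (auto simp: kron_def mat_def vec_eq_iff prod_eq_iff)

lemma kron_sum_right: "kron A (\<Sum>i\<in>I. B i) = (\<Sum>i\<in>I. kron A (B i))"
  by (simp add: kron_def vec_eq_iff sum_distrib_left)

lemma kron_add_right: "kron A (B + C) = kron A B + kron A C"
  by (simp add: kron_def vec_eq_iff distrib_left)

lemma kron_scaleR_right: "kron A (c *\<^sub>R B) = c *\<^sub>R kron A B"
  by (simp add: kron_def vec_eq_iff)

lemma trace_kron: "trace (kron A B) = trace A * trace B"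
  by (simp add: trace_def kron_def sum_UNIV_prod sum_product)

lemma sum_mat_1_left: "(\<Sum>a\<in>UNIV. (mat 1 :: complex ^ 'a::finite ^ 'a) $ i $ a * f a) = f i"
  by (simp add: mat_def if_distrib if_distribR sum.delta cong: if_cong)

lemma vectorize_mult: "vectorize (A ** B) = kron (mat 1) A *v vectorize B"
proof -
  have "(kron (mat 1) A *v vectorize B) $ k
      = (\<Sum>a\<in>UNIV. mat 1 $ fst k $ a * (\<Sum>b\<in>UNIV. A $ snd k $ b * B $ b $ a))" for k
    by (simp add: matrix_vector_mult_def kron_def vectorize_def sum_UNIV_prod sum_distrib_left mult_ac)
  then show ?thesis
    unfolding sum_mat_1_left by (simp add: vec_eq_iff vectorize_def matrix_matrix_mult_def)
qed

lemma sum_axis_ketbra: "(\<Sum>s\<in>UNIV. ketbra (axis s 1) (axis s 1)) = mat 1"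
proof -
  have "(\<Sum>s\<in>UNIV. ketbra (axis s (1::complex)) (axis s 1)) $ i $ j = (\<Sum>s\<in>UNIV. if s = i then if i = j then 1 else 0 else 0)"
    for i j :: 'a
    unfolding sum_component by (intro sum.cong refl) (auto simp: ketbra_axis_nth)
  then show ?thesis by (simp add: vec_eq_iff mat_def)
qed

text \<open>The operator I \<otimes> |m> from L to L \<otimes> S; \<open>embed_S\<close> is the case
  of a basis vector, and a general \<open>m\<close> is what the Kraus operators of an optimal
  encoder involve.\<close>

definition emb :: "complex ^ 'n::finite \<Rightarrow> complex ^ 'n ^ ('n \<times> 'n)"
  where "emb m = (\<chi> k b. if fst k = b then m $ snd k else 0)"

lemma embed_S_eq: "embed_S i = emb (axis i 1)"
  by (auto simp: embed_S_def emb_def vec_eq_iff axis_def)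

lemma emb_scaleR: "emb (r *\<^sub>R x) = r *\<^sub>R emb x"
  by (simp add: emb_def vec_eq_iff)

lemma mult_emb_nth: "(T ** emb m) $ k $ y = (\<Sum>t\<in>UNIV. T $ k $ (y, t) * m $ t)"
proof -
  have "(T ** emb m) $ k $ y = (\<Sum>x\<in>UNIV. \<Sum>t\<in>UNIV. T $ k $ (x, t) * emb m $ (x, t) $ y)"
    by (simp add: matrix_matrix_mult_def sum_UNIV_prod)
  also have "\<dots> = (\<Sum>x\<in>UNIV. if x = y then \<Sum>t\<in>UNIV. T $ k $ (x, t) * m $ t else 0)"
    by (rule sum.cong[OF refl]) (simp add: emb_def)
  finally show ?thesis by simp
qed

lemma adj_emb_mult_nth: "(adj (emb m) ** T) $ x $ y = (\<Sum>s\<in>UNIV. cnj (m $ s) * T $ (x, s) $ y)"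
proof -
  have "(adj (emb m) ** T) $ x $ y = adj (adj T ** emb m) $ x $ y"
    by (simp add: adj_mult)
  also have "\<dots> = cnj ((adj T ** emb m) $ y $ x)"
    by (simp add: adj_def)
  finally show ?thesis
    by (simp add: mult_emb_nth adj_def mult.commute)
qed

lemma kron_mult_emb: "kron (mat 1) M ** emb v = emb (M *v v)"
  unfolding vec_eq_iff mult_emb_nth by (auto simp: kron_def emb_def mat_def matrix_vector_mult_def)

lemma emb_sandwich: "emb m ** A ** adj (emb n) = kron A (ketbra m n)"
proof -
  have 1: "(emb m ** A) $ k $ y = m $ snd k * A $ fst k $ y" for k y
    by (simp add: matrix_matrix_mult_def emb_def if_distrib if_distribR sum.delta cong: if_cong)
  have "(emb m ** A ** adj (emb n)) $ k $ l = m $ snd k * A $ fst k $ fst l * cnj (n $ snd l)" for k l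
  proof -
    have "(emb m ** A ** adj (emb n)) $ k $ l = (\<Sum>b\<in>UNIV. m $ snd k * A $ fst k $ b * cnj (emb n $ l $ b))"
      by (simp add: matrix_matrix_mult_def[of "emb m ** A"] 1 adj_def)
    then show ?thesis
      by (simp add: emb_def if_distrib if_distribR sum.delta' sum.delta cong: if_cong)
  qed
  then show ?thesis
    by (simp add: vec_eq_iff kron_def ketbra_def mult_ac)
qed

lemma adj_emb_emb: "adj (emb m) ** emb n = cscale (cinner m n) (mat 1)"
  unfolding vec_eq_iff adj_emb_mult_nth by (auto simp: cscale_def cinner_def mat_def emb_def)

section \<open>The commutative algebra spanned by \<open>I - \<pi>\<close> and \<open>\<pi>\<close>\<close>

lemma psi_tau_coeff:
  "complex_of_real (1 / sqrt (real CARD('n::finite))) * complex_of_real (1 / sqrt (real CARD('n)))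
    = 1 / of_nat CARD('n)"
  unfolding of_real_mult[symmetric] by simp

lemma cinner_psi_tau: "cinner psi_tau (psi_tau :: complex ^ ('n::finite \<times> 'n)) = 1"
proof -
  have "cinner psi_tau (psi_tau :: complex ^ ('n \<times> 'n))
      = (\<Sum>a\<in>(UNIV :: 'n set). \<Sum>b\<in>UNIV. if b = a then 1 / of_nat CARD('n) else (0 :: complex))"
    unfolding cinner_def sum_UNIV_prod
  proof (intro sum.cong refl)
    fix a b :: 'n
    show "cnj (psi_tau $ (a, b)) * psi_tau $ (a, b) = (if b = a then 1 / of_nat CARD('n) else (0 :: complex))"
      using psi_tau_coeff[where 'n='n]
      by (auto simp: psi_tau_def scaleR_conv_of_real[where 'a=complex])
  qed
  then show ?thesis by simp
qed

lemma pi_C_nth: "(pi_C :: complex ^ ('n::finite \<times> 'n) ^ ('n \<times> 'n)) $ k $ l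
    = (if fst k = snd k \<and> fst l = snd l then 1 / of_nat CARD('n) else 0)"
  using psi_tau_coeff[where 'n='n]
  by (auto simp: pi_C_def ketbra_def psi_tau_def scaleR_conv_of_real[where 'a=complex])

lemma pi_C_idem: "pi_C ** pi_C = pi_C"
  by (simp add: pi_C_def mult_ketbra ketbra_mult_vec cinner_psi_tau)

lemma adj_pi_C: "adj pi_C = pi_C"
  by (simp add: pi_C_def adj_ketbra)

text \<open>\<open>a\<close> and \<open>b\<close> are the eigenvalues on the complement of
  \<open>psi_tau\<close> and on \<open>psi_tau\<close>. Sums, products and inverses act on the pair
  componentwise.\<close>

definition tw :: "real \<Rightarrow> real \<Rightarrow> complex ^ ('n::finite \<times> 'n) ^ ('n \<times> 'n)"
  where "tw a b = a *\<^sub>R (mat 1 - pi_C) + b *\<^sub>R pi_C"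

lemma tw_alt: "tw a b = a *\<^sub>R mat 1 + (b - a) *\<^sub>R pi_C"
  by (simp add: tw_def algebra_simps)

lemma tw_mult: "tw a b ** tw c e = tw (a * c) (b * e)"
  by (simp add: tw_def matrix_add_ldistrib matrix_add_rdistrib matrix_diff_ldistrib
      matrix_diff_rdistrib matrix_scalar_ac scalar_matrix_assoc[symmetric] pi_C_idem algebra_simps)

lemma tw_add: "tw a b + tw c e = tw (a + c) (b + e)"
  by (simp add: tw_def algebra_simps)

lemma tw_diff: "tw a b - tw c e = tw (a - c) (b - e)"
  by (simp add: tw_def algebra_simps)

lemma tw_scaleR: "r *\<^sub>R tw a b = tw (r * a) (r * b)"
  by (simp add: tw_def algebra_simps)

lemma tw_1 [simp]: "tw 1 1 = mat 1"
  by (simp add: tw_def)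

lemma adj_tw [simp]: "adj (tw a b) = tw a b"
  by (simp add: tw_def adj_add adj_scaleR adj_diff adj_pi_C)

lemma tw_inverse:
  assumes "a \<noteq> 0" "b \<noteq> 0"
  shows "tw (1 / a) (1 / b) ** tw a b = mat 1" "tw a b ** tw (1 / a) (1 / b) = mat 1"
  using assms by (simp_all add: tw_mult)

lemma tw_nth: "(tw a b :: complex ^ ('n::finite \<times> 'n) ^ ('n \<times> 'n)) $ k $ l
    = of_real a * (if k = l then 1 else 0)
      + of_real ((b - a) / real CARD('n)) * (if fst k = snd k \<and> fst l = snd l then 1 else 0)"
  by (simp add: tw_def pi_C_nth mat_def scaleR_conv_of_real[where 'a=complex] diff_divide_distrib
      algebra_simps)

text \<open>The reduced state of a maximally entangled vector is I/d.\<close>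

lemma trace_pi_kron:
  "trace (pi_C ** kron (mat 1) (M :: complex ^ 'n::finite ^ 'n)) = trace M / of_nat CARD('n)"
proof -
  have "(pi_C ** kron (mat 1) M) $ (x, y) $ (x, y) = (if y = x then M $ x $ x / of_nat CARD('n) else 0)"
    for x y
  proof -
    have "(pi_C ** kron (mat 1) M) $ (x, y) $ (x, y)
      = (\<Sum>a\<in>UNIV. \<Sum>b\<in>UNIV. pi_C $ (x, y) $ (a, b) * kron (mat 1) M $ (a, b) $ (x, y))"
      by (simp add: matrix_matrix_mult_def sum_UNIV_prod)
    also have "\<dots> = (\<Sum>a\<in>UNIV. \<Sum>b\<in>UNIV. if b = a then (if a = x then (if x = y then M $ x $ x / of_nat CARD('n) else 0) else 0) else 0)"
      by (intro sum.cong refl) (auto simp: pi_C_nth kron_def mat_def)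
    finally show ?thesis by simp
  qed
  then show ?thesis
    by (simp add: trace_def sum_UNIV_prod sum_divide_distrib)
qed

text \<open>The scalar by which a partial trace of \<open>tw a b\<close> multiplies the identity: d
  a comes from I, and (b - a)/d from \<pi>.\<close>

definition tw_trace :: "real \<Rightarrow> real \<Rightarrow> real \<Rightarrow> real"
  where "tw_trace d a b = ((d\<^sup>2 - 1) * a + b) / d"

lemma trace_tw_kron:
  "trace (tw a b ** kron (mat 1) (M :: complex ^ 'n::finite ^ 'n))
    = of_real (tw_trace (real CARD('n)) a b) * trace M"
proof -
  have "trace (tw a b ** kron (mat 1) M)
      = of_real a * (of_nat CARD('n) * trace M - trace M / of_nat CARD('n))
        + of_real b * (trace M / of_nat CARD('n))"
    by (simp add: tw_def matrix_add_rdistrib matrix_diff_rdistrib scalar_matrix_assoc[symmetric]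
        trace_add trace_scaleR trace_sub trace_pi_kron trace_kron trace_I scaleR_conv_of_real[where 'a=complex])
  then show ?thesis
    by (simp add: tw_trace_def field_simps power2_eq_square)
qed

text \<open>The maximally entangled vector carries vectors of S to L with a conjugation, so the part
  of \<open>pi_C\<close> contributes the matrix with entries cnj (m_x) n_y. This is the origin of
  the transpose in \<open>sum_adj_emb_tw_emb\<close>.\<close>

lemma adj_emb_tw_emb:
  "(adj (emb m) ** tw a b ** emb n) $ x $ y
    = of_real a * cinner m n * (if x = y then 1 else 0)
      + of_real ((b - a) / real CARD('n)) * (cnj (m $ x) * n $ y)"
  for m n :: "complex ^ 'n::finite"
proof -
  let ?r = "complex_of_real ((b - a) / real CARD('n))"
  have "(adj (emb m) ** tw a b ** emb n) $ x $ y
      = (\<Sum>s\<in>UNIV. \<Sum>t\<in>UNIV. cnj (m $ s) * (tw a b $ (x, s) $ (y, t) * n $ t))"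
    unfolding matrix_mul_assoc[symmetric] adj_emb_mult_nth mult_emb_nth
    by (simp add: sum_distrib_left)
  also have "\<dots> = (\<Sum>s\<in>UNIV. \<Sum>t\<in>UNIV. (if t = s then if x = y then of_real a * (cnj (m $ s) * n $ s) else 0 else 0)
      + (if t = y then if s = x then ?r * (cnj (m $ x) * n $ y) else 0 else 0))"
    by (intro sum.cong refl) (auto simp: tw_nth algebra_simps)
  also have "\<dots> = (\<Sum>s\<in>UNIV. (if x = y then of_real a * (cnj (m $ s) * n $ s) else 0))
      + ?r * (cnj (m $ x) * n $ y)"
    by (simp add: sum.distrib)
  also have "\<dots> = of_real a * cinner m n * (if x = y then 1 else 0) + ?r * (cnj (m $ x) * n $ y)"
    by (simp add: cinner_def sum_distrib_left)
  finally show ?thesis .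
qed

section \<open>Orthogonal projections and their quadratic forms\<close>

lemma cinner_projection:
  assumes "adj R = R" "R ** R = R"
  shows "cinner w (R *v w) = of_real ((norm (R *v w))\<^sup>2)"
  by (metis assms cinner_adj_right cinner_self matrix_vector_mul_assoc)

lemma norm_projection_split:
  assumes "adj R = R" "R ** R = R"
  shows "(norm w)\<^sup>2 = (norm (R *v w))\<^sup>2 + (norm (w - R *v w))\<^sup>2"
proof -
  have "cinner (w - R *v w) (w - R *v w) = cinner w w - cinner w (R *v w)"
  proof -
    have "cinner (R *v w) w = cinner w (R *v w)" "cinner (R *v w) (R *v w) = cinner w (R *v w)"
      by (simp_all add: cinner_adj_left assms matrix_vector_mul_assoc)
    then show ?thesis by (simp add: cinner_diff_left cinner_diff_right)
  qed
  then have "complex_of_real ((norm (w - R *v w))\<^sup>2) = of_real ((norm w)\<^sup>2 - (norm (R *v w))\<^sup>2)"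
    by (simp only: cinner_self cinner_projection[OF assms] of_real_diff)
  then show ?thesis
    unfolding of_real_eq_iff by simp
qed

text \<open>I \<otimes> \<open>tw a b\<close> is a I plus b - a times a projection, so its form lies
  between those of a I and b I.\<close>

lemma cinner_kron_tw:
  assumes "0 \<le> a" "a \<le> b"
  obtains r where "cinner w (kron (mat 1) (tw a b) *v w) = of_real r" "0 \<le> r" "r \<le> b * (norm w)\<^sup>2"
proof -
  let ?R = "kron (mat 1) pi_C"
  have R: "adj ?R = ?R" "?R ** ?R = ?R"
    by (simp_all add: adj_kron adj_pi_C kron_mult pi_C_idem)
  have tw: "kron (mat 1) (tw a b) = a *\<^sub>R mat 1 + (b - a) *\<^sub>R ?R"
    unfolding tw_alt by (simp add: kron_add_right kron_scaleR_right)
  let ?r = "a * (norm w)\<^sup>2 + (b - a) * (norm (?R *v w))\<^sup>2"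
  have le: "(norm (?R *v w))\<^sup>2 \<le> (norm w)\<^sup>2"
    using norm_projection_split[OF R, of w] by simp
  have "cinner w (kron (mat 1) (tw a b) *v w) = of_real ?r"
    unfolding tw by (simp add: matrix_vector_mult_add_rdistrib scaleR_matrix_vector cinner_add_right
        cinner_scaleR_right cinner_projection[OF R] cinner_self)
  moreover have "0 \<le> ?r" using assms by simp
  moreover have "?r \<le> b * (norm w)\<^sup>2"
    using mult_left_mono[OF le, of "b - a"] assms by (simp add: algebra_simps)
  ultimately show ?thesis by (rule that)
qed

section \<open>Scalars\<close>

text \<open>The last claim is the spectral gap behind optimality. With e = p / (d^2 - 2) < 1/2 one
  has \<open>lam1\<close> = 1 - e > 1/2, whereas \<open>lam3\<close> is at most 1/6 and
  \<open>lam2 / lam4\<close> at most 1/4.\<close>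

lemma lam_bounds:
  fixes d p :: real
  assumes d: "2 \<le> d" and p: "0 \<le> p" "p < 1"
  shows "d\<^sup>2 \<ge> 4" "1 / 2 < lam1 d p" "0 < lam4 d p" "0 < lam5 d p" "lam4 d p + lam5 d p = 1"
    "0 \<le> lam3 d p" "0 \<le> lam2 d p / lam4 d p" "lam3 d p + lam2 d p / lam4 d p < lam1 d p"
proof -
  define D where "D = d\<^sup>2"
  have D: "D \<ge> 4" using power_mono[OF d, of 2] by (simp add: D_def)
  then show "d\<^sup>2 \<ge> 4" by (simp add: D_def)
  define e where "e = p / (D - 2)"
  have e0: "0 \<le> e" using p D by (simp add: e_def)
  have pe: "p = e * (D - 2)" using D by (simp add: e_def)
  have e1: "e < 1 / 2"
  proof -
    have "e \<le> p / 2" unfolding e_def by (rule divide_left_mono) (use p D in auto)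
    then show ?thesis using p by linarith
  qed
  have l1: "lam1 d p = 1 - e" by (simp add: lam1_def e_def D_def)
  show "1 / 2 < lam1 d p" using e1 l1 by simp
  define a where "a = D - 1 + p"
  have a: "a \<ge> D - 1" "a \<ge> 3" using p D by (auto simp: a_def)
  have l4: "lam4 d p = a / D" by (simp add: lam4_def a_def D_def)
  show "0 < lam4 d p" "0 < lam5 d p"
    unfolding l4 lam5_def D_def[symmetric] using a D p by simp_all
  show "lam4 d p + lam5 d p = 1"
    using d by (simp add: lam4_def lam5_def add_divide_distrib[symmetric])
  have l3: "lam3 d p = 2 * e\<^sup>2 / a"
    using D by (simp add: lam3_def l1 l4 D_def[symmetric])
  show "0 \<le> lam3 d p" using a by (simp add: l3)
  have De: "D * e \<le> D - 1"
  proof -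
    have "D * e = p + 2 * e" by (simp add: pe algebra_simps)
    then show ?thesis using p e1 D by linarith
  qed
  have l24: "lam2 d p / lam4 d p = D * e * (D - 1 - D * e) / a\<^sup>2"
    unfolding lam2_def l1 l4 D_def[symmetric] using D a by (simp add: field_simps power2_eq_square)
  show "0 \<le> lam2 d p / lam4 d p"
    unfolding l24 using De D e0 by simp
  \<comment> \<open>The inequality of arithmetic and geometric means for D e and D - 1 - D e, whose
    sum is D - 1.\<close>
  have am: "D * e * (D - 1 - D * e) \<le> (D - 1)\<^sup>2 / 4"
    using zero_le_power2[of "D - 1 - 2 * (D * e)"] by (simp add: power2_eq_square algebra_simps)
  have "(D - 1)\<^sup>2 \<le> a\<^sup>2" using a D by (intro power_mono) auto
  then have "D * e * (D - 1 - D * e) / a\<^sup>2 \<le> 1 / 4"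
    using am a by (simp add: divide_le_eq)
  moreover have "2 * e\<^sup>2 / a \<le> 1 / 6"
  proof -
    have "e\<^sup>2 \<le> (1 / 2)\<^sup>2" using e0 e1 by (intro power_mono) auto
    then have "2 * e\<^sup>2 \<le> a * (1 / 6)" using a by (simp add: power2_eq_square)
    then show ?thesis using a by (simp add: divide_le_eq)
  qed
  ultimately show "lam3 d p + lam2 d p / lam4 d p < lam1 d p"
    unfolding l3 l24 l1 using e1 by linarith
qed

text \<open>The two eigenvalues of \<open>\<N>\<^sup>\<dagger>(I)\<close> are equal to 1.\<close>

lemma lam_unital:
  fixes d p :: real
  assumes d: "2 \<le> d" and p: "0 \<le> p" "p < 1"
  defines "x1 \<equiv> lam3 d p" and "x2 \<equiv> lam3 d p + lam2 d p / lam4 d p"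
    and "q1 \<equiv> d\<^sup>2 * lam4 d p / (d\<^sup>2 - 1)" and "q2 \<equiv> d\<^sup>2 * lam5 d p"
  defines "c \<equiv> lam4 d p * x1 + lam5 d p * x2"
  shows "(lam1 d p + c) * q1 + d\<^sup>2 * x1 - 2 * (q1 * x1) = 1"
    "(lam1 d p + c) * q2 + d\<^sup>2 * x2 - 2 * (q2 * x2) = 1"
proof -
  define D where "D = d\<^sup>2"
  have D: "D \<ge> 4" using lam_bounds(1)[OF assms(1-3)] by (simp add: D_def)
  define e where "e = p / (D - 2)"
  have pe: "p = e * (D - 2)" using D by (simp add: e_def)
  \<comment> \<open>Here p is eliminated in favour of e, so that all scalars are rational functions
    of D and e. Once the denominators are cleared, both claims are polynomial identities in D and
    e.\<close>
  define a where "a = D - 1 + e * (D - 2)"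
  have a: "a > 0" using p D by (simp add: a_def pe[symmetric])
  have l1: "lam1 d p = 1 - e" by (simp add: lam1_def e_def D_def)
  have l4: "lam4 d p = a / D" by (simp add: lam4_def a_def D_def[symmetric] pe[symmetric])
  have l5: "lam5 d p = (D - a) / D" by (simp add: lam5_def a_def D_def[symmetric] pe[symmetric])
  have x1: "x1 = 2 * e\<^sup>2 / a"
    using D by (simp add: x1_def lam3_def l1 l4 D_def[symmetric])
  have x2: "x2 = 2 * e\<^sup>2 / a + D * e * (D - 1 - D * e) / a\<^sup>2"
    unfolding x2_def x1_def[symmetric] x1
    unfolding lam2_def l1 l4 D_def[symmetric] using D a by (simp add: field_simps power2_eq_square)
  have q1: "q1 = a / (D - 1)" and q2: "q2 = D - a"
    using D by (simp_all add: q1_def q2_def l4 l5 D_def[symmetric])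
  have c: "c = 2 * e\<^sup>2 / a + (D - a) * e * (D - 1 - D * e) / a\<^sup>2"
  proof -
    have "c = (a / D + (D - a) / D) * x1 + (D - a) / D * (x2 - x1)"
      unfolding c_def l4 l5 using D by (simp add: field_simps)
    also have "a / D + (D - a) / D = 1" using D by (simp add: add_divide_distrib[symmetric])
    also have "x2 - x1 = D * (e * (D - 1 - D * e) / a\<^sup>2)" by (simp add: x1 x2)
    finally show ?thesis using D by (simp add: x1)
  qed
  have h1: "q1 * (D - 1) = a" using D by (simp add: q1)
  have hx1: "x1 * a = 2 * e\<^sup>2" using a by (simp add: x1)
  have hx2: "x2 * a\<^sup>2 = 2 * e\<^sup>2 * a + D * e * (D - 1 - D * e)"
    unfolding x2 distrib_right using a by (simp add: power2_eq_square)
  have hc: "c * a\<^sup>2 = 2 * e\<^sup>2 * a + (D - a) * e * (D - 1 - D * e)"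
    unfolding c distrib_right using a by (simp add: power2_eq_square)
  have "((lam1 d p + c) * q1 + D * x1 - 2 * (q1 * x1)) * (a * (D - 1)) = 1 * (a * (D - 1))"
  proof -
    have "((lam1 d p + c) * q1 + D * x1 - 2 * (q1 * x1)) * (a * (D - 1))
       = (1 - e + c) * a * (q1 * (D - 1)) + D * (x1 * a) * (D - 1) - 2 * (q1 * (D - 1)) * (x1 * a)"
      unfolding l1 by (simp add: algebra_simps)
    also have "\<dots> = (1 - e) * a\<^sup>2 + c * a\<^sup>2 + D * (2 * e\<^sup>2) * (D - 1) - 2 * a * (2 * e\<^sup>2)"
      unfolding h1 hx1 by (simp add: algebra_simps power2_eq_square)
    also have "\<dots> = 1 * (a * (D - 1))"
      unfolding hc unfolding a_def by (simp add: algebra_simps power2_eq_square)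
    finally show ?thesis .
  qed
  then show "(lam1 d p + c) * q1 + d\<^sup>2 * x1 - 2 * (q1 * x1) = 1"
    unfolding D_def[symmetric] using a D by (simp only: mult_cancel_right) auto
  have "((lam1 d p + c) * q2 + D * x2 - 2 * (q2 * x2)) * a\<^sup>2 = 1 * a\<^sup>2"
  proof -
    have "((lam1 d p + c) * q2 + D * x2 - 2 * (q2 * x2)) * a\<^sup>2
       = ((1 - e) * a\<^sup>2 + c * a\<^sup>2) * q2 + D * (x2 * a\<^sup>2) - 2 * q2 * (x2 * a\<^sup>2)"
      unfolding l1 by (simp add: algebra_simps)
    also have "\<dots> = 1 * a\<^sup>2"
      unfolding hc hx2 q2 unfolding a_def by (simp add: algebra_simps power2_eq_square)
    finally show ?thesis .
  qed
  then show "(lam1 d p + c) * q2 + d\<^sup>2 * x2 - 2 * (q2 * x2) = 1"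
    unfolding D_def[symmetric] using a D by (simp only: mult_cancel_right) auto
qed

section \<open>The projector and the noise map\<close>

definition q1_of :: "real \<Rightarrow> real \<Rightarrow> real" where "q1_of d p = sqrt d * sqrt (lam4 d p / (d\<^sup>2 - 1))"
definition q2_of :: "real \<Rightarrow> real \<Rightarrow> real" where "q2_of d p = sqrt d * sqrt (lam5 d p)"

lemma Q_op_tw: "(Q_op p :: complex ^ ('n::finite \<times> 'n) ^ ('n \<times> 'n))
    = tw (q1_of (real CARD('n)) p) (q2_of (real CARD('n)) p)"
  by (simp add: Q_op_def tw_def Let_def q1_of_def q2_of_def scaleR_add_right)

lemma X_op_tw: "(X_op p :: complex ^ ('n::finite \<times> 'n) ^ ('n \<times> 'n))
    = tw (lam3 (real CARD('n)) p) (lam3 (real CARD('n)) p + lam2 (real CARD('n)) p / lam4 (real CARD('n)) p)"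
  by (simp add: X_op_def tw_alt Let_def)

lemma adj_Q_op [simp]: "adj (Q_op p) = Q_op p"
  by (simp add: Q_op_tw)

lemma q_of_sq:
  assumes "2 \<le> d" "0 \<le> p" "p < 1"
  shows "q1_of d p > 0" "q2_of d p > 0"
    "q1_of d p * q1_of d p = d * lam4 d p / (d\<^sup>2 - 1)" "q2_of d p * q2_of d p = d * lam5 d p"
proof -
  note b = lam_bounds(1,3,4)[OF assms]
  show "q1_of d p > 0" "q2_of d p > 0"
    using b assms by (simp_all add: q1_of_def q2_of_def)
  have "q1_of d p * q1_of d p = (sqrt d * sqrt d) * (sqrt (lam4 d p / (d\<^sup>2 - 1)) * sqrt (lam4 d p / (d\<^sup>2 - 1)))"
    by (simp only: q1_of_def mult_ac)
  then show "q1_of d p * q1_of d p = d * lam4 d p / (d\<^sup>2 - 1)"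
    using b assms by simp
  have "q2_of d p * q2_of d p = (sqrt d * sqrt d) * (sqrt (lam5 d p) * sqrt (lam5 d p))"
    by (simp only: q2_of_def mult_ac)
  then show "q2_of d p * q2_of d p = d * lam5 d p"
    using b assms by simp
qed

text \<open>The partial traces of Q^2 are the identity. The isometry property of
  \<open>V_iso\<close>, trace preservation of the encoder and the trace of the exchange matrix all
  rest on this one normalization.\<close>

lemma tw_trace_Q:
  assumes "2 \<le> d" "0 \<le> p" "p < 1"
  shows "tw_trace d (q1_of d p * q1_of d p) (q2_of d p * q2_of d p) = 1"
proof -
  have "d\<^sup>2 - 1 \<noteq> 0" using lam_bounds(1)[OF assms] by linarith
  then have "tw_trace d (q1_of d p * q1_of d p) (q2_of d p * q2_of d p) = (d * (lam4 d p + lam5 d p)) / d"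
    by (simp add: tw_trace_def q_of_sq(3,4)[OF assms] distrib_left)
  then show ?thesis using lam_bounds(5)[OF assms] assms by simp
qed

definition unvec :: "complex ^ ('n::finite \<times> 'n) \<Rightarrow> complex ^ 'n ^ 'n"
  where "unvec w = (\<chi> i j. w $ (i, j))"

text \<open>\<open>V0\<close> maps \<open>|ij\<rangle>\<close> to the vectorization of \<open>I \<otimes> |i\<rangle>\<langle>j|\<close>, so the columns of \<open>V_iso p\<close> are
  the vectorized \<open>B\<^sub>i\<^sub>j(p)\<close>.\<close>

definition V0 :: "complex ^ ('n::finite \<times> 'n) ^ (('n \<times> 'n) \<times> ('n \<times> 'n))"
  where "V0 = (\<chi> k c. if fst (snd k) = fst (fst k) \<and> snd (snd k) = fst c \<and> snd (fst k) = snd c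
    then 1 else 0)"

definition V_iso :: "real \<Rightarrow> complex ^ ('n::finite \<times> 'n) ^ (('n \<times> 'n) \<times> ('n \<times> 'n))"
  where "V_iso p = kron (mat 1) (Q_op p) ** V0"

lemma V0_vec: "V0 *v w = vectorize (kron (mat 1) (unvec w))"
proof -
  have "(V0 *v w) $ k = vectorize (kron (mat 1) (unvec w)) $ k" for k
  proof -
    have "(V0 *v w) $ k = (\<Sum>i\<in>UNIV. \<Sum>j\<in>UNIV. if j = snd (fst k) then (if i = snd (snd k) then
        (if fst (snd k) = fst (fst k) then w $ (i, j) else 0) else 0) else 0)"
      unfolding matrix_vector_mult_def vec_lambda_beta sum_UNIV_prod
      by (intro sum.cong refl) (auto simp: V0_def)
    also have "\<dots> = (if fst (snd k) = fst (fst k) then w $ (snd (snd k), snd (fst k)) else 0)"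
      by simp
    finally show ?thesis
      by (simp add: vectorize_def kron_def unvec_def mat_def)
  qed
  then show ?thesis by (simp add: vec_eq_iff)
qed

lemma V_iso_vec: "V_iso p *v w = vectorize (Q_op p ** kron (mat 1) (unvec w))"
  by (simp add: V_iso_def matrix_vector_mul_assoc[symmetric] V0_vec vectorize_mult)

lemma hs_inner_unvec: "hs_inner (unvec v) (unvec w) = cinner v w"
  by (simp add: hs_inner_nth unvec_def cinner_def sum_UNIV_prod)

text \<open>The form of I \<otimes> T at the vectorized I \<otimes> M is the trace of T (I \<otimes>
  M \<open>adj M\<close>). The partial trace of T over L is a scalar, so only the Hilbert-Schmidt
  product on S remains.\<close>

lemma V0_sandwich:
  "adj V0 ** kron (mat 1) (tw a b) ** V0
    = tw_trace (real CARD('n)) a b *\<^sub>R (mat 1 :: complex ^ ('n::finite \<times> 'n) ^ ('n \<times> 'n))"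
proof (rule matrix_eq_by_cinner)
  fix v w :: "complex ^ ('n \<times> 'n)"
  have "cinner v ((adj V0 ** kron (mat 1) (tw a b) ** V0) *v w)
      = cinner (V0 *v v) (kron (mat 1) (tw a b) *v (V0 *v w))"
    by (simp add: cinner_adj_left matrix_vector_mul_assoc matrix_mul_assoc)
  also have "\<dots> = hs_inner (kron (mat 1) (unvec v)) (tw a b ** kron (mat 1) (unvec w))"
    by (simp add: V0_vec vectorize_mult[symmetric] cinner_vectorize)
  also have "\<dots> = trace (tw a b ** kron (mat 1) (unvec w ** adj (unvec v)))"
    unfolding hs_inner_def
    by (subst trace_mul_sym) (simp add: adj_kron kron_mult matrix_mul_assoc[symmetric])
  also have "\<dots> = of_real (tw_trace (real CARD('n)) a b) * hs_inner (unvec v) (unvec w)"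
    unfolding trace_tw_kron hs_inner_def by (subst trace_mul_sym) simp
  finally show "cinner v ((adj V0 ** kron (mat 1) (tw a b) ** V0) *v w)
      = cinner v ((tw_trace (real CARD('n)) a b *\<^sub>R mat 1) *v w)"
    by (simp add: hs_inner_unvec scaleR_matrix_vector cinner_scaleR_right)
qed

text \<open>The outer factors \<open>Q_op p\<close> merge with the middle one inside the commutative
  algebra. The case \<open>a = b = 1\<close> gives the isometry property; the eigenvalues of
  \<open>X_op p\<close> give the scalar by which compression with the projector acts.\<close>

lemma V_iso_sandwich:
  fixes p :: real and a b :: real
  defines "d \<equiv> real CARD('n::finite)"
  shows "adj (V_iso p) ** kron (mat 1) (tw a b) ** V_iso p
    = tw_trace d (q1_of d p * q1_of d p * a) (q2_of d p * q2_of d p * b)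
      *\<^sub>R (mat 1 :: complex ^ ('n \<times> 'n) ^ ('n \<times> 'n))"
proof -
  let ?Q = "Q_op p :: complex ^ ('n \<times> 'n) ^ ('n \<times> 'n)"
  have "adj (V_iso p) ** kron (mat 1) (tw a b) ** V_iso p
      = adj V0 ** (kron (mat 1) ?Q ** kron (mat 1) (tw a b) ** kron (mat 1) ?Q) ** V0"
    by (simp add: V_iso_def adj_mult adj_kron matrix_mul_assoc)
  also have "\<dots> = adj V0 ** kron (mat 1) (tw (q1_of d p * q1_of d p * a) (q2_of d p * q2_of d p * b)) ** V0"
    by (simp add: kron_mult Q_op_tw tw_mult d_def mult_ac)
  finally show ?thesis by (simp add: V0_sandwich d_def)
qed

lemma V_iso_isometry:
  fixes p :: real
  assumes "2 \<le> CARD('n::finite)" "0 \<le> p" "p < 1"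
  shows "adj (V_iso p) ** V_iso p = (mat 1 :: complex ^ ('n \<times> 'n) ^ ('n \<times> 'n))"
  using V_iso_sandwich[where 'n='n, of p 1 1] tw_trace_Q[of "real CARD('n)" p] assms by simp

lemma column_V_iso: "V_iso p *v axis c 1 = vectorize (B_op p (fst c) (snd c))"
proof -
  have "unvec (axis c 1) = ketbra (axis (fst c) 1) (axis (snd c) 1)"
    unfolding vec_eq_iff ketbra_axis_nth by (auto simp: unvec_def axis_nth_eq prod_eq_iff)
  moreover have "B_op p (fst c) (snd c) = Q_op p ** kron (mat 1) (ketbra (axis (fst c) 1) (axis (snd c) 1))"
    using emb_sandwich[of "axis (fst c) 1" "mat 1" "axis (snd c) 1"]
    by (simp add: B_op_def C_op_def D_op_def embed_S_eq matrix_mul_assoc[symmetric])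
  ultimately show ?thesis by (simp add: V_iso_vec)
qed

text \<open>Besides the properties of \<open>V ** adj V\<close>, the definite description needs
  uniqueness: hermitian idempotents P and R with the same range satisfy P R = R and R P = P, and
  taking the adjoint of the first gives P = R.\<close>

lemma orth_projector_isometry:
  fixes V :: "complex ^ 'a::finite ^ 'b::finite"
  assumes "adj V ** V = mat 1"
  shows "orth_projector (range ((*v) V)) = V ** adj V"
  unfolding orth_projector_def
proof (rule the_equality)
  have fix_V: "(V ** adj V) *v (V *v w) = V *v w" for w
  proof -
    have "(V ** adj V) *v (V *v w) = V *v ((adj V ** V) *v w)"
      by (simp add: matrix_vector_mul_assoc matrix_mul_assoc)
    then show ?thesis by (simp add: assms)
  qed
  have "V ** adj V ** (V ** adj V) = V ** (adj V ** V) ** adj V" by (simp add: matrix_mul_assoc)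
  then have idem: "V ** adj V ** (V ** adj V) = V ** adj V" by (simp add: assms)
  have sub: "range ((*v) (V ** adj V)) = range ((*v) V)"
  proof (intro equalityI subsetI)
    fix x assume "x \<in> range ((*v) (V ** adj V))"
    then show "x \<in> range ((*v) V)" by (auto simp: matrix_vector_mul_assoc[symmetric])
  next
    fix x assume "x \<in> range ((*v) V)"
    then show "x \<in> range ((*v) (V ** adj V))" using fix_V by (metis rangeE rangeI)
  qed
  show *: "adj (V ** adj V) = V ** adj V \<and> V ** adj V ** (V ** adj V) = V ** adj V
      \<and> range ((*v) (V ** adj V)) = range ((*v) V)"
    using idem sub by (simp add: adj_mult)
  fix P assume P: "adj P = P \<and> P ** P = P \<and> range ((*v) P) = range ((*v) V)"
  have "P ** (V ** adj V) = V ** adj V"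
  proof -
    have "(P ** (V ** adj V)) *v x = (V ** adj V) *v x" for x
    proof -
      have "(V ** adj V) *v x \<in> range ((*v) P)" using sub P by blast
      then obtain y where "(V ** adj V) *v x = P *v y" by blast
      then show ?thesis using P by (metis matrix_vector_mul_assoc)
    qed
    then show ?thesis by (simp add: matrix_eq)
  qed
  moreover have "(V ** adj V) ** P = P"
  proof -
    have "((V ** adj V) ** P) *v x = P *v x" for x
    proof -
      have "P *v x \<in> range ((*v) V)" using P by blast
      then obtain y where y: "P *v x = V *v y" by blast
      then show ?thesis using fix_V[of y] by (simp add: matrix_vector_mul_assoc[symmetric])
    qed
    then show ?thesis by (simp add: matrix_eq)
  qed
  ultimately show "P = V ** adj V"
    using P * by (metis adj_mult)
qed

lemma range_V_iso: "range ((*v) (V_iso p)) = vec.span {vectorize (B_op p i j) | i j. True}"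
proof -
  have cols: "columns (V_iso p) = {vectorize (B_op p i j) | i j. True}"
  proof -
    have "column c (V_iso p) = vectorize (B_op p (fst c) (snd c))" for c
      using column_V_iso[of p c] by (simp add: vec_eq_iff mult_vec_axis column_def)
    then show ?thesis unfolding columns_def by force
  qed
  show ?thesis
  proof (intro equalityI)
    show "range ((*v) (V_iso p)) \<subseteq> vec.span {vectorize (B_op p i j) | i j. True}"
    proof (rule image_subsetI)
      fix w show "V_iso p *v w \<in> vec.span {vectorize (B_op p i j) | i j. True}"
        using matrix_vector_mult_in_columnspace_gen[of "V_iso p" w] unfolding cols .
    qed
    have "vec.subspace (range ((*v) (V_iso p)))"
      unfolding vec.subspace_def
      by (auto simp: image_iff intro: exI[of _ 0])
        (metis matrix_vector_right_distrib, metis vector_scalar_commute)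
    moreover have "{vectorize (B_op p i j) | i j. True} \<subseteq> range ((*v) (V_iso p))"
    proof -
      have "vectorize (B_op p i j) = V_iso p *v axis (i, j) 1" for i j
        using column_V_iso[of p "(i, j)"] by simp
      then show ?thesis by auto
    qed
    ultimately show "vec.span {vectorize (B_op p i j) | i j. True} \<subseteq> range ((*v) (V_iso p))"
      by (rule vec.span_minimal[rotated])
  qed
qed

lemma P_proj_eq:
  fixes p :: real
  assumes "2 \<le> CARD('n::finite)" "0 \<le> p" "p < 1"
  shows "(P_proj p :: complex ^ (('n \<times> 'n) \<times> ('n \<times> 'n)) ^ _) = V_iso p ** adj (V_iso p)"
  unfolding P_proj_def range_V_iso[symmetric]
  by (rule orth_projector_isometry[OF V_iso_isometry[OF assms]])

lemma P_proj_projection: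
  fixes p :: real
  assumes "2 \<le> CARD('n::finite)" "0 \<le> p" "p < 1"
  shows "adj (P_proj p :: complex ^ (('n \<times> 'n) \<times> ('n \<times> 'n)) ^ _) = P_proj p"
    "(P_proj p :: complex ^ (('n \<times> 'n) \<times> ('n \<times> 'n)) ^ _) ** P_proj p = P_proj p"
proof -
  show "adj (P_proj p :: complex ^ (('n \<times> 'n) \<times> ('n \<times> 'n)) ^ _) = P_proj p"
    by (simp add: P_proj_eq[OF assms] adj_mult)
  have "V_iso p ** adj (V_iso p) ** (V_iso p ** adj (V_iso p))
      = V_iso p ** (adj (V_iso p) ** V_iso p) ** adj (V_iso p :: complex ^ ('n \<times> 'n) ^ _)"
    by (simp add: matrix_mul_assoc)
  then show "(P_proj p :: complex ^ (('n \<times> 'n) \<times> ('n \<times> 'n)) ^ _) ** P_proj p = P_proj p"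
    by (simp add: P_proj_eq[OF assms] V_iso_isometry[OF assms])
qed

text \<open>The two summands of the Choi matrix act on orthogonal subspaces: as \<open>lam1\<close>
  on the range of the projector, and by at most the larger eigenvalue of \<open>X_op\<close> on the
  complement. The bound keeps the distance from the range explicit, so that equality in it can be
  exploited later.\<close>

lemma noise_adj_choi_form:
  fixes p :: real and v :: "complex ^ (('n::finite \<times> 'n) \<times> ('n \<times> 'n))"
  assumes "2 \<le> CARD('n)" "0 \<le> p" "p < 1"
  defines "d \<equiv> real CARD('n)"
  obtains r where "cinner v (noise_adj_choi p *v v) = of_real r" "0 \<le> r"
    "r \<le> lam1 d p * (norm v)\<^sup>2
      - (lam1 d p - (lam3 d p + lam2 d p / lam4 d p)) * (norm (v - P_proj p *v v))\<^sup>2"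
    "P_proj p *v v = v \<Longrightarrow> r = lam1 d p * (norm v)\<^sup>2"
proof -
  let ?P = "P_proj p :: complex ^ (('n \<times> 'n) \<times> ('n \<times> 'n)) ^ _"
  note PP = P_proj_projection[OF assms(1-3)]
  have d: "2 \<le> d" using assms(1) by (simp add: d_def)
  note b = lam_bounds[OF d assms(2,3)]
  define w where "w = v - ?P *v v"
  let ?x = "lam3 d p + lam2 d p / lam4 d p"
  have w: "(mat 1 - ?P) *v v = w"
    by (simp add: w_def matrix_vector_mult_diff_rdistrib)
  obtain r where r: "cinner w (kron (mat 1) (X_op p) *v w) = of_real r" "0 \<le> r" "r \<le> ?x * (norm w)\<^sup>2"
    using cinner_kron_tw[of "lam3 d p" ?x w] b by (auto simp: X_op_tw d_def)
  have "cinner v (noise_adj_choi p *v v)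
      = of_real (lam1 d p) * cinner v (?P *v v) + cinner v (((mat 1 - ?P) ** kron (mat 1) (X_op p) ** (mat 1 - ?P)) *v v)"
    by (simp add: noise_adj_choi_def d_def matrix_vector_mult_add_rdistrib scaleR_matrix_vector
        cinner_add_right cinner_scaleR_right)
  also have "cinner v (((mat 1 - ?P) ** kron (mat 1) (X_op p) ** (mat 1 - ?P)) *v v)
      = cinner ((mat 1 - ?P) *v v) (kron (mat 1) (X_op p) *v ((mat 1 - ?P) *v v))"
    by (simp add: cinner_adj_left adj_diff PP matrix_vector_mul_assoc matrix_mul_assoc)
  finally have eq: "cinner v (noise_adj_choi p *v v) = of_real (lam1 d p * (norm (?P *v v))\<^sup>2 + r)"
    unfolding w r(1) cinner_projection[OF PP] by simp
  have split: "(norm v)\<^sup>2 = (norm (?P *v v))\<^sup>2 + (norm w)\<^sup>2"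
    unfolding w_def by (rule norm_projection_split[OF PP])
  show ?thesis
  proof (rule that[OF eq])
    show "0 \<le> lam1 d p * (norm (?P *v v))\<^sup>2 + r" using b r by simp
    show "lam1 d p * (norm (?P *v v))\<^sup>2 + r \<le> lam1 d p * (norm v)\<^sup>2
      - (lam1 d p - ?x) * (norm (v - ?P *v v))\<^sup>2"
      using r(3) unfolding split w_def[symmetric] by (simp add: algebra_simps)
    assume "?P *v v = v"
    then show "lam1 d p * (norm (?P *v v))\<^sup>2 + r = lam1 d p * (norm v)\<^sup>2"
      using r by (simp add: w_def)
  qed
qed

lemma noise_adj_choi_psd:
  fixes p :: real
  assumes "2 \<le> CARD('n::finite)" "0 \<le> p" "p < 1"
  shows "psd (noise_adj_choi p :: complex ^ (('n \<times> 'n) \<times> ('n \<times> 'n)) ^ _)"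
  unfolding psd_def
proof
  fix v :: "complex ^ (('n \<times> 'n) \<times> ('n \<times> 'n))"
  obtain r where "cinner v (noise_adj_choi p *v v) = of_real r" "0 \<le> r"
    using noise_adj_choi_form[OF assms, of v] by metis
  then show "cinner v (noise_adj_choi p *v v) \<in> \<real>\<^sub>\<ge>\<^sub>0" by simp
qed

section \<open>Partial traces and unitality of the adjoint noise map\<close>

definition ptr :: "complex ^ ('a::finite \<times> 'b::finite) ^ ('a \<times> 'b) \<Rightarrow> complex ^ 'b ^ 'b"
  where "ptr J = (\<chi> k l. \<Sum>a\<in>UNIV. J $ (a, k) $ (a, l))"

lemma ptr_add: "ptr (A + B) = ptr A + ptr B"
  by (simp add: ptr_def vec_eq_iff sum.distrib)

lemma ptr_diff: "ptr (A - B) = ptr A - ptr B"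
  by (simp add: ptr_def vec_eq_iff sum_subtractf)

lemma ptr_scaleR: "ptr (c *\<^sub>R A) = c *\<^sub>R ptr A"
  by (simp add: ptr_def vec_eq_iff scaleR_sum_right)

lemma ptr_mult_kron: "ptr (M ** kron (mat 1) Y) = ptr M ** Y"
proof -
  have 1: "(M ** kron (mat 1) Y) $ i $ (a, l) = (\<Sum>b\<in>UNIV. M $ i $ (a, b) * Y $ b $ l)" for i a l
  proof -
    have "(M ** kron (mat 1) Y) $ i $ (a, l)
      = (\<Sum>c\<in>UNIV. \<Sum>b\<in>UNIV. M $ i $ (c, b) * (mat 1 $ c $ a * Y $ b $ l))"
      by (simp add: matrix_matrix_mult_def sum_UNIV_prod kron_def)
    also have "\<dots> = (\<Sum>c\<in>UNIV. if c = a then (\<Sum>b\<in>UNIV. M $ i $ (a, b) * Y $ b $ l) else 0)"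
      by (rule sum.cong[OF refl]) (simp add: mat_def)
    finally show ?thesis by simp
  qed
  have "ptr (M ** kron (mat 1) Y) $ k $ l = (ptr M ** Y) $ k $ l" for k l
  proof -
    have "ptr (M ** kron (mat 1) Y) $ k $ l = (\<Sum>a\<in>UNIV. \<Sum>b\<in>UNIV. M $ (a, k) $ (a, b) * Y $ b $ l)"
      by (simp add: ptr_def 1)
    also have "\<dots> = (\<Sum>b\<in>UNIV. \<Sum>a\<in>UNIV. M $ (a, k) $ (a, b) * Y $ b $ l)"
      by (rule sum.swap)
    finally show ?thesis by (simp add: ptr_def matrix_matrix_mult_def sum_distrib_right)
  qed
  then show ?thesis by (simp add: vec_eq_iff)
qed

lemma ptr_adj: "ptr (adj M) = adj (ptr M)"
  by (simp add: ptr_def adj_def vec_eq_iff)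

lemma ptr_kron_mult: "ptr (kron (mat 1) Y ** M) = Y ** ptr M"
  using ptr_mult_kron[of "adj M" "adj Y"]
  by (metis adj_adj adj_kron adj_mat_1 adj_mult ptr_adj)

lemma ptr_kron: "ptr (kron (mat 1 :: complex ^ 'a::finite ^ 'a) Y) = real CARD('a) *\<^sub>R Y"
  by (simp add: ptr_def kron_def mat_def vec_eq_iff scaleR_conv_of_real[where 'a=complex])

text \<open>The partial trace over the input of a vectorized projection is
  \<open>M ** adj M\<close>. Here M runs over I \<otimes> |i><j|, and the products add up to d
  I.\<close>

lemma ptr_V0: "ptr (V0 ** adj V0) = real CARD('n) *\<^sub>R (mat 1 :: complex ^ ('n::finite \<times> 'n) ^ ('n \<times> 'n))"
proof -
  have V: "(V0 ** adj V0) $ ((a, b), (k1, k2)) $ ((a, b), (l1, l2))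
      = (if a = k1 then (if k1 = l1 \<and> k2 = l2 then 1 else 0) else (0 :: complex))" for a b k1 k2 l1 l2 :: 'n
  proof -
    have "(V0 ** adj V0) $ ((a, b), (k1, k2)) $ ((a, b), (l1, l2))
      = (\<Sum>i\<in>UNIV. \<Sum>j\<in>UNIV. V0 $ ((a, b), (k1, k2)) $ (i, j) * cnj (V0 $ ((a, b), (l1, l2)) $ (i, j)))"
      by (simp add: matrix_matrix_mult_def sum_UNIV_prod adj_def)
    also have "\<dots> = (\<Sum>i\<in>UNIV. \<Sum>j\<in>UNIV. if j = b then (if i = k2 then
          (if a = k1 then (if k1 = l1 \<and> k2 = l2 then 1 else 0) else 0) else 0) else 0)"
      by (intro sum.cong refl) (auto simp: V0_def)
    finally show ?thesis by simp
  qed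
  have "ptr (V0 ** adj V0) $ (k1, k2) $ (l1, l2)
      = (real CARD('n) *\<^sub>R (mat 1 :: complex ^ ('n \<times> 'n) ^ ('n \<times> 'n))) $ (k1, k2) $ (l1, l2)" for k1 k2 l1 l2 :: 'n
  proof -
    have "ptr (V0 ** adj V0) $ (k1, k2) $ (l1, l2)
      = (\<Sum>a\<in>UNIV. if a = k1 then of_nat CARD('n) * (if k1 = l1 \<and> k2 = l2 then 1 else 0) else (0 :: complex))"
      unfolding ptr_def vec_lambda_beta sum_UNIV_prod[where 'a='n and 'b='n] V
      by (rule sum.cong[OF refl]) simp
    then show ?thesis by (simp add: mat_def scaleR_conv_of_real[where 'a=complex])
  qed
  then show ?thesis by (simp add: vec_eq_iff)
qed

text \<open>The partial trace over the input of a Choi matrix is the value of the map at I, so this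
  is unitality of the adjoint noise map. Expanding the compression by the complementary projector
  leaves an element of the algebra of \<open>tw\<close>, and its two eigenvalues are those computed
  in \<open>lam_unital\<close>.\<close>

lemma ptr_noise_adj_choi:
  fixes p :: real
  assumes n: "2 \<le> CARD('n::finite)" and p: "0 \<le> p" "p < 1"
  shows "ptr (noise_adj_choi p :: complex ^ (('n \<times> 'n) \<times> ('n \<times> 'n)) ^ _) = mat 1"
proof -
  define d where "d = real CARD('n)"
  have d: "2 \<le> d" using n by (simp add: d_def)
  have D: "d\<^sup>2 - 1 \<noteq> 0" using lam_bounds(1)[OF d p] by linarith
  define x1 where "x1 = lam3 d p"
  define x2 where "x2 = lam3 d p + lam2 d p / lam4 d p"
  define s1 where "s1 = q1_of d p * q1_of d p"
  define s2 where "s2 = q2_of d p * q2_of d p"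
  define c where "c = tw_trace d (s1 * x1) (s2 * x2)"
  let ?V = "V_iso p :: complex ^ ('n \<times> 'n) ^ (('n \<times> 'n) \<times> ('n \<times> 'n))"
  let ?P = "?V ** adj ?V"
  let ?X = "kron (mat 1) (tw x1 x2) :: complex ^ (('n \<times> 'n) \<times> ('n \<times> 'n)) ^ _"
  have X: "X_op p = (tw x1 x2 :: complex ^ ('n \<times> 'n) ^ ('n \<times> 'n))" by (simp add: X_op_tw x1_def x2_def d_def)
  have c': "c = lam4 d p * x1 + lam5 d p * x2"
    using D d by (simp add: c_def tw_trace_def s1_def s2_def q_of_sq[OF d p] field_simps)
  \<comment> \<open>Since the compression of I \<otimes> X by the isometry is scalar, the term that
    is quadratic in the projector collapses to a multiple of the projector.\<close>
  have PXP: "?P ** ?X ** ?P = c *\<^sub>R ?P"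
  proof -
    have "?P ** ?X ** ?P = ?V ** (adj ?V ** ?X ** ?V) ** adj ?V" by (simp add: matrix_mul_assoc)
    also have "adj ?V ** ?X ** ?V = c *\<^sub>R mat 1"
      unfolding V_iso_sandwich by (simp add: c_def s1_def s2_def d_def)
    finally show ?thesis by (simp add: matrix_scalar_ac scalar_matrix_assoc[symmetric])
  qed
  have J: "(noise_adj_choi p :: complex ^ (('n \<times> 'n) \<times> ('n \<times> 'n)) ^ _)
      = (lam1 d p + c) *\<^sub>R ?P + ?X - ?P ** ?X - ?X ** ?P"
  proof -
    have "(mat 1 - ?P) ** ?X ** (mat 1 - ?P) = ?X - ?P ** ?X - ?X ** ?P + ?P ** ?X ** ?P"
      by (simp add: matrix_diff_ldistrib matrix_diff_rdistrib)
    moreover have "(noise_adj_choi p :: complex ^ (('n \<times> 'n) \<times> ('n \<times> 'n)) ^ _)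
        = lam1 d p *\<^sub>R ?P + (mat 1 - ?P) ** ?X ** (mat 1 - ?P)"
      by (simp add: noise_adj_choi_def P_proj_eq[OF n p] X d_def)
    moreover have "a + (x - y - z + b) = a + b + x - y - z" for a b x y z :: "complex ^ (('n \<times> 'n) \<times> ('n \<times> 'n)) ^ (('n \<times> 'n) \<times> ('n \<times> 'n))"
      by simp
    ultimately show ?thesis unfolding PXP scaleR_add_left by (simp only:)
  qed
  have ptrP: "ptr ?P = tw (d * s1) (d * s2)"
  proof -
    have "?P = kron (mat 1) (Q_op p) ** ((V0 ** adj V0) ** kron (mat 1) (Q_op p))"
      by (simp add: V_iso_def adj_mult adj_kron matrix_mul_assoc)
    then have "ptr ?P = Q_op p ** ((real CARD('n) *\<^sub>R mat 1) ** Q_op p)"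
      by (simp add: ptr_kron_mult ptr_mult_kron ptr_V0)
    then show ?thesis
      by (simp add: scalar_matrix_assoc[symmetric] matrix_scalar_ac Q_op_tw tw_mult tw_scaleR d_def s1_def s2_def mult.left_commute)
  qed
  have "ptr (noise_adj_choi p :: complex ^ (('n \<times> 'n) \<times> ('n \<times> 'n)) ^ _)
      = (lam1 d p + c) *\<^sub>R tw (d * s1) (d * s2) + d\<^sup>2 *\<^sub>R tw x1 x2
        - tw (d * s1) (d * s2) ** tw x1 x2 - tw x1 x2 ** tw (d * s1) (d * s2)"
    unfolding J ptr_add ptr_diff ptr_scaleR ptr_mult_kron ptr_kron_mult ptrP ptr_kron
    by (simp add: d_def power2_eq_square)
  also have "\<dots> = tw ((lam1 d p + c) * (d * s1) + d\<^sup>2 * x1 - d * s1 * x1 - x1 * (d * s1))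
      ((lam1 d p + c) * (d * s2) + d\<^sup>2 * x2 - d * s2 * x2 - x2 * (d * s2))"
    by (simp add: tw_scaleR tw_add tw_diff tw_mult)
  also have "(lam1 d p + c) * (d * s1) + d\<^sup>2 * x1 - d * s1 * x1 - x1 * (d * s1) = 1"
  proof -
    have "d * s1 = d\<^sup>2 * lam4 d p / (d\<^sup>2 - 1)" by (simp add: s1_def q_of_sq[OF d p] power2_eq_square)
    then show ?thesis
      using lam_unital(1)[OF d p] unfolding c' x1_def x2_def by (simp add: algebra_simps)
  qed
  also have "(lam1 d p + c) * (d * s2) + d\<^sup>2 * x2 - d * s2 * x2 - x2 * (d * s2) = 1"
  proof -
    have "d * s2 = d\<^sup>2 * lam5 d p" by (simp add: s2_def q_of_sq[OF d p] power2_eq_square)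
    then show ?thesis
      using lam_unital(2)[OF d p] unfolding c' x1_def x2_def by (simp add: algebra_simps)
  qed
  finally show ?thesis by simp
qed

section \<open>Kraus operators and trace preservation of the noise map\<close>

lemma kraus_on_adjoint:
  assumes "kraus_on I K \<Psi>"
  shows "kraus_on I (\<lambda>i. adj (K i)) (hs_adjoint \<Psi>)"
proof -
  have "hs_adjoint \<Psi> = (\<lambda>\<rho>. \<Sum>i\<in>I. adj (K i) ** \<rho> ** K i)"
  proof (rule hs_adjoint_unique)
    fix A B
    have "trace (adj (adj (K i) ** A ** K i) ** B) = trace (adj A ** (K i ** B ** adj (K i)))" for i
    proof -
      have "trace (adj (adj (K i) ** A ** K i) ** B) = trace (adj (K i) ** (adj A ** K i ** B))"
        by (simp add: adj_mult matrix_mul_assoc)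
      also have "\<dots> = trace (adj A ** K i ** B ** adj (K i))" by (rule trace_mul_sym)
      finally show ?thesis by (simp add: matrix_mul_assoc)
    qed
    then show "hs_inner (\<Sum>i\<in>I. adj (K i) ** A ** K i) B = hs_inner A (\<Psi> B)"
      by (simp add: hs_inner_def kraus_onD[OF assms] adj_sum matrix_sum_ldistrib matrix_sum_rdistrib trace_sum)
  qed
  then show ?thesis using kraus_on_finite[OF assms] by (simp add: kraus_on_def)
qed

text \<open>One family K serves two purposes: its adjoints are Kraus operators of the noise map, and
  its vectorizations factor the given Choi matrix. This link turns the fidelity into a quadratic
  form.\<close>

lemma noise_map_kraus:
  fixes p :: real
  assumes "2 \<le> CARD('n::finite)" "0 \<le> p" "p < 1"
  obtains K :: "('n::finite \<times> 'n) \<times> ('n \<times> 'n) \<Rightarrow> complex ^ ('n \<times> 'n) ^ ('n \<times> 'n)"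
  where "kraus_on UNIV (\<lambda>k. adj (K k)) (noise_map p)"
    "noise_adj_choi p = (\<Sum>k\<in>UNIV. ketbra (vectorize (K k)) (vectorize (K k)))"
proof -
  let ?N = "noise_map p :: complex ^ ('n \<times> 'n) ^ ('n \<times> 'n) \<Rightarrow> _"
  have lin: "clinear_map (hs_adjoint ?N)" by (rule hs_adjoint(2)[OF noise_map(1)])
  have "psd (choi (hs_adjoint ?N))" unfolding noise_map(2) by (rule noise_adj_choi_psd[OF assms])
  then obtain K :: "('n \<times> 'n) \<times> ('n \<times> 'n) \<Rightarrow> complex ^ ('n \<times> 'n) ^ ('n \<times> 'n)"
    where K: "kraus_on UNIV K (hs_adjoint ?N)"
      "choi (hs_adjoint ?N) = (\<Sum>i\<in>UNIV. ketbra (vectorize (K i)) (vectorize (K i)))"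
    using kraus_on_if_choi_psd[OF lin] by blast
  have "kraus_on UNIV (\<lambda>k. adj (K k)) ?N"
    using kraus_on_adjoint[OF K(1)] unfolding hs_adjoint(3)[OF noise_map(1)] .
  then show ?thesis using that K(2)[unfolded noise_map(2)] by blast
qed

text \<open>Pairing with the identity: the trace of N(\<rho>) is the Hilbert-Schmidt product of the
  adjoint's value at I with \<rho>, and that value is the partial trace of the Choi matrix.\<close>

lemma noise_map_trace_preserving:
  fixes p :: real
  assumes "2 \<le> CARD('n::finite)" "0 \<le> p" "p < 1"
  shows "trace_preserving (noise_map p :: complex ^ ('n \<times> 'n) ^ ('n \<times> 'n) \<Rightarrow> _)"
  unfolding trace_preserving_def
proof
  fix \<rho> :: "complex ^ ('n \<times> 'n) ^ ('n \<times> 'n)"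
  let ?N = "noise_map p :: complex ^ ('n \<times> 'n) ^ ('n \<times> 'n) \<Rightarrow> _"
  have lin: "clinear_map (hs_adjoint ?N)" by (rule hs_adjoint(2)[OF noise_map(1)])
  have "hs_adjoint ?N (mat 1) $ k $ l = ptr (choi (hs_adjoint ?N)) $ k $ l" for k l
  proof -
    have "hs_adjoint ?N (mat 1) $ k $ l
      = (\<Sum>a\<in>UNIV. \<Sum>b\<in>UNIV. mat 1 $ a $ b * choi (hs_adjoint ?N) $ (a, k) $ (b, l))"
      using clinear_map_expand[OF lin, of "mat 1" k l] by (simp only: choi_nth fst_conv snd_conv)
    then show ?thesis unfolding sum_mat_1_left by (simp add: ptr_def)
  qed
  then have "hs_adjoint ?N (mat 1) = mat 1"
    by (simp add: vec_eq_iff noise_map(2) ptr_noise_adj_choi[OF assms])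
  then have "hs_inner (mat 1) (?N \<rho>) = hs_inner (mat 1) \<rho>"
    using hs_adjoint(1)[OF noise_map(1), where A="mat 1" and B=\<rho>, of p] by simp
  then show "trace (?N \<rho>) = trace \<rho>" by (simp add: hs_inner_def)
qed

section \<open>Encoder and decoder\<close>

lemma kraus_on_encoder: "kraus_on UNIV (C_op p) (encoder p :: complex ^ 'n::finite ^ 'n \<Rightarrow> _)"
proof -
  have "encoder p \<rho> = (\<Sum>s\<in>UNIV. C_op p s ** \<rho> ** adj (C_op p s))" for \<rho> :: "complex ^ 'n ^ 'n"
  proof -
    have "C_op p s ** \<rho> ** adj (C_op p s)
        = Q_op p ** (emb (axis s 1) ** \<rho> ** adj (emb (axis s 1))) ** Q_op p" for s
      by (simp add: C_op_def embed_S_eq adj_mult matrix_mul_assoc)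
    then have "(\<Sum>s\<in>UNIV. C_op p s ** \<rho> ** adj (C_op p s))
        = Q_op p ** kron \<rho> (\<Sum>s\<in>UNIV. ketbra (axis s 1) (axis s 1)) ** Q_op p"
      by (simp add: emb_sandwich kron_sum_right matrix_sum_ldistrib matrix_sum_rdistrib)
    then show ?thesis by (simp add: sum_axis_ketbra encoder_def)
  qed
  then show ?thesis by (simp add: kraus_on_def)
qed

lemma kraus_on_tr_S: "kraus_on UNIV D_op (tr_S :: complex ^ ('n::finite \<times> 'n) ^ ('n \<times> 'n) \<Rightarrow> _)"
proof -
  have "tr_S M = (\<Sum>s\<in>UNIV. D_op s ** M ** adj (D_op s))" for M :: "complex ^ ('n \<times> 'n) ^ ('n \<times> 'n)"
  proof -
    have "(D_op s ** M ** adj (D_op s)) $ x $ y = M $ (x, s) $ (y, s)" for s x y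
    proof -
      have 1: "adj (D_op s) = emb (axis s 1)" "D_op s = adj (emb (axis s 1))"
        by (simp_all add: D_op_def embed_S_eq)
      have "(D_op s ** M ** adj (D_op s)) $ x $ y
          = (\<Sum>t\<in>UNIV. (\<Sum>r\<in>UNIV. cnj (axis s 1 $ r) * M $ (x, r) $ (y, t)) * axis s 1 $ t)"
        unfolding 1(1) mult_emb_nth unfolding 1(2) adj_emb_mult_nth ..
      then show ?thesis
        by (simp add: axis_nth_eq if_distrib if_distribR sum.delta cong: if_cong)
    qed
    then show ?thesis by (simp add: vec_eq_iff tr_S_def)
  qed
  then show ?thesis by (simp add: kraus_on_def)
qed

text \<open>The swapped indices on the right are the transpose coming from \<open>pi_C\<close>. For
  a basis \<open>m\<close> this yields trace preservation of the encoder; for unknown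
  \<open>m\<close> it is the equation that determines an optimal encoder.\<close>

lemma sum_adj_emb_tw_emb:
  fixes m :: "'i \<Rightarrow> complex ^ 'n::finite"
  shows "(\<Sum>i\<in>I. adj (emb (m i)) ** tw a b ** emb (m i)) $ x $ y
    = of_real a * trace (\<Sum>i\<in>I. ketbra (m i) (m i)) * (if x = y then 1 else 0)
      + of_real ((b - a) / real CARD('n)) * (\<Sum>i\<in>I. ketbra (m i) (m i)) $ y $ x"
  unfolding sum_component adj_emb_tw_emb trace_sum trace_ketbra
  by (simp add: sum.distrib sum_distrib_left sum_distrib_right ketbra_def mult_ac)

lemma mat_1_nth: "mat 1 $ i $ j = (if i = j then 1 else 0)"
  by (simp add: mat_def)

lemma sum_adj_C_op:
  fixes p :: real
  assumes "2 \<le> CARD('n::finite)" "0 \<le> p" "p < 1"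
  shows "(\<Sum>s\<in>UNIV. adj (C_op p s) ** C_op p s) = (mat 1 :: complex ^ 'n ^ 'n)"
proof -
  define d where "d = real CARD('n)"
  have d: "2 \<le> d" using assms by (simp add: d_def)
  define s1 where "s1 = q1_of d p * q1_of d p"
  define s2 where "s2 = q2_of d p * q2_of d p"
  have "(\<Sum>s\<in>UNIV. adj (C_op p s) ** C_op p s)
      = (\<Sum>s\<in>UNIV. adj (emb (axis s 1)) ** tw s1 s2 ** emb (axis s (1 :: complex) :: complex ^ 'n))"
    unfolding s1_def s2_def d_def tw_mult[symmetric] Q_op_tw[symmetric]
    by (simp add: C_op_def embed_S_eq adj_mult matrix_mul_assoc)
  moreover have "s1 * d + (s2 - s1) / d = 1"
    using tw_trace_Q[OF d assms(2,3)] d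
    by (simp add: s1_def s2_def tw_trace_def field_simps power2_eq_square)
  then have "complex_of_real s1 * of_real d + of_real ((s2 - s1) / d) = 1"
    by (metis of_real_1 of_real_add of_real_mult)
  ultimately show ?thesis
    by (auto simp: vec_eq_iff sum_adj_emb_tw_emb sum_axis_ketbra trace_I mat_1_nth d_def
        simp del: of_real_divide sum_component)
qed

lemma sum_adj_D_op: "(\<Sum>s\<in>UNIV. adj (D_op s) ** D_op s) = (mat 1 :: complex ^ ('n::finite \<times> 'n) ^ ('n \<times> 'n))"
proof -
  have "adj (D_op s) ** D_op s = kron (mat 1) (ketbra (axis s 1) (axis s 1))" for s :: 'n
    using emb_sandwich[of "axis s 1" "mat 1" "axis s 1"] by (simp add: D_op_def embed_S_eq)
  then show ?thesis
    by (simp add: kron_sum_right[symmetric] sum_axis_ketbra)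
qed

section \<open>The fidelity\<close>

text \<open>For the maximally mixed state, cyclicity of the trace turns each term into the squared
  overlap of the vectorized K and C D, divided by d^2. Summing over the Kraus operators K of the
  adjoint noise map rebuilds its Choi matrix.\<close>

lemma fidelity_eq:
  fixes p :: real and C :: "'i \<Rightarrow> complex ^ 'n::finite ^ ('n \<times> 'n)" and D :: "'j \<Rightarrow> complex ^ ('n \<times> 'n) ^ 'n"
  assumes "2 \<le> CARD('n)" "0 \<le> p" "p < 1" and C: "kraus_on I C \<C>" and D: "kraus_on J D \<D>"
  shows "entanglement_fidelity max_mixed (\<D> \<circ> noise_map p \<circ> \<C>) = (1 / (real CARD('n))\<^sup>2) *
    (\<Sum>i\<in>I. \<Sum>j\<in>J. Re (cinner (vectorize (C i ** D j)) (noise_adj_choi p *v vectorize (C i ** D j))))"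
proof -
  obtain K :: "('n \<times> 'n) \<times> ('n \<times> 'n) \<Rightarrow> complex ^ ('n \<times> 'n) ^ ('n \<times> 'n)"
    where K: "kraus_on UNIV (\<lambda>k. adj (K k)) (noise_map p)"
      "noise_adj_choi p = (\<Sum>k\<in>UNIV. ketbra (vectorize (K k)) (vectorize (K k)))"
    using noise_map_kraus[OF assms(1-3)] by blast
  have "kraus_on (I \<times> (UNIV \<times> J)) (\<lambda>(i, k). (case k of (k, j) \<Rightarrow> D j ** adj (K k)) ** C i) (\<D> \<circ> noise_map p \<circ> \<C>)"
    by (rule kraus_on_compose[OF C kraus_on_compose[OF K(1) D]])
  then have "entanglement_fidelity max_mixed (\<D> \<circ> noise_map p \<circ> \<C>)
      = (\<Sum>i\<in>I. \<Sum>k\<in>UNIV. \<Sum>j\<in>J. (cmod (trace (max_mixed ** (D j ** adj (K k) ** C i))))\<^sup>2)"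
    by (simp add: entanglement_fidelity_kraus_on sum.cartesian_product case_prod_beta)
  also have "\<dots> = (\<Sum>i\<in>I. \<Sum>j\<in>J. \<Sum>k\<in>UNIV. (cmod (trace (max_mixed ** (D j ** adj (K k) ** C i))))\<^sup>2)"
    by (intro sum.cong refl sum.swap)
  also have "\<dots> = (\<Sum>i\<in>I. \<Sum>j\<in>J. (1 / (real CARD('n))\<^sup>2) *
      Re (cinner (vectorize (C i ** D j)) (noise_adj_choi p *v vectorize (C i ** D j))))"
  proof (intro sum.cong refl)
    fix i j
    have "(cmod (trace (max_mixed ** (D j ** adj (K k) ** C i))))\<^sup>2
      = (1 / (real CARD('n))\<^sup>2) * (cmod (cinner (vectorize (K k)) (vectorize (C i ** D j))))\<^sup>2" for k
    proof -
      have "trace (D j ** adj (K k) ** C i) = trace (D j ** (adj (K k) ** C i))" by (simp add: matrix_mul_assoc)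
      also have "\<dots> = trace (adj (K k) ** C i ** D j)" by (rule trace_mul_sym)
      also have "\<dots> = cinner (vectorize (K k)) (vectorize (C i ** D j))"
        by (simp add: cinner_vectorize hs_inner_def matrix_mul_assoc)
      finally show ?thesis
        by (simp add: max_mixed_def scalar_matrix_assoc[symmetric] trace_scaleR norm_divide
            power_divide scaleR_conv_of_real[where 'a=complex] norm_mult power_mult_distrib)
    qed
    then show "(\<Sum>k\<in>UNIV. (cmod (trace (max_mixed ** (D j ** adj (K k) ** C i))))\<^sup>2)
      = (1 / (real CARD('n))\<^sup>2) *
        Re (cinner (vectorize (C i ** D j)) (noise_adj_choi p *v vectorize (C i ** D j)))"
      unfolding K(2) cinner_sum_ketbra Re_complex_of_real by (simp add: sum_distrib_left)
  qed
  finally show ?thesis by (simp add: sum_distrib_left)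
qed

section \<open>The upper bound\<close>

lemma sum_norm_mult_le:
  fixes M :: "complex ^ 'a::finite ^ 'b::finite" and C :: "'i \<Rightarrow> complex ^ 'b ^ 'c::finite"
  assumes "\<And>v. (\<Sum>i\<in>I. (norm (C i *v v))\<^sup>2) \<le> (norm v)\<^sup>2"
  shows "(\<Sum>i\<in>I. (norm (C i ** M))\<^sup>2) \<le> (norm M)\<^sup>2"
proof -
  have "(\<Sum>i\<in>I. (norm (C i ** M))\<^sup>2) = (\<Sum>i\<in>I. \<Sum>k\<in>UNIV. (norm (C i *v (M *v axis k 1)))\<^sup>2)"
    by (simp add: norm_matrix_sq_columns matrix_vector_mul_assoc)
  also have "\<dots> = (\<Sum>k\<in>UNIV. \<Sum>i\<in>I. (norm (C i *v (M *v axis k 1)))\<^sup>2)"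
    by (rule sum.swap)
  also have "\<dots> \<le> (\<Sum>k\<in>UNIV. (norm (M *v axis k 1))\<^sup>2)"
    by (intro sum_mono assms)
  finally show ?thesis by (simp add: norm_matrix_sq_columns)
qed

lemma norm_axis_complex: "norm (axis k (1 :: complex)) = 1"
proof -
  have "complex_of_real ((norm (axis k (1 :: complex)))\<^sup>2) = 1"
    unfolding cinner_self[symmetric] cinner_axis_left by (simp add: axis_nth_eq)
  then have "(norm (axis k (1 :: complex)))\<^sup>2 = 1" by (metis of_real_eq_1_iff)
  then show ?thesis by (simp add: power2_eq_1_iff)
qed

lemma norm_mat_1_sq: "(norm (mat 1 :: complex ^ 'a::finite ^ 'a))\<^sup>2 = real CARD('a)"
  by (simp add: norm_matrix_sq_columns norm_axis_complex)

lemma sum_norm_le_card: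
  fixes D :: "'i \<Rightarrow> complex ^ 'a::finite ^ 'b::finite"
  assumes "\<And>v. (\<Sum>i\<in>I. (norm (D i *v v))\<^sup>2) \<le> (norm v)\<^sup>2"
  shows "(\<Sum>i\<in>I. (norm (D i))\<^sup>2) \<le> real CARD('a)"
  using sum_norm_mult_le[of D I "mat 1", OF assms] by (simp add: norm_mat_1_sq)

lemma cinner_one_minus_kraus_sum:
  fixes K :: "'i \<Rightarrow> complex ^ 'a::finite ^ 'b::finite"
  shows "cinner v ((mat 1 - (\<Sum>i\<in>I. adj (K i) ** K i)) *v v)
      = of_real ((norm v)\<^sup>2 - (\<Sum>i\<in>I. (norm (K i *v v))\<^sup>2))"
proof -
  have "cinner v ((adj (K i) ** K i) *v v) = of_real ((norm (K i *v v))\<^sup>2)" for i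
    by (metis cinner_adj_left cinner_self matrix_vector_mul_assoc)
  then show ?thesis
    by (simp add: matrix_vector_mult_diff_rdistrib cinner_diff_right matrix_vector_sum_rdistrib
        cinner_sum_right cinner_self del: of_real_power)
qed

text \<open>The equality case of \<open>sum_norm_mult_le\<close>: the form of the positive operator
  I - \<Sum> \<open>adj (K i) ** K i\<close> sums to zero over the columns of \<open>M\<close>, so
  each column lies in its kernel.\<close>

lemma contraction_kernel:
  fixes K :: "'i \<Rightarrow> complex ^ 'a::finite ^ 'b::finite"
  assumes "\<And>v. (\<Sum>i\<in>I. (norm (K i *v v))\<^sup>2) \<le> (norm v)\<^sup>2"
    and "(\<Sum>i\<in>I. (norm (K i ** M))\<^sup>2) = (norm M)\<^sup>2"
  shows "(mat 1 - (\<Sum>i\<in>I. adj (K i) ** K i)) ** M = 0"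
proof -
  let ?R = "mat 1 - (\<Sum>i\<in>I. adj (K i) ** K i)"
  have psd: "psd ?R"
    unfolding psd_def cinner_one_minus_kraus_sum using assms(1)
    by (simp del: of_real_diff of_real_power of_real_sum)
  define g where "g = (\<lambda>k. (norm (M *v axis k 1))\<^sup>2 - (\<Sum>i\<in>I. (norm (K i *v (M *v axis k 1)))\<^sup>2))"
  have g0: "g k \<ge> 0" for k using assms(1) by (simp add: g_def)
  have "(\<Sum>k\<in>UNIV. g k) = (norm M)\<^sup>2 - (\<Sum>i\<in>I. (norm (K i ** M))\<^sup>2)"
    unfolding norm_matrix_sq_columns g_def sum_subtractf
    by (subst sum.swap) (simp add: matrix_vector_mul_assoc)
  then have "g k = 0" for k
    using g0 assms(2) sum_nonneg_eq_0_iff[of UNIV g] by simp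
  then have "?R *v (M *v axis k 1) = 0" for k
    by (intro psd_kernel[OF psd]) (simp add: cinner_one_minus_kraus_sum g_def)
  then have "(?R ** M) $ i $ k = 0" for i k
    by (metis matrix_vector_mul_assoc mult_vec_axis zero_index)
  then show ?thesis by (simp add: vec_eq_iff)
qed

context
  fixes p :: real and d :: real and C :: "'i \<Rightarrow> complex ^ 'n::finite ^ ('n \<times> 'n)"
    and D :: "'j \<Rightarrow> complex ^ ('n \<times> 'n) ^ 'n" and I J \<C> \<D>
  assumes n: "2 \<le> CARD('n)" and p: "0 \<le> p" "p < 1"
    and C: "kraus_on I C \<C>" "cptni \<C>" and D: "kraus_on J D \<D>" "cptni \<D>"
  defines "d \<equiv> real CARD('n)"
begin

lemma fid_d: "2 \<le> d"
  using n by (simp add: d_def)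

lemma fid_contraction:
  "(\<Sum>i\<in>I. (norm (C i *v v))\<^sup>2) \<le> (norm v)\<^sup>2" "(\<Sum>j\<in>J. (norm (D j *v w))\<^sup>2) \<le> (norm w)\<^sup>2"
  using C D cptni_iff_kraus_on by blast+

text \<open>The decoder sets the total weight, since its squared norms add up to at most the
  dimension d^2 of the physical space; the contraction C can only decrease it.\<close>

lemma fid_norm_bounds:
  "(\<Sum>i\<in>I. (norm (C i ** D j))\<^sup>2) \<le> (norm (D j))\<^sup>2" "(\<Sum>j\<in>J. (norm (D j))\<^sup>2) \<le> d\<^sup>2"
  "(\<Sum>i\<in>I. \<Sum>j\<in>J. (norm (C i ** D j))\<^sup>2) \<le> (\<Sum>j\<in>J. (norm (D j))\<^sup>2)"
proof -
  show 1: "(\<Sum>i\<in>I. (norm (C i ** D j))\<^sup>2) \<le> (norm (D j))\<^sup>2" for j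
    by (rule sum_norm_mult_le) (rule fid_contraction)
  show "(\<Sum>j\<in>J. (norm (D j))\<^sup>2) \<le> d\<^sup>2"
    using sum_norm_le_card[of D J, OF fid_contraction(2)] by (simp add: d_def power2_eq_square)
  show "(\<Sum>i\<in>I. \<Sum>j\<in>J. (norm (C i ** D j))\<^sup>2) \<le> (\<Sum>j\<in>J. (norm (D j))\<^sup>2)"
    by (subst sum.swap) (intro sum_mono 1)
qed

text \<open>The defect outside the range of the projector is retained, because its vanishing is what
  describes the optimal pairs.\<close>

lemma fidelity_le_defect:
  "entanglement_fidelity max_mixed (\<D> \<circ> noise_map p \<circ> \<C>) * d\<^sup>2
    \<le> lam1 d p * (\<Sum>i\<in>I. \<Sum>j\<in>J. (norm (C i ** D j))\<^sup>2)
      - (lam1 d p - (lam3 d p + lam2 d p / lam4 d p)) *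
        (\<Sum>i\<in>I. \<Sum>j\<in>J. (norm (vectorize (C i ** D j) - P_proj p *v vectorize (C i ** D j)))\<^sup>2)"
proof -
  let ?\<delta> = "lam1 d p - (lam3 d p + lam2 d p / lam4 d p)"
  have "Re (cinner (vectorize B) (noise_adj_choi p *v vectorize B))
      \<le> lam1 d p * (norm B)\<^sup>2 - ?\<delta> * (norm (vectorize B - P_proj p *v vectorize B))\<^sup>2"
    for B :: "complex ^ ('n \<times> 'n) ^ ('n \<times> 'n)"
  proof -
    obtain r where "cinner (vectorize B) (noise_adj_choi p *v vectorize B) = of_real r"
      "r \<le> lam1 d p * (norm (vectorize B))\<^sup>2 - ?\<delta> * (norm (vectorize B - P_proj p *v vectorize B))\<^sup>2"
      using noise_adj_choi_form[OF n p, of "vectorize B"] unfolding d_def by blast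
    then show ?thesis by (simp add: norm_vectorize)
  qed
  then have "(\<Sum>i\<in>I. \<Sum>j\<in>J. Re (cinner (vectorize (C i ** D j)) (noise_adj_choi p *v vectorize (C i ** D j))))
      \<le> (\<Sum>i\<in>I. \<Sum>j\<in>J. lam1 d p * (norm (C i ** D j))\<^sup>2
        - ?\<delta> * (norm (vectorize (C i ** D j) - P_proj p *v vectorize (C i ** D j)))\<^sup>2)"
    by (intro sum_mono)
  moreover have "d \<noteq> 0" using fid_d by simp
  then have "entanglement_fidelity max_mixed (\<D> \<circ> noise_map p \<circ> \<C>) * d\<^sup>2
      = (\<Sum>i\<in>I. \<Sum>j\<in>J. Re (cinner (vectorize (C i ** D j)) (noise_adj_choi p *v vectorize (C i ** D j))))"
    unfolding fidelity_eq[OF n p C(1) D(1)] d_def[symmetric] by simp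
  ultimately show ?thesis
    by (simp add: sum_subtractf sum_distrib_left)
qed

lemma fidelity_le: "entanglement_fidelity max_mixed (\<D> \<circ> noise_map p \<circ> \<C>) \<le> lam1 d p"
proof -
  note b = lam_bounds[OF fid_d p]
  have "lam1 d p * (\<Sum>i\<in>I. \<Sum>j\<in>J. (norm (C i ** D j))\<^sup>2) \<le> lam1 d p * d\<^sup>2"
    using fid_norm_bounds(2,3) b(2) by (intro mult_left_mono) auto
  moreover have "0 \<le> (lam1 d p - (lam3 d p + lam2 d p / lam4 d p)) *
        (\<Sum>i\<in>I. \<Sum>j\<in>J. (norm (vectorize (C i ** D j) - P_proj p *v vectorize (C i ** D j)))\<^sup>2)"
    using b(8) by (intro mult_nonneg_nonneg sum_nonneg) auto
  ultimately have "entanglement_fidelity max_mixed (\<D> \<circ> noise_map p \<circ> \<C>) * d\<^sup>2 \<le> lam1 d p * d\<^sup>2"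
    using fidelity_le_defect by linarith
  then show ?thesis using fid_d by (simp add: mult_le_cancel_right)
qed

section \<open>Optimal pairs\<close>

context
  assumes opt: "entanglement_fidelity max_mixed (\<D> \<circ> noise_map p \<circ> \<C>) = lam1 d p"
begin

text \<open>Optimality forces equality throughout the chain of estimates: with S the total squared
  norm, T the total defect and \<delta> > 0 the gap, it gives \<open>lam1\<close> d^2 \<le>
  \<open>lam1\<close> S - \<delta> T, whereas S \<le> d^2 and T \<ge> 0.\<close>

lemma opt_equalities:
  "\<And>i j. i \<in> I \<Longrightarrow> j \<in> J \<Longrightarrow> P_proj p *v vectorize (C i ** D j) = vectorize (C i ** D j)"
  "(\<Sum>i\<in>I. \<Sum>j\<in>J. (norm (C i ** D j))\<^sup>2) = d\<^sup>2"
  "(\<Sum>j\<in>J. (norm (D j))\<^sup>2) = d\<^sup>2"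
  "\<And>j. j \<in> J \<Longrightarrow> (\<Sum>i\<in>I. (norm (C i ** D j))\<^sup>2) = (norm (D j))\<^sup>2"
proof -
  note b = lam_bounds[OF fid_d p]
  let ?S = "\<Sum>i\<in>I. \<Sum>j\<in>J. (norm (C i ** D j))\<^sup>2"
  let ?\<delta> = "lam1 d p - (lam3 d p + lam2 d p / lam4 d p)"
  let ?E = "\<lambda>i j. (norm (vectorize (C i ** D j) - P_proj p *v vectorize (C i ** D j)))\<^sup>2"
  let ?T = "\<Sum>i\<in>I. \<Sum>j\<in>J. ?E i j"
  have fin: "finite I" "finite J" using C(1) D(1) kraus_on_finite by auto
  have T0: "0 \<le> ?T" by (intro sum_nonneg) auto
  have *: "lam1 d p * d\<^sup>2 \<le> lam1 d p * ?S - ?\<delta> * ?T"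
    using fidelity_le_defect unfolding opt .
  have S: "?S \<le> d\<^sup>2" using fid_norm_bounds(2,3) by linarith
  then have "lam1 d p * ?S \<le> lam1 d p * d\<^sup>2" using b(2) by (intro mult_left_mono) auto
  then have "?\<delta> * ?T \<le> 0" using * by linarith
  then have T: "?T = 0" using T0 b(8) by (smt (verit) mult_pos_pos)
  then have "d\<^sup>2 \<le> ?S" using * b(2) by simp
  then show S_eq: "?S = d\<^sup>2" using S by simp
  then show D_eq: "(\<Sum>j\<in>J. (norm (D j))\<^sup>2) = d\<^sup>2" using fid_norm_bounds(2,3) by linarith
  fix i j assume ij: "i \<in> I" "j \<in> J"
  have "(\<Sum>j\<in>J. ?E i j) = 0"
    using T ij fin sum_nonneg_eq_0_iff[of I "\<lambda>i. \<Sum>j\<in>J. ?E i j"] by (auto simp: sum_nonneg)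
  then have "?E i j = 0"
    using ij fin sum_nonneg_eq_0_iff[of J "?E i"] by auto
  then show "P_proj p *v vectorize (C i ** D j) = vectorize (C i ** D j)" by simp
next
  have fin: "finite I" "finite J" using C(1) D(1) kraus_on_finite by auto
  fix j assume j: "j \<in> J"
  note b = lam_bounds[OF fid_d p]
  let ?S = "\<Sum>i\<in>I. \<Sum>j\<in>J. (norm (C i ** D j))\<^sup>2"
  let ?\<delta> = "lam1 d p - (lam3 d p + lam2 d p / lam4 d p)"
  let ?T = "\<Sum>i\<in>I. \<Sum>j\<in>J. (norm (vectorize (C i ** D j) - P_proj p *v vectorize (C i ** D j)))\<^sup>2"
  have "0 \<le> ?\<delta> * ?T" using b(8) by (intro mult_nonneg_nonneg sum_nonneg) auto
  then have "lam1 d p * d\<^sup>2 \<le> lam1 d p * ?S" using fidelity_le_defect unfolding opt by linarith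
  then have "d\<^sup>2 \<le> ?S" using b(2) by simp
  also have "?S = (\<Sum>j\<in>J. \<Sum>i\<in>I. (norm (C i ** D j))\<^sup>2)" by (rule sum.swap)
  \<comment> \<open>The slacks of the encoder bound are nonnegative for each j and add up to at most
    0, so they vanish individually.\<close>
  finally have "(\<Sum>j\<in>J. (norm (D j))\<^sup>2 - (\<Sum>i\<in>I. (norm (C i ** D j))\<^sup>2)) \<le> 0"
    unfolding sum_subtractf using fid_norm_bounds(2) by linarith
  moreover have "0 \<le> (\<Sum>j\<in>J. (norm (D j))\<^sup>2 - (\<Sum>i\<in>I. (norm (C i ** D j))\<^sup>2))"
    by (intro sum_nonneg) (simp add: fid_norm_bounds(1))
  ultimately have "(\<Sum>j\<in>J. (norm (D j))\<^sup>2 - (\<Sum>i\<in>I. (norm (C i ** D j))\<^sup>2)) = 0"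
    by linarith
  then have "(norm (D j))\<^sup>2 - (\<Sum>i\<in>I. (norm (C i ** D j))\<^sup>2) = 0"
    using j fin sum_nonneg_eq_0_iff[of J "\<lambda>j. (norm (D j))\<^sup>2 - (\<Sum>i\<in>I. (norm (C i ** D j))\<^sup>2)"]
    by (simp add: fid_norm_bounds(1))
  then show "(\<Sum>i\<in>I. (norm (C i ** D j))\<^sup>2) = (norm (D j))\<^sup>2" by simp
qed

lemma opt_product_form:
  assumes "i \<in> I" "j \<in> J"
  obtains M where "C i ** D j = Q_op p ** kron (mat 1) M"
proof -
  have "vectorize (C i ** D j) = V_iso p *v (adj (V_iso p) *v vectorize (C i ** D j))"
    using opt_equalities(1)[OF assms] unfolding P_proj_eq[OF n p] matrix_vector_mul_assoc by simp
  then show ?thesis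
    using that unfolding V_iso_vec vectorize_inject by blast
qed

text \<open>One nonzero product \<open>C\<^sub>i D\<^sub>j = Q (I \<otimes> M)\<close> makes \<open>T = D\<^sub>j (I \<otimes> |n\<rangle>)\<close> invertible for a
  suitable \<open>n\<close>; this \<open>T\<close> then fixes all Kraus operators on both sides.\<close>

lemma opt_structure:
  assumes p0: "0 < p"
  obtains U m where "unitary U" "\<And>i. i \<in> I \<Longrightarrow> C i = Q_op p ** emb (m i) ** adj U"
    "(\<Sum>i\<in>I. ketbra (m i) (m i)) = mat 1"
proof -
  define s1 where "s1 = q1_of d p * q1_of d p"
  define s2 where "s2 = q2_of d p * q2_of d p"
  note b = lam_bounds[OF fid_d p]
  note q = q_of_sq[OF fid_d p]
  define Qi :: "complex ^ ('n \<times> 'n) ^ ('n \<times> 'n)" where "Qi = tw (1 / q1_of d p) (1 / q2_of d p)"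
  have Qi: "Qi ** Q_op p = mat 1"
    unfolding Qi_def Q_op_tw d_def[symmetric] using q by (intro tw_inverse) auto
  obtain M where M: "\<And>i j. i \<in> I \<Longrightarrow> j \<in> J \<Longrightarrow> C i ** D j = Q_op p ** kron (mat 1) (M i j)"
  proof -
    have "\<exists>M. i \<in> I \<longrightarrow> j \<in> J \<longrightarrow> C i ** D j = Q_op p ** kron (mat 1) M" for i j
      using opt_product_form by blast
    then show ?thesis using that by metis
  qed
  have "\<exists>i\<in>I. \<exists>j\<in>J. C i ** D j \<noteq> 0"
  proof (rule ccontr)
    assume "\<not> ?thesis"
    then have "(\<Sum>i\<in>I. \<Sum>j\<in>J. (norm (C i ** D j))\<^sup>2) = 0" by simp
    then show False using opt_equalities(2) b(1) by simp
  qed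
  then obtain i0 j0 where ij0: "i0 \<in> I" "j0 \<in> J" "C i0 ** D j0 \<noteq> 0" by blast
  have "M i0 j0 \<noteq> 0"
  proof
    assume "M i0 j0 = 0"
    moreover have "kron (mat 1 :: complex ^ 'n ^ 'n) (0 :: complex ^ 'n ^ 'n) = 0"
      by (simp add: kron_def vec_eq_iff)
    ultimately have "C i0 ** D j0 = 0" using M[OF ij0(1,2)] by simp
    then show False using ij0(3) by simp
  qed
  then obtain x t where "M i0 j0 $ x $ t \<noteq> 0"
    by (auto simp: vec_eq_iff)
  then have "M i0 j0 *v axis t 1 \<noteq> 0"
    using mult_vec_axis[of "M i0 j0" t x] by auto
  then obtain nv m0 where m0: "m0 = M i0 j0 *v nv" "m0 \<noteq> 0" by blast
  define T where "T = D j0 ** emb nv"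
  have CT: "C i ** T = Q_op p ** emb (M i j0 *v nv)" if "i \<in> I" for i
    using M[OF that ij0(2)] by (simp add: T_def matrix_mul_assoc)
      (simp add: matrix_mul_assoc[symmetric] kron_mult_emb)
  \<comment> \<open>Stripping Q from \<open>C i0 ** T = Q_op p ** emb m0\<close> and contracting
    with <m0| leaves |m0|^2 times the identity, so \<open>L0\<close> is a left inverse of
    \<open>T\<close>. It is two-sided because \<open>T\<close> is square.\<close>
  define L0 where "L0 = (1 / (norm m0)\<^sup>2) *\<^sub>R (adj (emb m0) ** Qi ** C i0)"
  have L0Q: "adj (emb m0) ** Qi ** (Q_op p ** A) = adj (emb m0) ** A" for A :: "complex ^ 'n ^ ('n \<times> 'n)"
  proof -
    have "adj (emb m0) ** Qi ** (Q_op p ** A) = adj (emb m0) ** (Qi ** Q_op p) ** A"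
      by (simp add: matrix_mul_assoc)
    then show ?thesis by (simp add: Qi)
  qed
  have L0Q': "adj (emb m0) ** Qi ** (Q_op p ** A) = adj (emb m0) ** A" for A :: "complex ^ ('n \<times> 'n) ^ ('n \<times> 'n)"
  proof -
    have "adj (emb m0) ** Qi ** (Q_op p ** A) = adj (emb m0) ** (Qi ** Q_op p) ** A"
      by (simp add: matrix_mul_assoc)
    then show ?thesis by (simp add: Qi)
  qed
  have "L0 ** T = (1 / (norm m0)\<^sup>2) *\<^sub>R (adj (emb m0) ** Qi ** (C i0 ** T))"
    by (simp add: L0_def scalar_matrix_assoc[symmetric] matrix_mul_assoc)
  also have "\<dots> = (1 / (norm m0)\<^sup>2) *\<^sub>R cscale (of_real ((norm m0)\<^sup>2)) (mat 1)"
    unfolding CT[OF ij0(1)] m0(1)[symmetric] L0Q adj_emb_emb cinner_self ..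
  also have "\<dots> = mat 1"
    using m0(2) by (simp add: cscale_def vec_eq_iff scaleR_conv_of_real[where 'a=complex])
  finally have L0T: "L0 ** T = mat 1" .
  then have TL0: "T ** L0 = mat 1" by (simp add: matrix_left_right_inverse)
  \<comment> \<open>Contracting I \<otimes> \<open>M i0 j\<close> with <m0| leaves I \<otimes>
    <n_j|, up to the factor |m0|^2. Hence \<open>L0 ** D j\<close> is I \<otimes> <n_j|, and every
    decoder operator factors through the same \<open>T\<close>.\<close>
  define nj where "nj = (\<lambda>j. (1 / (norm m0)\<^sup>2) *\<^sub>R (adj (M i0 j) *v m0))"
  have Dj: "D j = T ** adj (emb (nj j))" if "j \<in> J" for j
  proof -
    have "L0 ** D j = (1 / (norm m0)\<^sup>2) *\<^sub>R (adj (emb m0) ** Qi ** (C i0 ** D j))"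
      by (simp add: L0_def scalar_matrix_assoc[symmetric] matrix_mul_assoc)
    also have "\<dots> = (1 / (norm m0)\<^sup>2) *\<^sub>R (adj (emb m0) ** kron (mat 1) (M i0 j))"
      unfolding M[OF ij0(1) that] L0Q' ..
    also have "adj (emb m0) ** kron (mat 1) (M i0 j) = adj (kron (mat 1) (adj (M i0 j)) ** emb m0)"
      by (simp add: adj_mult adj_kron)
    also have "(1 / (norm m0)\<^sup>2) *\<^sub>R \<dots> = adj (emb (nj j))"
      unfolding kron_mult_emb by (simp add: nj_def emb_scaleR adj_scaleR)
    finally have "T ** (L0 ** D j) = T ** adj (emb (nj j))" by simp
    then show ?thesis by (simp add: matrix_mul_assoc TL0)
  qed
  define B where "B = (\<Sum>j\<in>J. ketbra (nj j) (nj j))"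
  have "(mat 1 - (\<Sum>j\<in>J. adj (D j) ** D j)) ** mat 1 = 0"
  proof (rule contraction_kernel)
    show "(\<Sum>j\<in>J. (norm (D j ** mat 1))\<^sup>2) = (norm (mat 1 :: complex ^ ('n \<times> 'n) ^ ('n \<times> 'n)))\<^sup>2"
      unfolding norm_mat_1_sq using opt_equalities(3) by (simp add: d_def power2_eq_square)
  qed (rule fid_contraction)
  then have H: "(\<Sum>j\<in>J. adj (D j) ** D j) = mat 1" by simp
  have kronTB: "kron (adj T ** T) B = mat 1"
  proof -
    have "adj (D j) ** D j = emb (nj j) ** (adj T ** T) ** adj (emb (nj j))" if "j \<in> J" for j
      by (simp add: Dj[OF that] adj_mult matrix_mul_assoc)
    then have "mat 1 = (\<Sum>j\<in>J. emb (nj j) ** (adj T ** T) ** adj (emb (nj j)))"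
      using H by simp
    then show ?thesis by (simp add: emb_sandwich kron_sum_right B_def)
  qed
  have psdB: "psd B" unfolding B_def by (rule psd_sum_ketbra)
  \<comment> \<open>The (t, t) block of the identity \<open>kronTB\<close> reads r
    \<open>adj T ** T\<close> = I, so r is nonzero and \<open>T\<close> is unitary up to the factor
    sqrt r.\<close>
  define r where "r = Re (B $ t $ t)"
  have r: "B $ t $ t = of_real r" "0 \<le> r"
    using psd_diag[OF psdB, of t] by (simp_all add: r_def complex_eq_iff)
  have TT: "(adj T ** T) $ x $ y * of_real r = (if x = y then 1 else 0)" for x y
    using arg_cong[OF kronTB, of "\<lambda>A. A $ (x, t) $ (y, t)"] r
    by (simp add: kron_def mat_1_nth)
  have "r \<noteq> 0" using TT[of t t] by auto
  define U where "U = sqrt r *\<^sub>R T"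
  have UU: "adj U ** U = mat 1"
  proof -
    have "adj U ** U = (sqrt r * sqrt r) *\<^sub>R (adj T ** T)"
      by (simp add: U_def adj_scaleR scalar_matrix_assoc[symmetric] matrix_scalar_ac)
    then show ?thesis
      using TT r(2) by (simp add: vec_eq_iff mat_1_nth scaleR_conv_of_real[where 'a=complex] mult.commute)
  qed
  then have UU': "U ** adj U = mat 1" by (simp add: matrix_left_right_inverse)
  have unitary: "unitary U" using UU UU' by (simp add: unitary_def)
  define m where "m = (\<lambda>i. sqrt r *\<^sub>R (M i j0 *v nv))"
  have Ci: "C i = Q_op p ** emb (m i) ** adj U" if "i \<in> I" for i
  proof -
    have "C i ** U = Q_op p ** emb (m i)"
      by (simp add: U_def m_def matrix_scalar_ac scalar_matrix_assoc[symmetric] CT[OF that] emb_scaleR)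
    then have "C i ** (U ** adj U) = Q_op p ** emb (m i) ** adj U"
      by (simp add: matrix_mul_assoc)
    then show ?thesis by (simp add: UU')
  qed
  \<comment> \<open>Equality of norms gives trace preservation of the encoder only on the range of
    \<open>D j0\<close>; composing with the invertible \<open>T\<close> extends it to all of
    L.\<close>
  have "(mat 1 - (\<Sum>i\<in>I. adj (C i) ** C i)) ** D j0 = 0"
    by (rule contraction_kernel) (rule fid_contraction, rule opt_equalities(4)[OF ij0(2)])
  then have "(mat 1 - (\<Sum>i\<in>I. adj (C i) ** C i)) ** T = 0"
    by (simp add: T_def matrix_mul_assoc)
  then have "(mat 1 - (\<Sum>i\<in>I. adj (C i) ** C i)) ** (T ** L0) = 0"
    by (simp add: matrix_mul_assoc)
  then have "mat 1 - (\<Sum>i\<in>I. adj (C i) ** C i) = 0"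
    by (simp add: TL0)
  then have G: "(\<Sum>i\<in>I. adj (C i) ** C i) = mat 1" by simp
  have E: "(\<Sum>i\<in>I. adj (emb (m i)) ** tw s1 s2 ** emb (m i)) = mat 1"
  proof -
    have "adj (C i) ** C i = U ** (adj (emb (m i)) ** tw s1 s2 ** emb (m i)) ** adj U" if "i \<in> I" for i
      unfolding s1_def s2_def d_def tw_mult[symmetric] Q_op_tw[symmetric]
      by (simp add: Ci[OF that] adj_mult matrix_mul_assoc)
    then have "U ** (\<Sum>i\<in>I. adj (emb (m i)) ** tw s1 s2 ** emb (m i)) ** adj U = mat 1"
      using G by (simp add: matrix_sum_ldistrib matrix_sum_rdistrib)
    then have "adj U ** (U ** (\<Sum>i\<in>I. adj (emb (m i)) ** tw s1 s2 ** emb (m i)) ** adj U) ** U = adj U ** mat 1 ** U"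
      by simp
    moreover have "adj U ** (U ** A ** adj U) ** U = A" for A :: "complex ^ 'n ^ 'n"
    proof -
      have "adj U ** (U ** A ** adj U) ** U = (adj U ** U) ** A ** (adj U ** U)"
        by (simp add: matrix_mul_assoc)
      then show ?thesis by (simp add: UU)
    qed
    ultimately show ?thesis using UU by simp
  qed
  define R where "R = (\<Sum>i\<in>I. ketbra (m i) (m i))"
  \<comment> \<open>The hypothesis \<open>0 < p\<close> enters here: equal eigenvalues of Q^2 would
    give p d^2 = 0.\<close>
  have s: "s1 \<noteq> s2"
  proof
    assume "s1 = s2"
    then have "d * (lam4 d p / (d\<^sup>2 - 1)) = d * lam5 d p" using q by (simp add: s1_def s2_def)
    then have "lam4 d p / (d\<^sup>2 - 1) = lam5 d p" using fid_d by (simp only: mult_cancel_left) auto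
    moreover have "d\<^sup>2 - 1 \<noteq> 0" using b(1) by linarith
    ultimately have "lam4 d p = lam5 d p * (d\<^sup>2 - 1)" by (simp add: divide_eq_eq)
    then have "d\<^sup>2 - 1 + p = (1 - p) * (d\<^sup>2 - 1)" using fid_d by (simp add: lam4_def lam5_def divide_eq_eq)
    then have "p * d\<^sup>2 = 0" by (simp add: algebra_simps)
    then show False using p0 b(1) by simp
  qed
  have tr1: "s1 * d + (s2 - s1) / d = 1"
    using tw_trace_Q[OF fid_d p] fid_d
    by (simp add: s1_def s2_def tw_trace_def field_simps power2_eq_square)
  define k where "k = (s2 - s1) / d"
  have k: "k \<noteq> 0" using s fid_d by (simp add: k_def)
  \<comment> \<open>The transpose of R is scalar because k is nonzero, so R = z I. The normalization
    \<open>tr1\<close> of Q^2 then leaves z = 1.\<close>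
  have Rxy: "of_real s1 * trace R * (if x = y then 1 else 0) + of_real k * R $ y $ x = (if x = y then 1 else 0)" for x y
    using sum_adj_emb_tw_emb[of m s1 s2 I x y] unfolding E R_def[symmetric] d_def[symmetric] k_def[symmetric]
    by (simp add: mat_1_nth)
  define z where "z = (1 - of_real s1 * trace R) / of_real k"
  have Rz: "R $ y $ x = (if x = y then z else 0)" for x y
    using Rxy[of x y] k by (auto simp: z_def field_simps)
  have trR: "trace R = of_real d * z" by (simp add: trace_def Rz d_def)
  have "z * of_real (s1 * d + k) = 1"
    using Rxy[of t t] unfolding trR Rz by (simp add: algebra_simps)
  then have "z = 1" using tr1 by (simp add: k_def del: of_real_add of_real_mult of_real_diff of_real_divide)
  then have "R = mat 1" by (simp add: vec_eq_iff Rz mat_1_nth)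
  then show ?thesis using that[OF unitary] Ci unfolding R_def by blast
qed

end

end

text \<open>The products \<open>C_op p s ** D_op t\<close> are the columns of
  \<open>V_iso p\<close>: unit vectors fixed by the projector. Each of the d^2 terms therefore
  contributes exactly \<open>lam1\<close>.\<close>

lemma fidelity_attained:
  fixes p :: real
  assumes "2 \<le> CARD('n::finite)" "0 \<le> p" "p < 1"
  shows "entanglement_fidelity max_mixed (tr_S \<circ> noise_map p \<circ> (encoder p :: complex ^ 'n ^ 'n \<Rightarrow> _))
    = lam1 (real CARD('n)) p"
proof -
  have "Re (cinner (vectorize (C_op p s ** D_op t)) (noise_adj_choi p *v vectorize (C_op p s ** D_op t)))
      = lam1 (real CARD('n)) p" for s t :: 'n
  proof -
    let ?e = "axis (s, t) 1 :: complex ^ ('n \<times> 'n)"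
    let ?b = "vectorize (C_op p s ** D_op t)"
    have b: "?b = V_iso p *v ?e"
      using column_V_iso[of p "(s, t)"] by (simp add: B_op_def)
    have "P_proj p *v ?b = V_iso p *v ((adj (V_iso p) ** V_iso p) *v ?e)"
      unfolding b P_proj_eq[OF assms] by (simp add: matrix_vector_mul_assoc matrix_mul_assoc)
    then have P: "P_proj p *v ?b = ?b" by (simp add: V_iso_isometry[OF assms] b)
    have "cinner ?b ?b = cinner ?e ((adj (V_iso p) ** V_iso p) *v ?e)"
      unfolding b by (simp add: cinner_adj_left matrix_vector_mul_assoc)
    also have "\<dots> = 1"
      unfolding V_iso_isometry[OF assms] by (simp add: cinner_axis_left axis_nth_eq)
    finally have "(norm ?b)\<^sup>2 = 1"
      unfolding cinner_self by (metis of_real_eq_1_iff)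
    then show ?thesis
      using noise_adj_choi_form[OF assms, of ?b] P by (metis Re_complex_of_real mult.right_neutral)
  qed
  then show ?thesis
    unfolding fidelity_eq[OF assms kraus_on_encoder kraus_on_tr_S]
    using assms(1) by (simp add: power2_eq_square)
qed

section \<open>Rank\<close>

text \<open>All rows of the product lie in the span of the rows of \<open>M\<close>, of which there
  are at most \<open>CARD('k)\<close>.\<close>

lemma rank_le_inner_card:
  fixes K :: "'a::field ^ 'k::finite ^ 'm::finite" and M :: "'a ^ 'n::finite ^ 'k"
  shows "rank (K ** M) \<le> CARD('k)"
proof -
  have "row i (K ** M) = (\<Sum>j\<in>UNIV. K $ i $ j *s row j M)" for i
    by (simp add: row_def matrix_matrix_mult_def vec_eq_iff)
  then have "row i (K ** M) \<in> vec.span (rows M)" for i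
    by (auto simp: rows_def intro!: vec.span_sum vec.span_scale intro: vec.span_base)
  then have "rows (K ** M) \<subseteq> vec.span (rows M)"
    unfolding rows_def[of "K ** M"] by blast
  moreover have fin: "rows M = range (\<lambda>i. row i M)" by (auto simp: rows_def)
  ultimately have "vec.dim (rows (K ** M)) \<le> card (rows M)"
    by (intro vec.dim_le_card) auto
  also have "card (rows M) \<le> CARD('k)" unfolding fin by (rule card_image_le) simp
  finally show ?thesis by (simp add: row_rank_def_gen)
qed

text \<open>The rows of \<open>A ** R\<close> are the images of the rows of \<open>A\<close> under
  one linear map, and their span contains the rows of \<open>L ** A ** R\<close>, which are the
  standard basis.\<close>

lemma card_le_rank:
  fixes A :: "'a::field ^ 'n::finite ^ 'm::finite" and L :: "'a ^ 'm ^ 'k::finite"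
  assumes "L ** A ** R = mat 1"
  shows "CARD('k) \<le> rank A"
proof -
  let ?f = "(*v) (transpose R)"
  have row: "row i (A ** R) = ?f (row i A)" for i
    by (simp add: row_def matrix_matrix_mult_def matrix_vector_mult_def transpose_def vec_eq_iff mult.commute)
  have rows: "rows (A ** R) = ?f ` rows A"
    unfolding rows_def by (auto simp: row)
  have "axis i 1 \<in> vec.span (rows (A ** R))" for i :: 'k
  proof -
    have "axis i 1 = row i (L ** (A ** R))"
      by (simp add: matrix_mul_assoc assms row_def mat_def axis_def vec_eq_iff)
    also have "\<dots> = (\<Sum>j\<in>UNIV. L $ i $ j *s row j (A ** R))"
      by (simp add: row_def matrix_matrix_mult_def vec_eq_iff)
    also have "\<dots> \<in> vec.span (rows (A ** R))"
      by (auto simp: rows_def intro!: vec.span_sum vec.span_scale intro: vec.span_base)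
    finally show ?thesis .
  qed
  then have "cart_basis \<subseteq> vec.span (rows (A ** R))"
    by (auto simp: cart_basis_def)
  then have "UNIV \<subseteq> vec.span (rows (A ** R))"
    using vec.span_minimal[OF _ vec.subspace_span] span_cart_basis by metis
  then have "vec.dim (UNIV :: ('a ^ 'k) set) \<le> vec.dim (rows (A ** R))"
    by (metis vec.dim_span vec.dim_subset)
  also have "\<dots> \<le> vec.dim (rows A)"
    unfolding rows by (rule vec.dim_image_le) simp
  finally show ?thesis unfolding vec_dim_card row_rank_def_gen .
qed

lemma rank_ketbra_le: "rank (ketbra v w) \<le> 1"
proof -
  have "ketbra v w = (\<chi> i. \<chi> (_ :: unit). v $ i) ** (\<chi> _. \<chi> j. cnj (w $ j))"
    by (simp add: ketbra_def matrix_matrix_mult_def vec_eq_iff)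
  then show ?thesis
    using rank_le_inner_card[of "(\<chi> i. \<chi> (_ :: unit). v $ i)" "(\<chi> _. \<chi> j. cnj (w $ j))"] by simp
qed

section \<open>Characteristic polynomials\<close>

text \<open>The index map is the one by which deletion of row and column \<open>i\<close> renumbers
  a matrix.\<close>

lemma sum_skip:
  fixes f :: "nat \<Rightarrow> 'a::ab_group_add"
  assumes "i < Suc k"
  shows "(\<Sum>j<k. f (if j < i then j else Suc j)) = (\<Sum>j<Suc k. f j) - f i"
proof -
  have "bij_betw (\<lambda>j. if j < i then j else Suc j) {..<k} ({..<Suc k} - {i})"
    by (rule bij_betw_byWitness[where f' = "\<lambda>j. if j < i then j else j - 1"]) (use assms in auto)
  then have "(\<Sum>j<k. f (if j < i then j else Suc j)) = (\<Sum>j\<in>{..<Suc k} - {i}. f j)"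
    by (rule sum.reindex_bij_betw)
  then show ?thesis using assms by (simp add: sum_diff1 del: sum.lessThan_Suc)
qed

text \<open>The derivative of the characteristic polynomial is the sum of the characteristic polynomials of
  the principal submatrices, which carries the claim from one dimension to the next.\<close>

lemma coeff_char_poly_trace:
  fixes A :: "'a::field_char_0 Matrix.mat"
  assumes "A \<in> carrier_mat (Suc k) (Suc k)"
  shows "coeff (char_poly A) k = - (\<Sum>i<Suc k. A $$ (i, i))"
  using assms
proof (induction k arbitrary: A)
  case 0
  then have "upper_triangular A" by (auto simp: upper_triangular_def)
  from char_poly_upper_triangular[OF 0 this] have "char_poly A = [:- A $$ (0, 0), 1:]"
    using 0 by (auto simp: diag_mat_def)
  then show ?case by simp
next
  case (Suc k)
  have del: "mat_delete A i i \<in> carrier_mat (Suc k) (Suc k)" for i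
    using mat_delete_carrier[OF Suc.prems] by simp
  have diag: "(\<Sum>j<Suc k. mat_delete A i i $$ (j, j)) = (\<Sum>j<Suc (Suc k). A $$ (j, j)) - A $$ (i, i)"
    if i: "i < Suc (Suc k)" for i
  proof -
    have "(\<Sum>j<Suc k. mat_delete A i i $$ (j, j)) = (\<Sum>j<Suc k. A $$ (if j < i then j else Suc j, if j < i then j else Suc j))"
      using mat_delete_index[OF Suc.prems i i] by (intro sum.cong refl) (simp add: insert_index_def)
    then show ?thesis using sum_skip[OF i, of "\<lambda>j. A $$ (j, j)"] by simp
  qed
  let ?t = "\<Sum>j<Suc (Suc k). A $$ (j, j)"
  have "of_nat (Suc k) * coeff (char_poly A) (Suc k) = coeff (pderiv (char_poly A)) k"
    by (simp add: coeff_pderiv)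
  also have "\<dots> = (\<Sum>i<Suc (Suc k). coeff (char_poly (mat_delete A i i)) k)"
    by (simp add: pderiv_char_poly[OF Suc.prems] coeff_sum del: sum.lessThan_Suc)
  \<comment> \<open>Each submatrix contributes minus its trace, that is
    \<open>A $$ (i, i) - ?t\<close>. The k + 2 copies of - t and the diagonal sum t combine to - (k
    + 1) t, and the factor cancels.\<close>
  also have "\<dots> = (\<Sum>i<Suc (Suc k). A $$ (i, i) - ?t)"
    by (intro sum.cong refl) (simp add: Suc.IH[OF del] diag del: sum.lessThan_Suc)
  also have "\<dots> = of_nat (Suc k) * (- ?t)"
    by (simp add: sum_subtractf algebra_simps del: sum.lessThan_Suc)
  finally show ?case
    by (simp only: mult_cancel_left of_nat_eq_0_iff) simp
qed

text \<open>The claims about the leading coefficient and the vanishing ones above it feed the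
  induction: multiplying by X - a subtracts a times the old leading coefficient from the old second
  one.\<close>

lemma coeff_prod_linear:
  fixes as :: "'a::comm_ring_1 list"
  shows "coeff (\<Prod>a\<leftarrow>as. [:- a, 1:]) (length as) = 1 \<and> (\<forall>k>length as. coeff (\<Prod>a\<leftarrow>as. [:- a, 1:]) k = 0)
    \<and> (as \<noteq> [] \<longrightarrow> coeff (\<Prod>a\<leftarrow>as. [:- a, 1:]) (length as - 1) = - sum_list as)"
proof (induction as)
  case (Cons a as)
  then show ?case
    by (cases as) (auto simp: mult_pCons_left coeff_pCons split: nat.splits)
qed simp

lemma proots_prod_linear:
  "proots (\<Prod>a\<leftarrow>as. [:- a, 1:]) = mset as" for as :: "'a::idom list"
proof (induction as)
  case (Cons a as)
  have "(\<Prod>a\<leftarrow>as. [:- a, 1:]) \<noteq> 0" by (auto simp: prod_list_zero_iff)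
  then show ?case using Cons by (simp add: proots_mult del: mult_pCons_left)
qed simp

lemma sum_proots_char_poly:
  fixes A :: "complex Matrix.mat"
  assumes "A \<in> carrier_mat n n"
  shows "sum_mset (proots (char_poly A)) = (\<Sum>i<n. A $$ (i, i))"
proof -
  obtain as where as: "char_poly A = (\<Prod>a\<leftarrow>as. [:- a, 1:])" "length as = n"
    using char_poly_factorized[OF assms] by blast
  show ?thesis
  proof (cases n)
    case 0
    then show ?thesis using as by simp
  next
    case (Suc k)
    then have "as \<noteq> []" using as by auto
    then have "coeff (char_poly A) k = - sum_list as"
      using coeff_prod_linear[of as] as Suc by simp
    then show ?thesis
      using coeff_char_poly_trace[of A k] assms Suc unfolding as(1) proots_prod_linear
      by (simp add: sum_mset_sum_list del: sum.lessThan_Suc)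
  qed
qed

text \<open>\<open>W\<close> is c times an idempotent, so its eigenvalues are 0 and c. On these x
  log x = x log c, also at 0 by the convention for the logarithm, and the entropy becomes - log c
  times the trace.\<close>

lemma vn_entropy_scaled_projection:
  fixes W :: "complex Matrix.mat" and c :: real
  assumes W: "W \<in> carrier_mat n n" and sq: "W * W = of_real c \<cdot>\<^sub>m W" and tr: "(\<Sum>i<n. W $$ (i, i)) = 1"
  shows "vn_entropy W = - log 2 c"
proof -
  have root: "x = 0 \<or> x = of_real c" if "x \<in># proots (char_poly W)" for x
  proof -
    have "char_poly W \<noteq> 0" using degree_monic_char_poly[OF W] by auto
    then have "poly (char_poly W) x = 0" using that by auto
    then obtain v where v: "v \<in> carrier_vec n" "v \<noteq> 0\<^sub>v n" "W *\<^sub>v v = x \<cdot>\<^sub>v v"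
      using W unfolding eigenvalue_root_char_poly[OF W, symmetric] eigenvalue_def eigenvector_def by auto
    have "(W * W) *\<^sub>v v = (x * x) \<cdot>\<^sub>v v"
      using v W by (simp add: assoc_mult_mat_vec[OF W W v(1)] mult_mat_vec[OF W v(1)] smult_smult_assoc)
    moreover have "(W * W) *\<^sub>v v = (of_real c * x) \<cdot>\<^sub>v v"
    proof -
      have "(of_real c \<cdot>\<^sub>m W) *\<^sub>v v = of_real c \<cdot>\<^sub>v (W *\<^sub>v v)"
        using W v(1) by (intro eq_vecI) auto
      then show ?thesis unfolding sq by (simp add: v(3) smult_smult_assoc)
    qed
    ultimately have eq: "(x * x) \<cdot>\<^sub>v v = (of_real c * x) \<cdot>\<^sub>v v" by simp
    have "\<exists>i<n. Matrix.vec_index v i \<noteq> 0"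
    proof (rule ccontr)
      assume "\<not> ?thesis"
      then have "v = 0\<^sub>v n" using v(1) by (intro eq_vecI) auto
      then show False using v(2) by simp
    qed
    then obtain i where i: "i < n" "Matrix.vec_index v i \<noteq> 0" by blast
    have "Matrix.vec_index ((x * x) \<cdot>\<^sub>v v) i = Matrix.vec_index ((of_real c * x) \<cdot>\<^sub>v v) i" by (simp only: eq)
    then have "x * x = of_real c * x" using i v(1) by simp
    then show ?thesis by simp
  qed
  have "(\<Sum>x\<in>#proots (char_poly W). Re x * log 2 (Re x)) = (\<Sum>x\<in>#proots (char_poly W). Re x * log 2 c)"
  proof (intro arg_cong[where f=sum_mset] image_mset_cong)
    fix x assume "x \<in># proots (char_poly W)"
    then show "Re x * log 2 (Re x) = Re x * log 2 c" using root[of x] by auto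
  qed
  also have "\<dots> = (\<Sum>x\<in>#proots (char_poly W). Re x) * log 2 c"
    by (simp add: sum_mset_distrib_right)
  also have "(\<Sum>x\<in>#proots (char_poly W). Re x) = Re (sum_mset (proots (char_poly W)))"
  proof -
    have "(\<Sum>x\<in>#M. Re x) = Re (sum_mset M)" for M by (induction M) auto
    then show ?thesis .
  qed
  also have "\<dots> = 1" unfolding sum_proots_char_poly[OF W] tr by simp
  finally show ?thesis by (simp add: vn_entropy_def)
qed

section \<open>Resolutions of the identity\<close>

text \<open>Applying the resolution to one of its own vectors gives |m_i|^4 \<le> |m_i|^2, hence
  |m_i| \<le> 1. The squared norms add up to the dimension, so at least that many vectors
  occur.\<close>

lemma card_le_resolution:
  fixes m :: "'i \<Rightarrow> complex ^ 'n::finite"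
  assumes "finite I" "(\<Sum>i\<in>I. ketbra (m i) (m i)) = mat 1"
  shows "CARD('n) \<le> card I"
proof -
  have le1: "(norm (m i))\<^sup>2 \<le> 1" if "i \<in> I" for i
  proof -
    have "complex_of_real ((norm (m i))\<^sup>2) = of_real (\<Sum>j\<in>I. (cmod (cinner (m j) (m i)))\<^sup>2)"
      using cinner_sum_ketbra[of "m i" m I] unfolding assms(2) matrix_vector_mul_lid cinner_self .
    then have "(norm (m i))\<^sup>2 = (\<Sum>j\<in>I. (cmod (cinner (m j) (m i)))\<^sup>2)"
      unfolding of_real_eq_iff .
    also have "\<dots> \<ge> (cmod (cinner (m i) (m i)))\<^sup>2"
      using that assms(1) by (intro member_le_sum) auto
    finally have "((norm (m i))\<^sup>2)\<^sup>2 \<le> (norm (m i))\<^sup>2"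
      by (simp add: cinner_self norm_power)
    moreover have "t \<le> 1" if "t\<^sup>2 \<le> t" for t :: real
    proof (rule ccontr)
      assume "\<not> t \<le> 1"
      then have "t * 1 < t * t" by (intro mult_strict_left_mono) auto
      then show False using that by (simp add: power2_eq_square)
    qed
    ultimately show ?thesis by blast
  qed
  have "complex_of_real (\<Sum>i\<in>I. (norm (m i))\<^sup>2) = trace (\<Sum>i\<in>I. ketbra (m i) (m i))"
    by (simp add: trace_sum trace_ketbra cinner_self)
  also have "\<dots> = of_real (real CARD('n))" by (simp add: assms(2) trace_I)
  finally have "real CARD('n) = (\<Sum>i\<in>I. (norm (m i))\<^sup>2)" unfolding of_real_eq_iff by simp
  also have "\<dots> \<le> (\<Sum>i\<in>I. 1)" by (intro sum_mono le1)
  finally show ?thesis by simp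
qed

lemma norm_sq_le_card:
  fixes K :: "complex ^ 'a::finite ^ 'b::finite"
  assumes "\<And>v. (norm (K *v v))\<^sup>2 \<le> (norm v)\<^sup>2"
  shows "(norm K)\<^sup>2 \<le> real CARD('a)"
  using sum_norm_le_card[of "\<lambda>_. K" "{()}"] assms by simp

section \<open>Attainment of the optimum over encoders of Choi rank one\<close>

lemma choi_rank_le: "kraus Ks \<Phi> \<Longrightarrow> choi_rank \<Phi> \<le> length Ks"
  unfolding choi_rank_def by (rule Least_le) blast

lemma kraus_choi_rank:
  fixes \<Phi> :: "complex ^ 'a::finite ^ 'a \<Rightarrow> complex ^ 'b::finite ^ 'b"
  assumes "cptni \<Phi>"
  obtains Ks where "kraus Ks \<Phi>" "length Ks = choi_rank \<Phi>"
proof -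
  obtain K :: "'a \<times> 'b \<Rightarrow> _" where "kraus_on UNIV K \<Phi>" using cptni_kraus_on[OF assms] .
  then obtain xs where "kraus (map K xs) \<Phi>" using kraus_on_list by metis
  then have "\<exists>r. \<exists>Ks. length Ks = r \<and> kraus Ks \<Phi>" by blast
  then have "\<exists>Ks. length Ks = choi_rank \<Phi> \<and> kraus Ks \<Phi>"
    unfolding choi_rank_def by (rule LeastI_ex)
  then show ?thesis using that by blast
qed

lemma choi_rank_le_1_kraus:
  fixes \<Phi> :: "complex ^ 'a::finite ^ 'a \<Rightarrow> complex ^ 'b::finite ^ 'b"
  assumes "cptni \<Phi>" "choi_rank \<Phi> \<le> 1"
  obtains K where "kraus_on {()} (\<lambda>_. K) \<Phi>"
proof -
  obtain Ks where Ks: "kraus Ks \<Phi>" "length Ks \<le> 1"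
    using kraus_choi_rank[OF assms(1)] assms(2) by metis
  show ?thesis
  proof (cases Ks)
    \<comment> \<open>Choi rank 0 is the zero map; the single Kraus operator 0 brings it into the
      common form.\<close>
    case Nil
    then have "kraus_on {()} (\<lambda>_. 0) \<Phi>" using Ks(1) by (simp add: kraus_def kraus_on_def)
    then show ?thesis by (rule that)
  next
    case (Cons K Ls)
    then have "kraus_on {()} (\<lambda>_. K) \<Phi>" using Ks by (simp add: kraus_def kraus_on_def)
    then show ?thesis by (rule that)
  qed
qed

text \<open>Pairs with one encoder operator and a fixed number of decoder operators form a closed
  bounded set in a finite-dimensional space, on which the fidelity is continuous. Attainment makes
  the equality case applicable to \<open>F1_opt\<close> itself.\<close>

lemma F1_attained:
  fixes p :: real
  assumes n: "2 \<le> CARD('n::finite)" and p: "0 \<le> p" "p < 1"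
  obtains C :: "complex ^ 'n ^ 'n \<Rightarrow> complex ^ ('n \<times> 'n) ^ ('n \<times> 'n)" and D
  where "cptni C" "cptni D" "choi_rank C \<le> 1"
    "F1_opt (max_mixed :: complex ^ 'n ^ 'n) (noise_map p :: complex ^ ('n \<times> 'n) ^ ('n \<times> 'n) \<Rightarrow> _)
      = entanglement_fidelity max_mixed (D \<circ> noise_map p \<circ> C)"
proof -
  let ?N = "noise_map p :: complex ^ ('n \<times> 'n) ^ ('n \<times> 'n) \<Rightarrow> _"
  let ?J = "noise_adj_choi p :: complex ^ (('n \<times> 'n) \<times> ('n \<times> 'n)) ^ _"
  \<comment> \<open>The d^3 decoder operators, indexed by pairs of input and output labels, suffice
    for every CPTNI decoder by \<open>cptni_kraus_on\<close>. The contraction conditions are exactly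
    the CPTNI conditions for both maps.\<close>
  define S :: "((complex ^ 'n ^ ('n \<times> 'n)) \<times> (complex ^ ('n \<times> 'n) ^ 'n ^ (('n \<times> 'n) \<times> 'n))) set"
    where "S = {x. (\<forall>v. (norm (fst x *v v))\<^sup>2 \<le> (norm v)\<^sup>2) \<and>
      (\<forall>w. (\<Sum>j\<in>UNIV. (norm (snd x $ j *v w))\<^sup>2) \<le> (norm w)\<^sup>2)}"
  define f where "f = (\<lambda>x :: (complex ^ 'n ^ ('n \<times> 'n)) \<times> (complex ^ ('n \<times> 'n) ^ 'n ^ (('n \<times> 'n) \<times> 'n)). (1 / (real CARD('n))\<^sup>2) *
    (\<Sum>j\<in>UNIV. Re (cinner (vectorize (fst x ** (snd x $ j))) (?J *v vectorize (fst x ** (snd x $ j))))))"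
  define EC where "EC = (\<lambda>x :: (complex ^ 'n ^ ('n \<times> 'n)) \<times> (complex ^ ('n \<times> 'n) ^ 'n ^ (('n \<times> 'n) \<times> 'n)). \<lambda>\<rho>. fst x ** \<rho> ** adj (fst x))"
  define DC where "DC = (\<lambda>x :: (complex ^ 'n ^ ('n \<times> 'n)) \<times> (complex ^ ('n \<times> 'n) ^ 'n ^ (('n \<times> 'n) \<times> 'n)). \<lambda>\<rho>. \<Sum>j\<in>UNIV. (snd x $ j) ** \<rho> ** adj (snd x $ j))"
  have kEC: "kraus_on {()} (\<lambda>_. fst x) (EC x)" and kDC: "kraus_on UNIV (\<lambda>j. snd x $ j) (DC x)" for x
    by (simp_all add: kraus_on_def EC_def DC_def)
  have fid: "entanglement_fidelity max_mixed (DC x \<circ> ?N \<circ> EC x) = f x" for x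
    using fidelity_eq[OF n p kEC[of x] kDC[of x]] by (simp add: f_def)
  have S_iff: "x \<in> S \<longleftrightarrow> cptni (EC x) \<and> cptni (DC x)" for x
    by (simp add: S_def cptni_iff_kraus_on[OF kEC] cptni_iff_kraus_on[OF kDC])
  have cont_mv: "continuous_on UNIV (\<lambda>x. g x *v v)"
    if "continuous_on UNIV g" for g :: "'z::topological_space \<Rightarrow> complex ^ 'b::finite ^ 'c::finite" and v
    unfolding matrix_vector_mult_def by (intro continuous_intros that)
  have cl: "closed S"
    unfolding S_def
    by (intro closed_Collect_conj closed_Collect_all closed_Collect_le continuous_intros cont_mv)
  have bd: "bounded S"
  proof -
    have "norm x \<le> sqrt (real CARD('n)) + sqrt (real CARD('n \<times> 'n))" if "x \<in> S" for x
    proof -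
      have "(norm (fst x))\<^sup>2 \<le> real CARD('n)"
        by (rule norm_sq_le_card) (use that in \<open>simp add: S_def\<close>)
      moreover have "(norm (snd x))\<^sup>2 = (\<Sum>j\<in>UNIV. (norm (snd x $ j))\<^sup>2)"
        by (simp add: norm_vec_def[of "snd x"] L2_set_def sum_nonneg)
      then have "(norm (snd x))\<^sup>2 \<le> real CARD('n \<times> 'n)"
        using sum_norm_le_card[of "\<lambda>j. snd x $ j" UNIV] that by (simp add: S_def)
      ultimately have "norm (fst x) \<le> sqrt (real CARD('n))" "norm (snd x) \<le> sqrt (real CARD('n \<times> 'n))"
        using real_le_rsqrt by blast+
      moreover have "norm x \<le> norm (fst x) + norm (snd x)"
        using norm_Pair_le[of "fst x" "snd x"] by simp
      ultimately show ?thesis by linarith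
    qed
    then show ?thesis by (rule boundedI)
  qed
  have comp: "compact S" using cl bd by (simp add: compact_eq_bounded_closed)
  have ne: "S \<noteq> {}"
  proof -
    have "0 \<in> S" by (simp add: S_def)
    then show ?thesis by blast
  qed
  have cont: "continuous_on S f"
    unfolding f_def cinner_def vectorize_def matrix_vector_mult_def matrix_matrix_mult_def vec_lambda_beta
    by (intro continuous_intros)
  obtain x where x: "x \<in> S" "\<And>y. y \<in> S \<Longrightarrow> f y \<le> f x"
    using continuous_attains_sup[OF comp ne cont] by blast
  have "choi_rank (EC x) \<le> 1"
    using choi_rank_le[of "[fst x]" "EC x"] by (simp add: kraus_def EC_def)
  moreover have "F1_opt (max_mixed :: complex ^ 'n ^ 'n) ?N = entanglement_fidelity max_mixed (DC x \<circ> ?N \<circ> EC x)"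
    unfolding F1_opt_def
  proof (rule cSup_eq_maximum)
    show "entanglement_fidelity max_mixed (DC x \<circ> ?N \<circ> EC x)
        \<in> {entanglement_fidelity (max_mixed :: complex ^ 'n ^ 'n) (D \<circ> ?N \<circ> C) |C D. cptni C \<and> cptni D \<and> choi_rank C \<le> 1}"
      using calculation x(1) S_iff[of x] by (intro CollectI exI[of _ "EC x"] exI[of _ "DC x"]) simp
    fix r assume "r \<in> {entanglement_fidelity (max_mixed :: complex ^ 'n ^ 'n) (D \<circ> ?N \<circ> C) |C D. cptni C \<and> cptni D \<and> choi_rank C \<le> 1}"
    then obtain C :: "complex ^ 'n ^ 'n \<Rightarrow> _" and D where CD: "r = entanglement_fidelity max_mixed (D \<circ> ?N \<circ> C)" "cptni C" "cptni D" "choi_rank C \<le> 1"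
      by blast
    obtain K where K: "kraus_on {()} (\<lambda>_. K) C" using choi_rank_le_1_kraus[OF CD(2,4)] .
    obtain L :: "('n \<times> 'n) \<times> 'n \<Rightarrow> _" where L: "kraus_on UNIV L D" using cptni_kraus_on[OF CD(3)] .
    define y where "y = (K, \<chi> j. L j)"
    have "EC y = C" "DC y = D"
      using kraus_onD[OF K] kraus_onD[OF L] by (auto simp: fun_eq_iff EC_def DC_def y_def)
    then have "y \<in> S" "r = f y" using CD S_iff fid[of y] by auto
    then show "r \<le> entanglement_fidelity max_mixed (DC x \<circ> ?N \<circ> EC x)" using x(2) fid[of x] by simp
  qed
  ultimately show ?thesis using that[of "EC x" "DC x"] x(1) S_iff[of x] by blast
qed

section \<open>Properties of optimal encoders\<close>

context
  fixes p :: real and I :: "'i set" and C :: "'i \<Rightarrow> complex ^ 'n::finite ^ ('n \<times> 'n)" and \<C> U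
    and m :: "'i \<Rightarrow> complex ^ 'n"
  assumes n: "2 \<le> CARD('n)" and p: "0 \<le> p" "p < 1"
    and C: "kraus_on I C \<C>" and U: "unitary U"
    and form: "\<And>i. i \<in> I \<Longrightarrow> C i = Q_op p ** emb (m i) ** adj U"
    and res: "(\<Sum>i\<in>I. ketbra (m i) (m i)) = mat 1"
begin

text \<open>The vectors \<open>m i\<close> enter the encoder only through the sum of their
  projections, which is the identity on S.\<close>

lemma encoder_form: "\<C> = encoder p \<circ> unitary_channel (adj U)"
proof
  fix \<rho>
  have "C i ** \<rho> ** adj (C i) = Q_op p ** (emb (m i) ** (adj U ** \<rho> ** U) ** adj (emb (m i))) ** Q_op p"
    if "i \<in> I" for i
    by (simp add: form[OF that] adj_mult matrix_mul_assoc)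
  then have "\<C> \<rho> = Q_op p ** kron (adj U ** \<rho> ** U) (\<Sum>i\<in>I. ketbra (m i) (m i)) ** Q_op p"
    by (simp add: kraus_onD[OF C] emb_sandwich kron_sum_right matrix_sum_ldistrib matrix_sum_rdistrib)
  then show "\<C> \<rho> = (encoder p \<circ> unitary_channel (adj U)) \<rho>"
    by (simp add: res encoder_def unitary_channel_def)
qed

text \<open>Cyclicity cancels U, and the normalization of Q^2 turns the remaining trace into an
  inner product. The exchange matrix is thus the Gram matrix of the \<open>m i\<close> divided by
  d.\<close>

lemma exchange_entry:
  assumes "i \<in> I" "j \<in> I"
  shows "trace (C i ** max_mixed ** adj (C j)) = cinner (m j) (m i) / of_nat CARD('n)"
proof -
  define d where "d = real CARD('n)"
  have d: "2 \<le> d" using n by (simp add: d_def)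
  define s1 where "s1 = q1_of d p * q1_of d p"
  define s2 where "s2 = q2_of d p * q2_of d p"
  have "trace (C i ** max_mixed ** adj (C j)) = (1 / d) *\<^sub>R trace (C i ** adj (C j))"
    by (simp add: max_mixed_def matrix_scalar_ac scalar_matrix_assoc[symmetric] trace_scaleR d_def)
  also have "trace (C i ** adj (C j)) = trace (adj (C j) ** C i)" by (rule trace_mul_sym)
  also have "\<dots> = trace (U ** (adj (emb (m j)) ** tw s1 s2 ** emb (m i) ** adj U))"
    unfolding s1_def s2_def d_def tw_mult[symmetric] Q_op_tw[symmetric]
    by (simp add: form[OF assms(1)] form[OF assms(2)] adj_mult matrix_mul_assoc)
  also have "\<dots> = trace (adj (emb (m j)) ** tw s1 s2 ** emb (m i) ** adj U ** U)" by (rule trace_mul_sym)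
  also have "\<dots> = trace (adj (emb (m j)) ** tw s1 s2 ** emb (m i))"
    using U by (simp add: unitary_def matrix_mul_assoc[symmetric])
  also have "\<dots> = of_real (s1 * d + (s2 - s1) / d) * cinner (m j) (m i)"
  proof -
    have "trace (adj (emb (m j)) ** tw s1 s2 ** emb (m i))
        = of_nat CARD('n) * (of_real s1 * cinner (m j) (m i))
          + of_real ((s2 - s1) / d) * cinner (m j) (m i)"
      by (simp add: trace_def adj_emb_tw_emb sum.distrib cinner_def d_def sum_distrib_left
          del: of_real_divide of_real_diff)
    then show ?thesis by (simp add: d_def algebra_simps)
  qed
  also have "s1 * d + (s2 - s1) / d = 1"
    using tw_trace_Q[OF d p] d
    by (simp add: s1_def s2_def tw_trace_def field_simps power2_eq_square)
  finally show ?thesis by (simp add: d_def scaleR_conv_of_real[where 'a=complex])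
qed

text \<open>The output is Q F \<open>adj F\<close> Q with F an isometry from S and Q invertible, so
  its rank is the dimension d of S.\<close>

lemma output_rank:
  assumes "norm \<phi> = 1"
  shows "rank (\<C> (ketbra \<phi> \<phi>)) = CARD('n)"
proof -
  define d where "d = real CARD('n)"
  have d: "2 \<le> d" using n by (simp add: d_def)
  define \<psi> where "\<psi> = adj U *v \<phi>"
  define Qi :: "complex ^ ('n \<times> 'n) ^ ('n \<times> 'n)" where "Qi = tw (1 / q1_of d p) (1 / q2_of d p)"
  have Qi: "Qi ** Q_op p = mat 1" "Q_op p ** Qi = mat 1"
  proof -
    have "q1_of d p \<noteq> 0" "q2_of d p \<noteq> 0" using q_of_sq(1,2)[OF d p] by auto
    from tw_inverse[OF this] show "Qi ** Q_op p = mat 1" "Q_op p ** Qi = mat 1"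
      unfolding Qi_def Q_op_tw d_def[symmetric] by auto
  qed
  have "cinner \<psi> \<psi> = cinner \<phi> ((U ** adj U) *v \<phi>)"
    unfolding \<psi>_def by (simp add: cinner_adj_left matrix_vector_mul_assoc)
  then have \<psi>: "cinner \<psi> \<psi> = 1" using U assms by (simp add: unitary_def cinner_self)
  \<comment> \<open>F is |\<psi>> \<otimes> I, so that \<open>F ** adj F\<close> is the operator
    |\<psi>><\<psi>| \<otimes> I between the two factors Q.\<close>
  define F :: "complex ^ 'n ^ ('n \<times> 'n)" where "F = (\<chi> k s. \<psi> $ fst k * (if snd k = s then 1 else 0))"
  have FF: "adj F ** F = mat 1"
  proof -
    have "(adj F ** F) $ s $ t = (\<Sum>a\<in>UNIV. \<Sum>b\<in>UNIV. if b = s then cnj (\<psi> $ a) * \<psi> $ a * (if s = t then 1 else 0) else 0)" for s t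
      unfolding matrix_matrix_mult_def vec_lambda_beta sum_UNIV_prod
      by (intro sum.cong refl) (auto simp: adj_def F_def)
    then have "(adj F ** F) $ s $ t = cinner \<psi> \<psi> * (if s = t then 1 else 0)" for s t
      by (simp add: cinner_def)
    then show ?thesis by (simp add: \<psi> vec_eq_iff mat_1_nth)
  qed
  have "F ** adj F = kron (ketbra \<psi> \<psi>) (mat 1)"
  proof -
    have "(F ** adj F) $ k $ l = (\<Sum>s\<in>UNIV. if s = snd k then \<psi> $ fst k * cnj (\<psi> $ fst l) * (if snd k = snd l then 1 else 0) else 0)" for k l
      unfolding matrix_matrix_mult_def vec_lambda_beta
      by (intro sum.cong refl) (auto simp: adj_def F_def)
    then show ?thesis by (simp add: vec_eq_iff kron_def ketbra_def mat_1_nth)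
  qed
  moreover have "unitary_channel (adj U) (ketbra \<phi> \<phi>) = ketbra \<psi> \<psi>"
    by (simp add: unitary_channel_def \<psi>_def mult_ketbra ketbra_mult)
  ultimately have "\<C> (ketbra \<phi> \<phi>) = Q_op p ** (F ** adj F) ** Q_op p"
    by (simp add: encoder_form encoder_def)
  then have CF: "\<C> (ketbra \<phi> \<phi>) = (Q_op p ** F) ** (adj F ** Q_op p)"
    by (simp add: matrix_mul_assoc)
  show ?thesis
  proof (rule antisym)
    show "rank (\<C> (ketbra \<phi> \<phi>)) \<le> CARD('n)" unfolding CF by (rule rank_le_inner_card)
    have "(adj F ** Qi) ** \<C> (ketbra \<phi> \<phi>) ** (Qi ** F)
        = adj F ** (Qi ** Q_op p) ** F ** (adj F ** (Q_op p ** Qi) ** F)"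
      by (simp add: CF matrix_mul_assoc)
    also have "\<dots> = mat 1" by (simp add: Qi FF)
    finally show "CARD('n) \<le> rank (\<C> (ketbra \<phi> \<phi>))" by (rule card_le_rank)
  qed
qed

lemma output_trace_preserving: "trace_preserving \<C>"
proof -
  have "trace_preserving (encoder p :: complex ^ 'n ^ 'n \<Rightarrow> _)"
    by (rule trace_preserving_kraus_on[OF kraus_on_encoder sum_adj_C_op[OF n p]])
  moreover have "trace (unitary_channel (adj U) \<rho>) = trace \<rho>" for \<rho>
  proof -
    have "trace (unitary_channel (adj U) \<rho>) = trace (adj U ** (\<rho> ** U))"
      by (simp add: unitary_channel_def matrix_mul_assoc)
    also have "\<dots> = trace (\<rho> ** U ** adj U)" by (rule trace_mul_sym)
    finally show ?thesis using U by (simp add: unitary_def matrix_mul_assoc[symmetric])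
  qed
  ultimately show ?thesis by (simp add: encoder_form trace_preserving_def)
qed

lemma output_density:
  assumes "norm \<phi> = 1"
  shows "density (\<C> (ketbra \<phi> \<phi>))"
proof -
  have "\<C> (ketbra \<phi> \<phi>) = (\<Sum>i\<in>I. ketbra (C i *v \<phi>) (C i *v \<phi>))"
    by (simp add: kraus_onD[OF C] mult_ketbra ketbra_mult)
  then have "psd (\<C> (ketbra \<phi> \<phi>))" by (simp add: psd_sum_ketbra)
  moreover have "trace (\<C> (ketbra \<phi> \<phi>)) = 1"
    using output_trace_preserving assms by (simp add: trace_preserving_def trace_ketbra cinner_self)
  ultimately show ?thesis by (simp add: density_def)
qed

end

text \<open>A Gram matrix of vectors resolving the identity is idempotent. The exchange matrix is
  therefore 1/d times a projection, whatever the length of the Kraus list.\<close>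

lemma entropy_exchange_optimal:
  fixes Cs :: "(complex ^ 'n::finite ^ ('n \<times> 'n)) list"
  assumes n: "2 \<le> CARD('n)" and p: "0 \<le> p" "p < 1" and Cs: "kraus Cs \<C>" and U: "unitary U"
    and form: "\<And>i. i < length Cs \<Longrightarrow> Cs ! i = Q_op p ** emb (m i) ** adj U"
    and res: "(\<Sum>i<length Cs. ketbra (m i) (m i)) = mat 1"
  shows "entropy_exchange Cs max_mixed = log 2 (real CARD('n))"
proof -
  define r where "r = length Cs"
  define W where "W = exchange_matrix Cs max_mixed"
  define c where "c = 1 / real CARD('n)"
  have W: "W \<in> carrier_mat r r" by (simp add: W_def exchange_matrix_def r_def)
  have entry: "W $$ (i, j) = of_real c * cinner (m j) (m i)" if "i < r" "j < r" for i j
    using exchange_entry[OF n p Cs[unfolded kraus_iff_kraus_on] U, of m i j] form res that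
    by (simp add: W_def exchange_matrix_def r_def c_def)
  have sum1: "(\<Sum>j<r. cinner v (m j) * cinner (m j) w) = cinner v w" for v w
  proof -
    have "cinner v ((\<Sum>j<r. ketbra (m j) (m j)) *v w) = (\<Sum>j<r. cinner v (m j) * cinner (m j) w)"
      by (simp add: matrix_vector_sum_rdistrib cinner_sum_right ketbra_mult_vec cinner_scale_right mult.commute)
    then show ?thesis using res by (simp add: r_def)
  qed
  have "W * W = of_real c \<cdot>\<^sub>m W"
  proof (rule eq_matI)
    fix i k assume "i < dim_row (of_real c \<cdot>\<^sub>m W)" "k < dim_col (of_real c \<cdot>\<^sub>m W)"
    then have ik: "i < r" "k < r" using W by auto
    have "(W * W) $$ (i, k) = (\<Sum>j<r. W $$ (i, j) * W $$ (j, k))"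
      using W ik by (simp add: scalar_prod_def atLeast0LessThan)
    also have "\<dots> = (\<Sum>j<r. of_real c * of_real c * (cinner (m k) (m j) * cinner (m j) (m i)))"
      by (intro sum.cong refl) (simp add: entry ik)
    also have "\<dots> = of_real c * (of_real c * cinner (m k) (m i))"
      by (simp add: sum_distrib_left[symmetric] sum1)
    finally show "(W * W) $$ (i, k) = (of_real c \<cdot>\<^sub>m W) $$ (i, k)"
      using W ik by (simp add: entry)
  qed (use W in auto)
  moreover have "(\<Sum>i<r. W $$ (i, i)) = 1"
  proof -
    have "(\<Sum>i<r. W $$ (i, i)) = of_real c * trace (\<Sum>i<r. ketbra (m i) (m i))"
      by (simp add: entry trace_sum trace_ketbra sum_distrib_left)
    also have "\<dots> = 1" using res by (simp add: r_def trace_I c_def)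
    finally show ?thesis .
  qed
  ultimately have "vn_entropy W = - log 2 c" by (rule vn_entropy_scaled_projection[OF W])
  then show ?thesis
    by (simp add: entropy_exchange_def W_def c_def log_divide)
qed

section \<open>Optimal fidelity\<close>

lemma F_opt_noise_map:
  fixes p :: real
  assumes n: "2 \<le> CARD('n::finite)" and p: "0 \<le> p" "p < 1"
  shows "cptni (encoder p :: complex ^ 'n ^ 'n \<Rightarrow> _)"
    "cptni (tr_S :: complex ^ ('n \<times> 'n) ^ ('n \<times> 'n) \<Rightarrow> _)"
    "trace_preserving (encoder p :: complex ^ 'n ^ 'n \<Rightarrow> _)"
    "F_opt (max_mixed :: complex ^ 'n ^ 'n) (noise_map p :: complex ^ ('n \<times> 'n) ^ ('n \<times> 'n) \<Rightarrow> _) = lam1 (real CARD('n)) p"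
proof -
  let ?N = "noise_map p :: complex ^ ('n \<times> 'n) ^ ('n \<times> 'n) \<Rightarrow> _"
  let ?E = "encoder p :: complex ^ 'n ^ 'n \<Rightarrow> _"
  let ?T = "tr_S :: complex ^ ('n \<times> 'n) ^ ('n \<times> 'n) \<Rightarrow> _"
  show tp: "trace_preserving ?E"
    by (rule trace_preserving_kraus_on[OF kraus_on_encoder sum_adj_C_op[OF n p]])
  show E: "cptni ?E"
    by (rule cptni_if_trace_preserving[OF completely_positive_kraus_on[OF kraus_on_encoder] tp])
  show T: "cptni ?T"
    by (rule cptni_if_trace_preserving[OF completely_positive_kraus_on[OF kraus_on_tr_S]
          trace_preserving_kraus_on[OF kraus_on_tr_S sum_adj_D_op]])
  show "F_opt (max_mixed :: complex ^ 'n ^ 'n) ?N = lam1 (real CARD('n)) p"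
    unfolding F_opt_def
  proof (rule cSup_eq_maximum)
    show "lam1 (real CARD('n)) p \<in> {entanglement_fidelity (max_mixed :: complex ^ 'n ^ 'n) (D \<circ> ?N \<circ> C) |C D. cptni C \<and> cptni D}"
      using fidelity_attained[OF n p] E T by (intro CollectI exI[of _ ?E] exI[of _ ?T]) simp
    fix r assume "r \<in> {entanglement_fidelity (max_mixed :: complex ^ 'n ^ 'n) (D \<circ> ?N \<circ> C) |C D. cptni C \<and> cptni D}"
    then obtain C :: "complex ^ 'n ^ 'n \<Rightarrow> _" and D
      where CD: "r = entanglement_fidelity max_mixed (D \<circ> ?N \<circ> C)" "cptni C" "cptni D"
      by blast
    obtain K :: "'n \<times> ('n \<times> 'n) \<Rightarrow> _" where K: "kraus_on UNIV K C" using cptni_kraus_on[OF CD(2)] .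
    obtain L :: "('n \<times> 'n) \<times> 'n \<Rightarrow> _" where L: "kraus_on UNIV L D" using cptni_kraus_on[OF CD(3)] .
    show "r \<le> lam1 (real CARD('n)) p"
      unfolding CD(1) by (rule fidelity_le[OF n p K CD(2) L CD(3)])
  qed
qed

lemma optimal_encoder:
  fixes p :: real and C :: "complex ^ 'n::finite ^ 'n \<Rightarrow> complex ^ ('n \<times> 'n) ^ ('n \<times> 'n)"
  assumes n: "2 \<le> CARD('n)" and p0: "0 < p" and p1: "p < 1" and CD: "cptni C" "cptni D"
    and opt: "entanglement_fidelity max_mixed (D \<circ> noise_map p \<circ> C) = lam1 (real CARD('n)) p"
  shows "\<exists>U. unitary U \<and> C = encoder p \<circ> unitary_channel U"
    "CARD('n) \<le> choi_rank C"
    "norm \<phi> = 1 \<Longrightarrow> density (C (ketbra \<phi> \<phi>))"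
    "norm \<phi> = 1 \<Longrightarrow> rank (C (ketbra \<phi> \<phi>)) = CARD('n)"
    "trace_preserving C"
    "kraus Cs C \<Longrightarrow> entropy_exchange Cs max_mixed = log 2 (real CARD('n))"
proof -
  have p: "0 \<le> p" using p0 by simp
  obtain L :: "('n \<times> 'n) \<times> 'n \<Rightarrow> _" where L: "kraus_on UNIV L D" using cptni_kraus_on[OF CD(2)] .
  \<comment> \<open>U and m depend on the Kraus list, so the structure is stated for every list: a
    minimal one bounds the Choi rank, and an arbitrary one is needed for the entropy
    exchange.\<close>
  have struct: "\<exists>U m. unitary U \<and> (\<forall>i<length Ks. Ks ! i = Q_op p ** emb (m i) ** adj U)
      \<and> (\<Sum>i<length Ks. ketbra (m i) (m i)) = mat 1" if "kraus Ks C" for Ks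
    using opt_structure[OF n p p1 that[unfolded kraus_iff_kraus_on] CD(1) L CD(2) opt p0]
    by (metis lessThan_iff)
  obtain Ks where Ks: "kraus Ks C" "length Ks = choi_rank C" using kraus_choi_rank[OF CD(1)] .
  obtain U m where U: "unitary U" "\<And>i. i < length Ks \<Longrightarrow> Ks ! i = Q_op p ** emb (m i) ** adj U"
    "(\<Sum>i<length Ks. ketbra (m i) (m i)) = mat 1" using struct[OF Ks(1)] by blast
  have U2: "\<And>i. i \<in> {..<length Ks} \<Longrightarrow> Ks ! i = Q_op p ** emb (m i) ** adj U" using U(2) by simp
  note hyps = n p p1 Ks(1)[unfolded kraus_iff_kraus_on] U(1) U2 U(3)
  have "unitary (adj U)" using U(1) by (simp add: unitary_def)
  then show "\<exists>U. unitary U \<and> C = encoder p \<circ> unitary_channel U"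
    using encoder_form[OF hyps] by blast
  show "CARD('n) \<le> choi_rank C" using card_le_resolution[OF _ U(3)] Ks(2) by simp
  show "norm \<phi> = 1 \<Longrightarrow> density (C (ketbra \<phi> \<phi>))" by (rule output_density[OF hyps])
  show "norm \<phi> = 1 \<Longrightarrow> rank (C (ketbra \<phi> \<phi>)) = CARD('n)" by (rule output_rank[OF hyps])
  show "trace_preserving C" by (rule output_trace_preserving[OF hyps])
  assume Cs: "kraus Cs C"
  obtain U' m' where "unitary U'" "\<And>i. i < length Cs \<Longrightarrow> Cs ! i = Q_op p ** emb (m' i) ** adj U'"
    "(\<Sum>i<length Cs. ketbra (m' i) (m' i)) = mat 1" using struct[OF Cs] by blast
  then show "entropy_exchange Cs max_mixed = log 2 (real CARD('n))"
    by (rule entropy_exchange_optimal[OF n p p1 Cs])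
qed

lemma Delta_opt_pos:
  fixes p :: real
  assumes n: "2 \<le> CARD('n::finite)" and p: "0 < p" "p < 1"
  shows "Delta_opt (max_mixed :: complex ^ 'n ^ 'n) (noise_map p :: complex ^ ('n \<times> 'n) ^ ('n \<times> 'n) \<Rightarrow> _) > 0"
proof -
  have p0: "0 \<le> p" using p by simp
  let ?N = "noise_map p :: complex ^ ('n \<times> 'n) ^ ('n \<times> 'n) \<Rightarrow> _"
  obtain C :: "complex ^ 'n ^ 'n \<Rightarrow> complex ^ ('n \<times> 'n) ^ ('n \<times> 'n)" and D
    where CD: "cptni C" "cptni D" "choi_rank C \<le> 1"
      "F1_opt (max_mixed :: complex ^ 'n ^ 'n) ?N = entanglement_fidelity max_mixed (D \<circ> ?N \<circ> C)"
    using F1_attained[OF n p0 p(2)] by blast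
  obtain K :: "'n \<times> ('n \<times> 'n) \<Rightarrow> _" where K: "kraus_on UNIV K C" using cptni_kraus_on[OF CD(1)] .
  obtain L :: "('n \<times> 'n) \<times> 'n \<Rightarrow> _" where L: "kraus_on UNIV L D" using cptni_kraus_on[OF CD(2)] .
  have "F1_opt (max_mixed :: complex ^ 'n ^ 'n) ?N \<le> lam1 (real CARD('n)) p"
    unfolding CD(4) by (rule fidelity_le[OF n p0 p(2) K CD(1) L CD(2)])
  moreover have "F1_opt (max_mixed :: complex ^ 'n ^ 'n) ?N \<noteq> lam1 (real CARD('n)) p"
    using optimal_encoder(2)[OF n p CD(1,2)] CD(3,4) n by auto
  ultimately show ?thesis by (simp add: Delta_opt_def F_opt_noise_map(4)[OF n p0 p(2)])
qed

theorem mainTheorem4: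
  fixes p :: real
  assumes "2 \<le> CARD('n::finite)" and "0 \<le> p" and "p < 1"
  shows "let \<tau> = (max_mixed :: complex ^ 'n ^ 'n);
             d = real CARD('n);
             N = (noise_map p :: complex ^ ('n \<times> 'n) ^ ('n \<times> 'n) \<Rightarrow> complex ^ ('n \<times> 'n) ^ ('n \<times> 'n));
             C\<^sub>p = (encoder p :: complex ^ 'n ^ 'n \<Rightarrow> complex ^ ('n \<times> 'n) ^ ('n \<times> 'n))
    in (completely_positive N \<and> trace_preserving N
        \<and> completely_positive C\<^sub>p \<and> trace_preserving C\<^sub>p
        \<and> cptni C\<^sub>p \<and> cptni (tr_S :: _ \<Rightarrow> complex ^ 'n ^ 'n)
        \<and> entanglement_fidelity \<tau> (tr_S \<circ> N \<circ> C\<^sub>p) = F_opt \<tau> N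
        \<and> F_opt \<tau> N = 1 - p / (d\<^sup>2 - 2)
        \<and> eps_opt \<tau> N = p / (d\<^sup>2 - 2))
     \<and> (0 < p \<longrightarrow>
          Delta_opt \<tau> N > 0
        \<and> (\<forall>C D. cptni C \<and> cptni D \<and> entanglement_fidelity \<tau> (D \<circ> N \<circ> C) = F_opt \<tau> N \<longrightarrow>
              (\<exists>U. unitary U \<and> C = C\<^sub>p \<circ> unitary_channel U)
            \<and> CARD('n) \<le> choi_rank C
            \<and> (\<forall>\<phi>. norm \<phi> = 1 \<longrightarrow>
                  density (C (ketbra \<phi> \<phi>)) \<and> rank (C (ketbra \<phi> \<phi>)) = CARD('n)
                \<and> \<not> (\<exists>\<xi>. norm \<xi> = 1 \<and> C (ketbra \<phi> \<phi>) = ketbra \<xi> \<xi>))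
            \<and> trace_preserving C
            \<and> (\<forall>Cs. kraus Cs C \<longrightarrow> entropy_exchange Cs \<tau> = log 2 d)))"
proof -
  let ?N = "noise_map p :: complex ^ ('n \<times> 'n) ^ ('n \<times> 'n) \<Rightarrow> complex ^ ('n \<times> 'n) ^ ('n \<times> 'n)"
  let ?E = "encoder p :: complex ^ 'n ^ 'n \<Rightarrow> complex ^ ('n \<times> 'n) ^ ('n \<times> 'n)"
  note opt = F_opt_noise_map[OF assms]
  have lam: "lam1 (real CARD('n)) p = 1 - p / ((real CARD('n))\<^sup>2 - 2)" by (simp add: lam1_def)
  have cpN: "completely_positive ?N"
    using noise_map_kraus[OF assms] completely_positive_kraus_on by blast
  have part1: "completely_positive ?N \<and> trace_preserving ?N
        \<and> completely_positive ?E \<and> trace_preserving ?E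
        \<and> cptni ?E \<and> cptni (tr_S :: _ \<Rightarrow> complex ^ 'n ^ 'n)
        \<and> entanglement_fidelity max_mixed (tr_S \<circ> ?N \<circ> ?E) = F_opt (max_mixed :: complex ^ 'n ^ 'n) ?N
        \<and> F_opt (max_mixed :: complex ^ 'n ^ 'n) ?N = 1 - p / ((real CARD('n))\<^sup>2 - 2)
        \<and> eps_opt (max_mixed :: complex ^ 'n ^ 'n) ?N = p / ((real CARD('n))\<^sup>2 - 2)"
    using cpN noise_map_trace_preserving[OF assms] opt fidelity_attained[OF assms] lam
      completely_positive_kraus_on[OF kraus_on_encoder]
    by (simp add: eps_opt_def)
  have part2: "(\<exists>U. unitary U \<and> C = ?E \<circ> unitary_channel U)
            \<and> CARD('n) \<le> choi_rank C
            \<and> (\<forall>\<phi>. norm \<phi> = 1 \<longrightarrow>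
                  density (C (ketbra \<phi> \<phi>)) \<and> rank (C (ketbra \<phi> \<phi>)) = CARD('n)
                \<and> \<not> (\<exists>\<xi>. norm \<xi> = 1 \<and> C (ketbra \<phi> \<phi>) = ketbra \<xi> \<xi>))
            \<and> trace_preserving C
            \<and> (\<forall>Cs. kraus Cs C \<longrightarrow> entropy_exchange Cs max_mixed = log 2 (real CARD('n)))"
    if p0: "0 < p" and CD: "cptni C" "cptni D"
      and F: "entanglement_fidelity max_mixed (D \<circ> ?N \<circ> C) = F_opt (max_mixed :: complex ^ 'n ^ 'n) ?N" for C D
  proof -
    note * = optimal_encoder[OF assms(1) p0 assms(3) CD F[unfolded opt(4)]]
    \<comment> \<open>A pure output would have rank at most 1, whereas the rank is d \<ge>
      2.\<close>
    have "\<not> (\<exists>\<xi>. norm \<xi> = 1 \<and> C (ketbra \<phi> \<phi>) = ketbra \<xi> \<xi>)" if "norm \<phi> = 1" for \<phi>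
    proof
      assume "\<exists>\<xi>. norm \<xi> = 1 \<and> C (ketbra \<phi> \<phi>) = ketbra \<xi> \<xi>"
      then obtain \<xi> where "C (ketbra \<phi> \<phi>) = ketbra \<xi> \<xi>" by blast
      then have "CARD('n) \<le> 1" using *(4)[OF that] rank_ketbra_le[of \<xi> \<xi>] by simp
      then show False using assms(1) by simp
    qed
    then show ?thesis using * by blast
  qed
  show ?thesis
    unfolding Let_def using part1 part2 Delta_opt_pos[OF assms(1) _ assms(3)] by blast
qed

end
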